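(* Fix $s\in(0,\infty)$. Among all measurable subsets $\Omega\subset\mathbb{R}^2$ with Lebesgue measure $|\Omega|=s$, the quantity $$\Phi_\Omega:=\max_{f\in L^2(\mathbb{R})\setminus\{0\}}\frac{\int_\Omega|\mathcal{V}f(x,\omega)|^2\,dx\,d\omega}{\int_{\mathbb{R}^2}|\mathcal{V}f(x,\omega)|^2\,dx\,d\omega}=\max_{f\in L^2(\mathbb{R})\setminus\{0\}}\frac{\langle \mathcal{V}^*\mathbf{1}_\Omega\mathcal{V}f,f\rangle}{\|f\|_{L^2}^2}$$ achieves its maximum if and only if $\Omega$ is equivalent, up to a set of measure zero, to a ball (i.e. a Euclidean disc in $\mathbb{R}^2$). Moreover, when $\Omega$ is a ball of center $(x_0,\omega_0)$, the only functions $f$ that achieve the maximum over $f$ in the definition of $\Phi_\Omega$ are the functions of the kind $$f(x)=c\,e^{2\pi i\omega_0x}\varphi(x-x_0),\qquad c\in\mathbb{C}\setminus\{0\}.$$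
   Context: The Gaussian window is $\varphi(x)=2^{1/4}e^{-\pi x^2}$, $x\in\mathbb{R}$ (so $\|\varphi\|_{L^2}=1$). The Short-time Fourier transform (STFT) of $f\in L^2(\mathbb{R})$ is $$\mathcal{V}f(x,\omega)=\int_{\mathbb{R}}e^{-2\pi iy\omega}f(y)\varphi(x-y)\,dy,\qquad x,\omega\in\mathbb{R}.$$ The map $\mathcal{V}:L^2(\mathbb{R})\to L^2(\mathbb{R}^2)$ is an isometry, $\mathcal{V}^*$ is its adjoint, and $\mathbf{1}_\Omega$ denotes both the indicator function of $\Omega$ and the operator of multiplication by it. Functions are complex valued. *)

theory Defs
  imports "HOL-Analysis.Analysis"
begin

text \<open>
  Elements of \<open>L\<^sup>2\<close> are represented by Lebesgue measurable functions, so that equality in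
  \<open>L\<^sup>2\<close> is equality almost everywhere.
\<close>

definition L2_space :: "('a::euclidean_space \<Rightarrow> complex) set" where
  "L2_space = {f. f \<in> borel_measurable lebesgue \<and> integrable lebesgue (\<lambda>x. (norm (f x))\<^sup>2)}"

definition L2_nonzero :: "('a::euclidean_space \<Rightarrow> complex) set" where
  "L2_nonzero = {f \<in> L2_space. \<not> (AE x in lebesgue. f x = 0)}"

definition L2_inner :: "('a::euclidean_space \<Rightarrow> complex) \<Rightarrow> ('a \<Rightarrow> complex) \<Rightarrow> complex" where
  "L2_inner f g = (LINT x|lebesgue. f x * cnj (g x))"

definition L2_norm :: "('a::euclidean_space \<Rightarrow> complex) \<Rightarrow> real" where
  "L2_norm f = sqrt (LINT x|lebesgue. (norm (f x))\<^sup>2)"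

definition gaussian :: "real \<Rightarrow> real" where
  "gaussian x = 2 powr (1 / 4) * exp (- pi * x\<^sup>2)"

definition stft :: "(real \<Rightarrow> complex) \<Rightarrow> real \<times> real \<Rightarrow> complex" where
  "stft f = (\<lambda>(x, \<omega>). LINT y|lebesgue.
     exp (- 2 * of_real pi * \<i> * of_real y * of_real \<omega>) * f y * of_real (gaussian (x - y)))"

text \<open>
  The Hilbert space adjoint of \<^const>\<open>stft\<close>, determined up to equality almost everywhere;
  it is meaningful for \<open>F\<close> in \<open>L\<^sup>2(\<real>\<^sup>2)\<close>.
\<close>

definition stft_adjoint :: "(real \<times> real \<Rightarrow> complex) \<Rightarrow> real \<Rightarrow> complex" where
  "stft_adjoint F =
     (SOME g. g \<in> L2_space \<and> (\<forall>f\<in>L2_space. L2_inner (stft f) F = L2_inner f g))"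

definition concentration :: "(real \<times> real) set \<Rightarrow> (real \<Rightarrow> complex) \<Rightarrow> real" where
  "concentration \<Omega> f =
     (LINT z:\<Omega>|lebesgue. (norm (stft f z))\<^sup>2) / (LINT z|lebesgue. (norm (stft f z))\<^sup>2)"

text \<open>
  The operator below is self-adjoint, so its quadratic form is real; \<^const>\<open>Re\<close> only
  serves to obtain a value of type \<^typ>\<open>real\<close>.
\<close>

definition rayleigh_quotient :: "(real \<times> real) set \<Rightarrow> (real \<Rightarrow> complex) \<Rightarrow> real" where
  "rayleigh_quotient \<Omega> f =
     Re (L2_inner (stft_adjoint (\<lambda>z. indicator \<Omega> z * stft f z)) f) / (L2_norm f)\<^sup>2"

definition \<Phi> :: "(real \<times> real) set \<Rightarrow> real" where
  "\<Phi> \<Omega> = (SUP f\<in>L2_nonzero. concentration \<Omega> f)"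

end

theory Submission
  imports Defs "HOL-Probability.Probability" "HOL-Complex_Analysis.Complex_Analysis" "HOL-Real_Asymp.Real_Asymp"
begin

text \<open>
  Up to the factor \<open>exp (- pi |z|\<^sup>2 / 2)\<close> the modulus of the short-time Fourier transform of \<open>f\<close> is that of an
  entire function, so \<open>u = |V f|\<^sup>2\<close> satisfies \<open>\<Delta> (ln u) = - 4 \<pi>\<close> where it does not vanish. Integrating
  \<open>|\<nabla> u|\<close> over a shell between two level sets, the isoperimetric inequality, the divergence theorem and the
  Cauchy--Schwarz inequality show that \<open>\<mu>(r) + ln r\<close> is nonincreasing for \<open>r < max u\<close>, where \<open>\<mu>(r)\<close> is the
  area of \<open>{u > r}\<close>; for a time-frequency shifted Gaussian it vanishes for \<open>r < 1\<close>. As \<open>\<integral> \<mu> = \<integral> u = 1\<close> for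
  normalised \<open>f\<close>, the functions \<open>\<mu>\<close> and \<open>- ln\<close> cross at most once, hence
  \<open>\<integral>\<^sub>\<Omega> u \<le> 1 - exp (- |\<Omega>|)\<close>, strictly if \<open>max u < 1\<close>. If \<open>max u = 1\<close>, equality in the
  Cauchy--Schwarz inequality makes \<open>f\<close> a shifted Gaussian. Maximisers for a fixed \<open>\<Omega>\<close> exist because a
  maximising sequence converges pointwise, along a subsequence, by Montel's theorem, and the localisation
  operator upgrades this to a maximiser.
\<close>

section \<open>The Brunn--Minkowski inequality for a planar set and a disc\<close>

text \<open>The obstacle is regularity: differentiating the area of a superlevel set would call for
  smooth level curves and the coarea formula. Both are avoided by finite differences: a cut-off
  function of \<open>ln u\<close> that rises from 0 to 1 between two levels is fed both to the
  Sobolev form of the isoperimetric inequality and to the divergence theorem, and only the areas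
  above the two levels survive. The zeros of \<open>u\<close>, where \<open>ln u\<close> is
  singular, lie below every level considered. The isoperimetric constant \<open>4 * pi\<close>
  cancels against the \<open>4 * pi\<close> of the Laplacian; this leaves the rate 1 and hence the
  comparison function \<open>- ln\<close>, the area function of the Gaussian. The set
  \<open>\<Omega>\<close> enters through the bathtub bound: the integral of \<open>u\<close> over a
  set of area \<open>s\<close> is at most that of the positive part of \<open>u - \<tau>\<close>
  plus \<open>\<tau> * s\<close>. The choice \<open>\<tau> = exp (- s)\<close> is the level at which
  the Gaussian has a superlevel disc of area \<open>s\<close>. No equality case of the isoperimetric
  inequality is examined: extremality is decided by whether \<open>u\<close> reaches the
  Cauchy--Schwarz bound at some point.\<close>

lemma nn_integral_layer_cake:
  fixes f :: "'a \<Rightarrow> real"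
  assumes "sigma_finite_measure M" and f[measurable]: "f \<in> borel_measurable M"
  shows "(\<integral>\<^sup>+x. ennreal (f x) \<partial>M)
    = (\<integral>\<^sup>+t. indicator {0<..} t * emeasure M {x \<in> space M. t < f x} \<partial>lborel)"
proof -
  interpret M: sigma_finite_measure M by fact
  interpret pair_sigma_finite M lborel ..
  have "(\<integral>\<^sup>+x. ennreal (f x) \<partial>M) =
      (\<integral>\<^sup>+x. (\<integral>\<^sup>+t. indicator {0<..} t * indicator {x\<in>space M. t < f x} x \<partial>lborel) \<partial>M)"
  proof (rule nn_integral_cong)
    fix x assume x: "x \<in> space M"
    have "(\<integral>\<^sup>+t. indicator {0<..} t * indicator {x\<in>space M. t < f x} x \<partial>lborel)
        = (\<integral>\<^sup>+t. indicator {0<..<f x} t \<partial>lborel)"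
      using x by (intro nn_integral_cong) (auto split: split_indicator)
    also have "\<dots> = emeasure lborel {0<..<f x}" by simp
    also have "\<dots> = ennreal (f x)"
      by (cases "0 \<le> f x") (auto simp: ennreal_neg)
    finally show "ennreal (f x) =
      (\<integral>\<^sup>+t. indicator {0<..} t * indicator {x\<in>space M. t < f x} x \<partial>lborel)" by simp
  qed
  also have "\<dots> = (\<integral>\<^sup>+t. (\<integral>\<^sup>+x. indicator {0<..} t * indicator {x\<in>space M. t < f x} x \<partial>M) \<partial>lborel)"
    by (rule Fubini'[symmetric]) simp
  also have "\<dots> = (\<integral>\<^sup>+t. indicator {0<..} t * emeasure M {x \<in> space M. t < f x} \<partial>lborel)"
    by (intro nn_integral_cong) (simp add: nn_integral_cmult)
  finally show ?thesis .
qed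

text \<open>Levels are counted as fractions \<open>t\<close> of \<open>k\<close>, so that functions
  of different height can be compared at the same \<open>t\<close>: the section lengths of a set, of
  its thickening and of the disc are sliced with \<open>k\<close> equal to \<open>M\<close>,
  \<open>M + 2 * e\<close> and \<open>2 * e\<close>.\<close>

lemma nn_integral_layer_cake_scaled:
  fixes f :: "'a \<Rightarrow> real"
  assumes "sigma_finite_measure M" and f[measurable]: "f \<in> borel_measurable M" and "0 < k"
  shows "(\<integral>\<^sup>+x. ennreal (f x) \<partial>M)
    = ennreal k * (\<integral>\<^sup>+t. indicator {0<..} t * emeasure M {x \<in> space M. t * k < f x} \<partial>lborel)"
proof -
  interpret M: sigma_finite_measure M by fact
  have "(\<integral>\<^sup>+x. ennreal (f x) \<partial>M) = (\<integral>\<^sup>+x. ennreal k * ennreal (f x / k) \<partial>M)"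
    using \<open>0 < k\<close> by (intro nn_integral_cong) (simp add: ennreal_mult'[symmetric])
  also have "\<dots> = ennreal k * (\<integral>\<^sup>+x. ennreal (f x / k) \<partial>M)"
    by (rule nn_integral_cmult) simp
  also have "(\<integral>\<^sup>+x. ennreal (f x / k) \<partial>M) =
      (\<integral>\<^sup>+t. indicator {0<..} t * emeasure M {x \<in> space M. t < f x / k} \<partial>lborel)"
    by (rule nn_integral_layer_cake) (use assms in auto)
  finally show ?thesis
    using \<open>0 < k\<close> by (simp add: field_simps)
qed

text \<open>Brunn--Minkowski on the line: besides \<open>U\<close> the thickening contains an open
  interval of length \<open>r\<close> beyond \<open>Sup U\<close> and another one below
  \<open>Inf U\<close>.\<close>

lemma emeasure_thickening_real:
  fixes U :: "real set"
  assumes "U \<in> sets borel" "bounded U" "U \<noteq> {}" "0 < r"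
  shows "emeasure lborel U + ennreal (2 * r) \<le> emeasure lborel (\<Union>u\<in>U. ball u r)"
proof -
  define a b where "a = Inf U" and "b = Sup U"
  have bdd: "bdd_above U" "bdd_below U"
    using assms(2) by (simp_all add: bounded_imp_bdd_above bounded_imp_bdd_below)
  have ab: "a \<le> u" "u \<le> b" if "u \<in> U" for u
    using that bdd unfolding a_def b_def by (auto intro: cInf_lower cSup_upper)
  then have "a \<le> b" using assms(3) by fastforce
  have sub: "(U \<union> {b<..<b+r}) \<union> {a-r<..<a} \<subseteq> (\<Union>u\<in>U. ball u r)"
  proof -
    have "x \<in> (\<Union>u\<in>U. ball u r)" if "b < x" "x < b + r" for x
    proof -
      have "x - r < Sup U" using that by (simp add: b_def)
      then obtain u where "u \<in> U" "x - r < u" using less_cSup_iff[OF assms(3) bdd(1)] by auto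
      moreover have "u < x" using ab[OF \<open>u \<in> U\<close>] that by simp
      ultimately show ?thesis by (auto simp: dist_real_def intro!: bexI[of _ u])
    qed
    moreover have "x \<in> (\<Union>u\<in>U. ball u r)" if "a - r < x" "x < a" for x
    proof -
      have "Inf U < x + r" using that by (simp add: a_def)
      then obtain u where "u \<in> U" "u < x + r" using cInf_less_iff[OF assms(3) bdd(2)] by auto
      moreover have "x < u" using ab[OF \<open>u \<in> U\<close>] that by simp
      ultimately show ?thesis by (auto simp: dist_real_def intro!: bexI[of _ u])
    qed
    ultimately show ?thesis using \<open>0 < r\<close> by auto
  qed
  have "emeasure lborel ((U \<union> {b<..<b+r}) \<union> {a-r<..<a})
      = emeasure lborel U + ennreal r + ennreal r"
  proof -
    have "emeasure lborel ((U \<union> {b<..<b+r}) \<union> {a-r<..<a})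
        = emeasure lborel (U \<union> {b<..<b+r}) + emeasure lborel {a-r<..<a}"
      using assms(1) ab \<open>a \<le> b\<close> by (intro plus_emeasure[symmetric]) fastforce+
    also have "emeasure lborel (U \<union> {b<..<b+r}) = emeasure lborel U + emeasure lborel {b<..<b+r}"
      using assms(1) ab by (intro plus_emeasure[symmetric]) fastforce+
    finally show ?thesis using \<open>0 < r\<close> by simp
  qed
  also have "\<dots> = emeasure lborel U + ennreal (2 * r)"
    using \<open>0 < r\<close> by (simp add: add.assoc ennreal_plus[symmetric] del: ennreal_plus)
  finally show ?thesis
    using emeasure_mono[OF sub, of lborel] by (simp add: borel_open open_UN)
qed

lemma sets_borel_Pair_vimage [intro]:
  fixes W :: "('a::second_countable_topology \<times> 'b::second_countable_topology) set"
  assumes "W \<in> sets borel"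
  shows "Pair x -` W \<in> sets borel"
proof -
  have "Pair x \<in> borel_measurable borel"
    by (intro borel_measurable_continuous_onI continuous_intros)
  from measurable_sets[OF this assms] show ?thesis by simp
qed

lemma emeasure_plane_sections:
  assumes "W \<in> sets (borel :: ('a::euclidean_space \<times> 'b::euclidean_space) measure)"
  shows "emeasure lborel W = (\<integral>\<^sup>+x. emeasure lborel (Pair x -` W) \<partial>lborel)"
proof -
  have "W \<in> sets (lborel \<Otimes>\<^sub>M lborel)" using assms by (metis lborel_prod sets_lborel)
  then show ?thesis by (metis lborel.emeasure_pair_measure_alt lborel_prod)
qed

lemma emeasure_plane_sections2:
  assumes "W \<in> sets (borel :: ('a::euclidean_space \<times> 'b::euclidean_space) measure)"
  shows "emeasure lborel W = (\<integral>\<^sup>+y. emeasure lborel ((\<lambda>x. (x, y)) -` W) \<partial>lborel)"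
proof -
  have "W \<in> sets (lborel \<Otimes>\<^sub>M lborel)" using assms by (metis lborel_prod sets_lborel)
  then show ?thesis by (metis lborel_pair.emeasure_pair_measure_alt2 lborel_prod)
qed

lemma borel_measurable_measure_Pair [measurable]:
  fixes W :: "('a::euclidean_space \<times> 'b::euclidean_space) set"
  assumes "W \<in> sets borel"
  shows "(\<lambda>x. measure lborel (Pair x -` W)) \<in> borel_measurable borel"
proof -
  have "W \<in> sets (lborel \<Otimes>\<^sub>M lborel)" using assms by (metis lborel_prod sets_lborel)
  then have "(\<lambda>x. emeasure lborel (Pair x -` W)) \<in> borel_measurable lborel"
    by (rule lborel.measurable_emeasure_Pair)
  then show ?thesis unfolding measure_def by measurable
qed

text \<open>The chord of the disc at abscissa \<open>x\<close> exceeds the fraction \<open>t\<close>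
  of the diameter exactly when \<open>\<bar>x\<bar> < e * sqrt (1 - t\<^sup>2)\<close>. Slicing the
  area of the disc by these levels gives the value of the integral that occurs in the planar
  argument.\<close>

lemma emeasure_disc_eq_caps:
  assumes "0 < e"
  shows "ennreal (2 * e) * (\<integral>\<^sup>+t. indicator {0<..<1} t * ennreal (2 * (e * sqrt (1 - t\<^sup>2))) \<partial>lborel)
    = ennreal (pi * e\<^sup>2)"
proof -
  have sec: "emeasure lborel (Pair x -` ball (0::real\<times>real) e) = ennreal (2 * sqrt (e\<^sup>2 - x\<^sup>2))" for x
  proof -
    have "Pair x -` ball (0::real\<times>real) e = {- sqrt (e\<^sup>2 - x\<^sup>2) <..< sqrt (e\<^sup>2 - x\<^sup>2)}"
    proof -
      have "sqrt (x\<^sup>2 + y\<^sup>2) < e \<longleftrightarrow> \<bar>y\<bar> < sqrt (e\<^sup>2 - x\<^sup>2)" for y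
      proof -
        have "sqrt (x\<^sup>2 + y\<^sup>2) < e \<longleftrightarrow> sqrt (x\<^sup>2 + y\<^sup>2) < sqrt (e\<^sup>2)" using assms by simp
        also have "\<dots> \<longleftrightarrow> sqrt (y\<^sup>2) < sqrt (e\<^sup>2 - x\<^sup>2)"
          unfolding real_sqrt_less_iff by (auto simp: algebra_simps)
        finally show ?thesis by simp
      qed
      then show ?thesis by (auto simp: dist_norm norm_Pair)
    qed
    then show ?thesis by (cases "0 \<le> sqrt (e\<^sup>2 - x\<^sup>2)") (auto simp: ennreal_neg)
  qed
  have lev: "{x. t * (2 * e) < 2 * sqrt (e\<^sup>2 - x\<^sup>2)} = {- (e * sqrt (1 - t\<^sup>2))<..<e * sqrt (1 - t\<^sup>2)}"
    if "0 < t" for t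
  proof -
    have "t * (2 * e) < 2 * sqrt (e\<^sup>2 - x\<^sup>2) \<longleftrightarrow> \<bar>x\<bar> < e * sqrt (1 - t\<^sup>2)" for x
    proof -
      have "t * (2 * e) < 2 * sqrt (e\<^sup>2 - x\<^sup>2) \<longleftrightarrow> sqrt ((t * e)\<^sup>2) < sqrt (e\<^sup>2 - x\<^sup>2)"
        using that assms by simp
      also have "\<dots> \<longleftrightarrow> sqrt (x\<^sup>2) < sqrt (e\<^sup>2 * (1 - t\<^sup>2))"
        unfolding real_sqrt_less_iff by (auto simp: algebra_simps)
      also have "sqrt (e\<^sup>2 * (1 - t\<^sup>2)) = e * sqrt (1 - t\<^sup>2)"
        using assms by (simp add: real_sqrt_mult)
      finally show ?thesis by simp
    qed
    then have "{x. t * (2 * e) < 2 * sqrt (e\<^sup>2 - x\<^sup>2)} = {x. \<bar>x\<bar> < e * sqrt (1 - t\<^sup>2)}"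
      by (simp only:)
    moreover have "{x. \<bar>x\<bar> < r} = {-r<..<r}" for r :: real by auto
    ultimately show ?thesis by (simp only:)
  qed
  have "ennreal (pi * e\<^sup>2) = emeasure lborel (ball (0::real\<times>real) e)"
    using assms by (subst emeasure_ball) (auto simp: unit_ball_vol_2 power2_eq_square)
  also have "\<dots> = (\<integral>\<^sup>+x. ennreal (2 * sqrt (e\<^sup>2 - x\<^sup>2)) \<partial>lborel)"
    by (subst emeasure_plane_sections) (simp_all only: sec borel_open open_ball)
  also have "\<dots> = ennreal (2 * e) * (\<integral>\<^sup>+t. indicator {0<..} t *
      emeasure lborel {x \<in> space lborel. t * (2 * e) < 2 * sqrt (e\<^sup>2 - x\<^sup>2)} \<partial>lborel)"
    using assms by (intro nn_integral_layer_cake_scaled) (auto simp: lborel.sigma_finite_measure_axioms)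
  also have "(\<integral>\<^sup>+t. indicator {0<..} t *
      emeasure lborel {x \<in> space lborel. t * (2 * e) < 2 * sqrt (e\<^sup>2 - x\<^sup>2)} \<partial>lborel)
     = (\<integral>\<^sup>+t. indicator {0<..<1} t * ennreal (2 * (e * sqrt (1 - t\<^sup>2))) \<partial>lborel)"
  proof (rule nn_integral_cong)
    fix t :: real
    show "indicator {0<..} t * emeasure lborel {x \<in> space lborel. t * (2 * e) < 2 * sqrt (e\<^sup>2 - x\<^sup>2)}
      = indicator {0<..<1} t * ennreal (2 * (e * sqrt (1 - t\<^sup>2)))"
    proof (cases "0 < t")
      case True
      then have L: "{x \<in> space lborel. t * (2 * e) < 2 * sqrt (e\<^sup>2 - x\<^sup>2)}
          = {- (e * sqrt (1 - t\<^sup>2))<..<e * sqrt (1 - t\<^sup>2)}"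
        using lev by (simp only: space_lborel space_borel UNIV_I simp_thms)
      show ?thesis
      proof (cases "t < 1")
        case True
        then have "0 \<le> e * sqrt (1 - t\<^sup>2)" using \<open>0 < t\<close> assms by (simp add: power_le_one)
        then show ?thesis unfolding L using True \<open>0 < t\<close> by simp
      next
        case False
        then have "1 \<le> t\<^sup>2" by (simp add: one_le_power)
        then have "e * sqrt (1 - t\<^sup>2) \<le> 0" using assms by (simp add: mult_le_0_iff)
        then have "{- (e * sqrt (1 - t\<^sup>2))<..<e * sqrt (1 - t\<^sup>2)} = {}" by auto
        then show ?thesis unfolding L using False \<open>0 < t\<close> by simp
      qed
    qed simp
  qed
  finally show ?thesis ..
qed

text \<open>Bonnesen's argument: superlevel
  sets of the section lengths, normalised by their suprema, are added on the line.\<close>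

lemma emeasure_thickening_plane:
  fixes A :: "(real \<times> real) set"
  assumes "open A" "bounded A" "0 < e"
  shows "emeasure lborel A + ennreal (2 * e * sqrt (pi * measure lborel A))
    \<le> emeasure lborel (\<Union>z\<in>A. ball z e)"
proof (cases "A = {}")
  case False
  define W where "W = (\<Union>z\<in>A. ball z e)"
  have "open W" unfolding W_def by auto
  have [measurable]: "A \<in> sets borel" "W \<in> sets borel" using assms \<open>open W\<close> by auto
  obtain R where R: "\<And>z. z \<in> A \<Longrightarrow> norm z \<le> R" using assms(2) bounded_iff by blast
  have secb: "Pair x -` A \<subseteq> {-R..R}" for x
  proof
    fix y assume "y \<in> Pair x -` A"
    then have "norm y \<le> R" using R[of "(x,y)"] norm_snd_le[of y x] by force
    then show "y \<in> {-R..R}" by auto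
  qed
  have secm[measurable]: "Pair x -` A \<in> sets borel" for x
    by (rule sets_borel_Pair_vimage) simp
  define a where "a x = measure lborel (Pair x -` A)" for x
  have ea: "emeasure lborel (Pair x -` A) = ennreal (a x)" for x
  proof -
    have "emeasure lborel (Pair x -` A) \<le> emeasure lborel {-R..R}"
      using secb by (intro emeasure_mono) auto
    also have "\<dots> < \<infinity>" by (simp add: emeasure_lborel_Icc_eq)
    finally show ?thesis by (simp add: a_def emeasure_eq_ennreal_measure)
  qed
  have abd: "a x \<le> 2 * \<bar>R\<bar>" for x
  proof -
    have "ennreal (a x) \<le> emeasure lborel {-R..R}"
      unfolding ea[symmetric] using secb by (intro emeasure_mono) auto
    also have "\<dots> \<le> ennreal (2 * \<bar>R\<bar>)" by (simp add: emeasure_lborel_Icc_eq ennreal_leI)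
    finally show ?thesis by simp
  qed
  have [measurable]: "a \<in> borel_measurable borel"
    unfolding a_def by (rule borel_measurable_measure_Pair) simp
  define M where "M = (SUP x. a x)"
  have bdd: "bdd_above (range a)" using abd by (intro bdd_aboveI[of _ "2*\<bar>R\<bar>"]) auto
  have aM: "a x \<le> M" for x unfolding M_def by (rule cSUP_upper) (use bdd in auto)
  have intA: "emeasure lborel A = (\<integral>\<^sup>+x. ennreal (a x) \<partial>lborel)"
    by (simp add: emeasure_plane_sections ea)
  have "M > 0"
  proof -
    have "emeasure lborel A \<noteq> 0"
    proof
      assume "emeasure lborel A = 0"
      then have "A \<in> null_sets lborel" by auto
      then have "negligible A" by (simp add: negligible_iff_null_sets null_sets_completionI)
      then show False using open_not_negligible[OF assms(1) False] by blast
    qed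
    moreover have "(\<integral>\<^sup>+x. ennreal (a x) \<partial>lborel) = 0" if "\<forall>x. a x \<le> 0"
      using that by (simp add: ennreal_neg)
    ultimately have "\<not> (\<forall>x. a x \<le> 0)" unfolding intA by blast
    then show ?thesis using aM by (meson le_less_trans not_le_imp_less order_less_le_trans)
  qed
  define \<alpha> where "\<alpha> t = emeasure lborel {x. t * M < a x}" for t
  have \<alpha>1: "\<alpha> t = 0" if "1 \<le> t" for t
  proof -
    have "\<not> t * M < a x" for x
      using aM[of x] that \<open>M > 0\<close> by (smt (verit) mult_le_cancel_right1)
    then show ?thesis by (simp add: \<alpha>_def)
  qed
  have [measurable]: "\<alpha> \<in> borel_measurable borel"
    unfolding \<alpha>_def by measurable
  have A1: "emeasure lborel A = ennreal M * (\<integral>\<^sup>+t. indicator {0<..<1} t * \<alpha> t \<partial>lborel)"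
  proof -
    have "emeasure lborel A = ennreal M * (\<integral>\<^sup>+t. indicator {0<..} t * \<alpha> t \<partial>lborel)"
      unfolding intA \<alpha>_def using \<open>M > 0\<close>
      by (subst nn_integral_layer_cake_scaled[of _ _ M]) (auto simp: lborel.sigma_finite_measure_axioms)
    also have "(\<integral>\<^sup>+t. indicator {0<..} t * \<alpha> t \<partial>lborel) = (\<integral>\<^sup>+t. indicator {0<..<1} t * \<alpha> t \<partial>lborel)"
      by (intro nn_integral_cong) (auto split: split_indicator simp: \<alpha>1)
    finally show ?thesis .
  qed
  \<comment> \<open>The maximal section length grows by the diameter of the disc. The level
    \<open>t * N\<close> splits as \<open>t * M + 2 * (e * t)\<close>: a level for the sections of
    \<open>A\<close> plus the same fraction of the diameter.\<close>
  define N where "N = M + 2 * e"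
  have "N > 0" using \<open>M > 0\<close> assms by (simp add: N_def)
  obtain R' where R': "\<And>z. z \<in> W \<Longrightarrow> norm z \<le> R'"
  proof -
    have "norm w \<le> R + e" if w: "w \<in> W" for w
    proof -
      obtain z where z: "z \<in> A" "dist z w < e" using w by (auto simp: W_def)
      have "norm w \<le> norm z + dist z w" by (metis dist_commute dist_norm norm_triangle_sub)
      then show ?thesis using R[OF z(1)] z(2) by simp
    qed
    then show ?thesis using that by blast
  qed
  define c' where "c' x = measure lborel (Pair x -` W)" for x
  have secW: "Pair x -` W \<subseteq> {-R'..R'}" for x
  proof
    fix y assume "y \<in> Pair x -` W"
    then have "norm y \<le> R'" using R'[of "(x,y)"] norm_snd_le[of y x] by force
    then show "y \<in> {-R'..R'}" by auto
  qed
  have secWm[measurable]: "Pair x -` W \<in> sets borel" for x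
    by (rule sets_borel_Pair_vimage) simp
  have ec: "emeasure lborel (Pair x -` W) = ennreal (c' x)" for x
  proof -
    have "emeasure lborel (Pair x -` W) \<le> emeasure lborel {-R'..R'}"
      using secW by (intro emeasure_mono) auto
    also have "\<dots> < \<infinity>" by (simp add: emeasure_lborel_Icc_eq)
    finally show ?thesis by (simp add: c'_def emeasure_eq_ennreal_measure)
  qed
  have [measurable]: "c' \<in> borel_measurable borel"
    unfolding c'_def by (rule borel_measurable_measure_Pair) simp
  have key: "\<alpha> t + ennreal (2 * (e * sqrt (1 - t\<^sup>2))) \<le> emeasure lborel {x. t * N < c' x}"
    if t: "0 < t" "t < 1" for t
  proof -
    \<comment> \<open>The abscissae at which the half-chord of the disc exceeds \<open>e * t\<close>
      form an interval of half-width \<open>\<rho>\<close>. If the section of \<open>A\<close> over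
      \<open>x0\<close> is longer than \<open>t * M\<close> and \<open>x\<close> is closer to
      \<open>x0\<close> than \<open>\<rho>\<close>, the section of \<open>W\<close> over
      \<open>x\<close> contains a thickening by more than \<open>e * t\<close>, so it is longer than
      \<open>t * N\<close>.\<close>
    define \<rho> where "\<rho> = e * sqrt (1 - t\<^sup>2)"
    have "\<rho> > 0" using t assms by (simp add: \<rho>_def power_less_one_iff abs_square_less_1)
    have sub: "(\<Union>u\<in>{x. t * M < a x}. ball u \<rho>) \<subseteq> {x. t * N < c' x}"
    proof clarify
      fix x0 x assume x0: "t * M < a x0" and x: "x \<in> ball x0 \<rho>"
      define s where "s = sqrt (e\<^sup>2 - (x - x0)\<^sup>2)"
      have "(x - x0)\<^sup>2 < \<rho>\<^sup>2" using x power_strict_mono[of "\<bar>x - x0\<bar>" \<rho> 2]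
        by (simp add: dist_real_def abs_minus_commute power2_commute)
      also have "\<rho>\<^sup>2 = e\<^sup>2 * (1 - t\<^sup>2)" using t by (simp add: \<rho>_def power_mult_distrib power_le_one)
      finally have "(e * t)\<^sup>2 < e\<^sup>2 - (x - x0)\<^sup>2" by (simp add: algebra_simps power_mult_distrib)
      then have s: "e * t < s" unfolding s_def by (rule real_less_rsqrt)
      have "0 < e * t" using assms t by simp
      have s2: "s\<^sup>2 = e\<^sup>2 - (x - x0)\<^sup>2"
        using order_trans[OF zero_le_power2 less_imp_le[OF \<open>(e * t)\<^sup>2 < e\<^sup>2 - (x - x0)\<^sup>2\<close>]]
        unfolding s_def by simp
      have ne: "Pair x0 -` A \<noteq> {}"
      proof
        assume "Pair x0 -` A = {}"
        then have "a x0 = 0" by (simp add: a_def)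
        then show False using x0 t \<open>M > 0\<close> by (simp add: mult_less_0_iff)
      qed
      have sub2: "(\<Union>y\<in>Pair x0 -` A. ball y s) \<subseteq> Pair x -` W"
      proof clarify
        fix y0 y assume y0: "(x0, y0) \<in> A" and y: "y \<in> ball y0 s"
        have "(y0 - y)\<^sup>2 < s\<^sup>2"
          using y power_strict_mono[of "\<bar>y0 - y\<bar>" s 2] by (simp add: dist_real_def)
        then have "dist (x0,y0) (x,y) < e"
          using s2 assms by (simp add: dist_Pair_Pair dist_real_def real_sqrt_less_iff power2_commute real_less_lsqrt)
        then show "y \<in> Pair x -` W" using y0 by (auto simp: W_def)
      qed
      have "ennreal (a x0 + 2 * s) \<le> emeasure lborel (Pair x0 -` A) + ennreal (2 * s)"
        using s \<open>0 < e * t\<close> by (simp add: ea a_def)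
      also have "\<dots> \<le> emeasure lborel (\<Union>y\<in>Pair x0 -` A. ball y s)"
        using secb ne s \<open>0 < e * t\<close> by (intro emeasure_thickening_real) (auto intro: bounded_subset[OF bounded_closed_interval secb])
      also have "\<dots> \<le> ennreal (c' x)"
        unfolding ec[symmetric] using sub2 by (intro emeasure_mono) auto
      finally have "a x0 + 2 * s \<le> c' x" by (simp add: c'_def)
      then show "t * N < c' x" using x0 s by (simp add: N_def algebra_simps)
    qed
    have ne: "{x. t * M < a x} \<noteq> {}"
    proof -
      have "t * M < (SUP x. a x)" using t \<open>M > 0\<close> by (simp add: M_def[symmetric])
      then show ?thesis by (auto simp: less_cSUP_iff bdd)
    qed
    have bd: "bounded {x. t * M < a x}"
    proof (rule bounded_subset)
      show "{x. t * M < a x} \<subseteq> {-R..R}"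
      proof
        fix x assume "x \<in> {x. t * M < a x}"
        then have "a x \<noteq> 0" using t \<open>M > 0\<close> by (smt (verit) mem_Collect_eq mult_pos_pos)
        then obtain y where "(x,y) \<in> A" by (cases "Pair x -` A = {}") (auto simp: a_def)
        then have "norm x \<le> R" using R[of "(x,y)"] norm_fst_le[of x y] by force
        then show "x \<in> {-R..R}" by auto
      qed
    qed simp
    have "\<alpha> t + ennreal (2 * \<rho>) \<le> emeasure lborel (\<Union>u\<in>{x. t * M < a x}. ball u \<rho>)"
      unfolding \<alpha>_def by (rule emeasure_thickening_real[OF _ bd ne \<open>\<rho> > 0\<close>]) measurable
    also have "\<dots> \<le> emeasure lborel {x. t * N < c' x}"
      by (rule emeasure_mono[OF sub]) measurable
    finally show ?thesis by (simp add: \<rho>_def)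
  qed
  have "ennreal N * (\<integral>\<^sup>+t. indicator {0<..<1} t * \<alpha> t + indicator {0<..<1} t * ennreal (2 * (e * sqrt (1 - t\<^sup>2))) \<partial>lborel)
    \<le> ennreal N * (\<integral>\<^sup>+t. indicator {0<..} t * emeasure lborel {x. t * N < c' x} \<partial>lborel)"
    using key by (intro mult_left_mono nn_integral_mono) (auto split: split_indicator)
  also have "\<dots> = emeasure lborel W"
    using \<open>N > 0\<close> by (simp add: emeasure_plane_sections ec)
      (subst nn_integral_layer_cake_scaled[of _ _ N], auto simp: lborel.sigma_finite_measure_axioms)
  finally have W: "ennreal N * ((\<integral>\<^sup>+t. indicator {0<..<1} t * \<alpha> t \<partial>lborel) +
      (\<integral>\<^sup>+t. indicator {0<..<1} t * ennreal (2 * (e * sqrt (1 - t\<^sup>2))) \<partial>lborel)) \<le> emeasure lborel W"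
    by (subst (asm) nn_integral_add) auto
  define mA where "mA = measure lborel A"
  have finA: "emeasure lborel A = ennreal mA"
    using emeasure_bounded_finite[OF assms(2)] by (simp add: mA_def emeasure_eq_ennreal_measure)
  have "mA \<ge> 0" by (simp add: mA_def)
  have i1: "(\<integral>\<^sup>+t. indicator {0<..<1} t * \<alpha> t \<partial>lborel) = ennreal (mA / M)"
  proof -
    have "ennreal (mA / M) = ennreal (1 / M) * ennreal mA"
      using \<open>M > 0\<close> \<open>mA \<ge> 0\<close> by (simp add: ennreal_mult[symmetric])
    also have "ennreal mA = ennreal M * (\<integral>\<^sup>+t. indicator {0<..<1} t * \<alpha> t \<partial>lborel)"
      using A1 finA by simp
    finally show ?thesis using \<open>M > 0\<close>
      by (simp add: mult.assoc[symmetric] ennreal_mult[symmetric])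
  qed
  have i2: "(\<integral>\<^sup>+t. indicator {0<..<1} t * ennreal (2 * (e * sqrt (1 - t\<^sup>2))) \<partial>lborel) = ennreal (pi * e / 2)"
  proof -
    have "ennreal (pi * e / 2) = ennreal (1 / (2 * e)) * ennreal (pi * e\<^sup>2)"
      using assms by (simp add: ennreal_mult[symmetric] power2_eq_square)
    also have "\<dots> = ennreal (1 / (2 * e)) * (ennreal (2 * e) * (\<integral>\<^sup>+t. indicator {0<..<1} t * ennreal (2 * (e * sqrt (1 - t\<^sup>2))) \<partial>lborel))"
      using emeasure_disc_eq_caps[OF assms(3)] by simp
    finally show ?thesis using assms
      by (simp add: mult.assoc[symmetric] ennreal_mult[symmetric])
  qed
  \<comment> \<open>The supremum \<open>M\<close> is not known; the arithmetic-geometric mean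
    inequality removes it and leaves the area alone.\<close>
  have amgm: "2 * e * sqrt (pi * mA) \<le> 2 * e * mA / M + M * pi * e / 2"
  proof -
    have "sqrt ((2 * mA / M) * (M * pi / 2)) \<le> ((2 * mA / M) + (M * pi / 2)) / 2"
      using \<open>M > 0\<close> \<open>mA \<ge> 0\<close> by (intro arith_geo_mean_sqrt) auto
    moreover have "(2 * mA / M) * (M * pi / 2) = pi * mA" using \<open>M > 0\<close> by simp
    ultimately have "2 * e * sqrt (pi * mA) \<le> 2 * e * (((2 * mA / M) + (M * pi / 2)) / 2)"
      using assms(3) by (intro mult_left_mono) auto
    also have "\<dots> = 2 * e * mA / M + M * pi * e / 2" by (simp add: algebra_simps)
    finally show ?thesis .
  qed
  have "mA + 2 * e * sqrt (pi * mA) \<le> N * (mA / M + pi * e / 2)"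
  proof -
    \<comment> \<open>The last summand is the area of the disc itself; it is of second order in
      \<open>e\<close> and is dropped.\<close>
    have "N * (mA / M + pi * e / 2) = mA + (2 * e * mA / M + M * pi * e / 2) + pi * e\<^sup>2"
      using \<open>M > 0\<close> by (simp add: N_def field_simps power2_eq_square)
    moreover have "0 \<le> pi * e\<^sup>2" by simp
    ultimately show ?thesis using amgm by linarith
  qed
  then have "ennreal (mA + 2 * e * sqrt (pi * mA)) \<le> ennreal (N * (mA / M + pi * e / 2))"
    by (rule ennreal_leI)
  also have "\<dots> = ennreal N * (ennreal (mA / M) + ennreal (pi * e / 2))"
    using \<open>N > 0\<close> \<open>M > 0\<close> \<open>mA \<ge> 0\<close> assms by (simp add: ennreal_mult ennreal_plus[symmetric] del: ennreal_plus)
  also have "\<dots> \<le> emeasure lborel W" using W unfolding i1 i2 .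
  finally show ?thesis
    using \<open>mA \<ge> 0\<close> assms by (simp add: finA mA_def W_def)
qed simp

section \<open>The isoperimetric inequality for gradients\<close>

lemma norm_diff_le_gradient_bound:
  fixes w :: "'a::euclidean_space \<Rightarrow> real"
  assumes der: "\<And>z. (w has_derivative (\<lambda>h. D z \<bullet> h)) (at z)"
    and bd: "\<And>x. x \<in> ball z e \<Longrightarrow> norm (D x) \<le> B" and z': "z' \<in> ball z e"
  shows "w z' - w z \<le> B * dist z z'"
proof -
  have "0 < e" using z' zero_le_dist[of z z'] by (simp del: zero_le_dist)
  have "norm (w z' - w z) \<le> B * norm (z' - z)"
  proof (rule differentiable_bound[OF convex_ball[of z e]])
    show "(w has_derivative (\<lambda>h. D x \<bullet> h)) (at x within ball z e)" for x
      using der has_derivative_at_withinI by blast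
    show "onorm (\<lambda>h. D x \<bullet> h) \<le> B" if "x \<in> ball z e" for x
    proof (rule onorm_le)
      fix h show "norm (D x \<bullet> h) \<le> B * norm h"
        using Cauchy_Schwarz_ineq2[of "D x" h] mult_right_mono[OF bd[OF that], of "norm h"] by simp
    qed
  qed (use z' \<open>0 < e\<close> in auto)
  then show ?thesis by (simp add: dist_norm norm_minus_commute)
qed

text \<open>The isoperimetric inequality in Sobolev form: both sides are read off from the volume of the thickened subgraph of \<open>w\<close>.\<close>

lemma nn_integral_norm_gradient_ge:
  fixes w :: "real \<times> real \<Rightarrow> real"
  assumes der: "\<And>z. (w has_derivative (\<lambda>h. D z \<bullet> h)) (at z)"
    and cD: "continuous_on UNIV D"
    and supp: "\<And>z. R < norm z \<Longrightarrow> w z = 0"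
    and w01: "\<And>z. 0 \<le> w z" "\<And>z. w z \<le> 1"
  shows "ennreal (2 * sqrt (pi * measure lborel {z. 1 \<le> w z})) \<le> (\<integral>\<^sup>+z. ennreal (norm (D z)) \<partial>lborel)"
proof -
  define I where "I = (\<integral>\<^sup>+z. ennreal (norm (D z)) \<partial>lborel)"
  define mE where "mE = measure lborel {z. 1 \<le> w z}"
  define V where "V = measure lborel (cball (0::real\<times>real) (R + 1))"
  have "0 \<le> mE" "0 \<le> V" by (auto simp: mE_def V_def)
  have V: "emeasure lborel (cball (0::real\<times>real) (R + 1)) = ennreal V"
    unfolding V_def using emeasure_bounded_finite[of "cball (0::real\<times>real) (R + 1)"]
    by (simp add: emeasure_eq_ennreal_measure)
  have cw: "continuous_on UNIV w"
    by (intro continuous_at_imp_continuous_on ballI has_derivative_continuous[OF der])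
  have [measurable]: "w \<in> borel_measurable borel" "D \<in> borel_measurable borel"
    using cw cD by (auto intro: borel_measurable_continuous_onI)
  have [measurable]: "cball (0::real\<times>real) (R + 1) \<in> sets borel" by simp
  have bounded_level: "bounded {z. t < w z}" if "0 \<le> t" for t
    by (rule bounded_subset[of "cball 0 R"]) (use supp that in \<open>auto simp: not_less[symmetric]\<close>)
  have open_level: "open {z. t < w z}" for t
    using cw by (intro open_Collect_less continuous_intros) auto
  \<comment> \<open>\<open>\<eta>\<close> bounds the oscillation of the gradient over a ball of
    radius \<open>e\<close>. The radius depends on \<open>\<eta>\<close> but is divided out, after
    which \<open>\<eta>\<close> tends to 0.\<close>
  have main: "ennreal (2 * sqrt (pi * mE)) \<le> I + ennreal (\<eta> * V)" if "0 < \<eta>" for \<eta>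
  proof -
    have "uniformly_continuous_on (cball 0 (R + 2)) D"
      using cD continuous_on_subset by (intro compact_uniformly_continuous compact_cball) blast
    then obtain d where d: "d > 0"
      "\<And>x y. x \<in> cball 0 (R + 2) \<Longrightarrow> y \<in> cball 0 (R + 2) \<Longrightarrow> dist y x < d \<Longrightarrow> dist (D y) (D x) < \<eta>"
      using \<open>0 < \<eta>\<close> unfolding uniformly_continuous_on_def by meson
    define e where "e = min d 1"
    have "0 < e" "e \<le> 1" "e \<le> d" using d(1) by (auto simp: e_def)
    have up: "w z' \<le> w z + e * (norm (D z) + \<eta>)" if "norm z \<le> R + 1" "dist z z' < e" for z z'
    proof -
      have "norm (D x) \<le> norm (D z) + \<eta>" if x: "x \<in> ball z e" for x
      proof -
        have "norm x \<le> norm z + dist z x"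
          by (metis dist_commute dist_norm norm_triangle_sub)
        then have "dist (D x) (D z) < \<eta>"
          using x \<open>norm z \<le> R + 1\<close> \<open>e \<le> 1\<close> \<open>e \<le> d\<close> by (intro d(2)) (auto simp: dist_commute)
        then show ?thesis
          by (metis add.commute dist_norm less_eq_real_def norm_triangle_sub order_trans add_mono_thms_linordered_semiring(2))
      qed
      then have "w z' - w z \<le> (norm (D z) + \<eta>) * dist z z'"
        using that(2) by (intro norm_diff_le_gradient_bound[OF der]) auto
      also have "\<dots> \<le> (norm (D z) + \<eta>) * e"
        using that(2) \<open>0 < \<eta>\<close> by (intro mult_left_mono) auto
      finally show ?thesis by (simp add: mult.commute)
    qed
    \<comment> \<open>The subgraph of \<open>w\<close> is thickened in the horizontal directions
      only. Its vertical sections grow by about \<open>e * norm (D z)\<close>, while its horizontal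
      sections are \<open>e\<close>-thickenings of superlevel sets. As \<open>e\<close> is at most
      1, nothing is left above points outside \<open>cball 0 (R + 1)\<close>, so the error
      \<open>e * \<eta>\<close> is paid on a set of finite area.\<close>
    define S where "S = {p. 0 < snd p \<and> snd p < 1 \<and> (\<exists>z'\<in>ball (fst p) e. snd p < w z')}"
    have "open S"
    proof -
      have "S = (\<Union>z'. {p. 0 < snd p} \<inter> {p. snd p < 1} \<inter> {p. dist (fst p) z' < e} \<inter> {p. snd p < w z'})"
        by (auto simp: S_def)
      also have "open \<dots>"
        by (intro open_UN ballI open_Int open_Collect_less continuous_intros)
      finally show ?thesis .
    qed
    then have [measurable]: "S \<in> sets borel" by simp
    have sec1: "emeasure lborel (Pair z -` S) \<le>
      ennreal (w z) + ennreal e * ennreal (norm (D z)) + ennreal (e * \<eta>) * indicator (cball 0 (R + 1)) z" for z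
    proof (cases "norm z \<le> R + 1")
      case True
      have "Pair z -` S \<subseteq> {0<..<w z + e * (norm (D z) + \<eta>)}"
        using up[OF True] by (fastforce simp: S_def)
      then have "emeasure lborel (Pair z -` S) \<le> emeasure lborel {0<..<w z + e * (norm (D z) + \<eta>)}"
        by (rule emeasure_mono) simp
      also have "\<dots> = ennreal (w z + e * (norm (D z) + \<eta>))"
        using w01[of z] \<open>0 < e\<close> \<open>0 < \<eta>\<close> by simp
      also have "\<dots> = ennreal (w z) + ennreal e * ennreal (norm (D z)) + ennreal (e * \<eta>)"
        using w01[of z] \<open>0 < e\<close> \<open>0 < \<eta>\<close>
        by (simp add: ennreal_mult[symmetric] ennreal_plus[symmetric] algebra_simps del: ennreal_plus)
      finally show ?thesis using True by simp
    next
      case False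
      have "w z' = 0" if "z' \<in> ball z e" for z'
      proof (rule supp)
        have "norm z \<le> norm z' + dist z z'" by (metis dist_norm norm_triangle_sub)
        then show "R < norm z'" using that False \<open>e \<le> 1\<close> by simp
      qed
      then have "Pair z -` S = {}" by (fastforce simp: S_def)
      then show ?thesis by simp
    qed
    \<comment> \<open>Every superlevel set at a height below 1 contains
      \<open>{z. 1 \<le> w z}\<close>, so each \<open>t\<close> in the unit interval contributes at
      least the same gain.\<close>
    have sec2: "(emeasure lborel {z. t < w z} + ennreal (2 * e * sqrt (pi * mE))) * indicator {0<..<1} t
      \<le> emeasure lborel ((\<lambda>z. (z, t)) -` S)" for t
    proof (cases "0 < t \<and> t < 1")
      case True
      have "mE \<le> measure lborel {z. t < w z}"
        unfolding mE_def using True emeasure_bounded_finite[OF bounded_level[of t]]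
        by (intro measure_mono_fmeasurable) (auto simp: fmeasurable_def open_level borel_open intro!: borel_closed closed_Collect_le cw continuous_intros)
      then have "(emeasure lborel {z. t < w z} + ennreal (2 * e * sqrt (pi * mE)))
        \<le> emeasure lborel {z. t < w z} + ennreal (2 * e * sqrt (pi * measure lborel {z. t < w z}))"
        using \<open>0 < e\<close> by (intro add_left_mono ennreal_leI mult_left_mono real_sqrt_le_mono) auto
      also have "\<dots> \<le> emeasure lborel (\<Union>z\<in>{z. t < w z}. ball z e)"
        using True \<open>0 < e\<close> by (intro emeasure_thickening_plane open_level bounded_level) auto
      also have "(\<Union>z\<in>{z. t < w z}. ball z e) = (\<lambda>z. (z, t)) -` S"
        using True by (auto simp: S_def dist_commute)
      finally show ?thesis using True by simp
    qed simp
    have w_int: "(\<integral>\<^sup>+t. emeasure lborel {z. t < w z} * indicator {0<..<1} t \<partial>lborel) = (\<integral>\<^sup>+z. ennreal (w z) \<partial>lborel)"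
    proof -
      have "indicator {0<..} t * emeasure lborel {z \<in> space lborel. t < w z} =
        emeasure lborel {z. t < w z} * indicator {0<..<1} t" for t
      proof (cases "t < 1")
        case False
        then have E: "{z. t < w z} = {}" using w01(2) by (auto simp: not_less intro: order_trans)
        show ?thesis
          by (simp only: space_lborel space_borel UNIV_I simp_thms E emeasure_empty mult_zero_left mult_zero_right)
      qed (auto split: split_indicator)
      then show ?thesis
        by (subst nn_integral_layer_cake[of _ w]) (auto simp: lborel.sigma_finite_measure_axioms)
    qed
    have [measurable]: "(\<lambda>t. emeasure lborel {z. t < w z}) \<in> borel_measurable borel"
      by measurable
    have "(\<integral>\<^sup>+z. ennreal (w z) \<partial>lborel) + ennreal (2 * e * sqrt (pi * mE)) =
      (\<integral>\<^sup>+t. (emeasure lborel {z. t < w z} + ennreal (2 * e * sqrt (pi * mE))) * indicator {0<..<1} t \<partial>lborel)"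
      by (simp add: distrib_right nn_integral_add w_int nn_integral_cmult_indicator)
    also have "\<dots> \<le> (\<integral>\<^sup>+t. emeasure lborel ((\<lambda>z. (z, t)) -` S) \<partial>lborel)"
      by (intro nn_integral_mono sec2)
    also have "\<dots> = emeasure lborel S" by (rule emeasure_plane_sections2[symmetric]) simp
    also have "\<dots> = (\<integral>\<^sup>+z. emeasure lborel (Pair z -` S) \<partial>lborel)" by (rule emeasure_plane_sections) simp
    also have "\<dots> \<le> (\<integral>\<^sup>+z. ennreal (w z) + ennreal e * ennreal (norm (D z)) + ennreal (e * \<eta>) * indicator (cball 0 (R + 1)) z \<partial>lborel)"
      by (intro nn_integral_mono sec1)
    also have "\<dots> = (\<integral>\<^sup>+z. ennreal (w z) + ennreal e * ennreal (norm (D z)) \<partial>lborel)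
        + (\<integral>\<^sup>+z. ennreal (e * \<eta>) * indicator (cball (0::real\<times>real) (R + 1)) z \<partial>lborel)"
      by (rule nn_integral_add) measurable
    also have "(\<integral>\<^sup>+z. ennreal (w z) + ennreal e * ennreal (norm (D z)) \<partial>lborel)
        = (\<integral>\<^sup>+z. ennreal (w z) \<partial>lborel) + (\<integral>\<^sup>+z. ennreal e * ennreal (norm (D z)) \<partial>lborel)"
      by (rule nn_integral_add) measurable
    also have "(\<integral>\<^sup>+z. ennreal e * ennreal (norm (D z)) \<partial>lborel) = ennreal e * I"
      unfolding I_def by (rule nn_integral_cmult) measurable
    also have "(\<integral>\<^sup>+z. ennreal (e * \<eta>) * indicator (cball (0::real\<times>real) (R + 1)) z \<partial>lborel) = ennreal (e * \<eta> * V)"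
      using \<open>0 < e\<close> \<open>0 < \<eta>\<close> \<open>0 \<le> V\<close> by (subst nn_integral_cmult_indicator) (auto simp: V ennreal_mult)
    finally have "(\<integral>\<^sup>+z. ennreal (w z) \<partial>lborel) + ennreal (2 * e * sqrt (pi * mE))
      \<le> (\<integral>\<^sup>+z. ennreal (w z) \<partial>lborel) + (ennreal e * I + ennreal (e * \<eta> * V))"
      by (simp only: add.assoc)
    moreover have "(\<integral>\<^sup>+z. ennreal (w z) \<partial>lborel) \<noteq> \<infinity>"
    proof -
      have "(\<integral>\<^sup>+z. ennreal (w z) \<partial>lborel) \<le> (\<integral>\<^sup>+z. indicator (cball (0::real\<times>real) R) z \<partial>lborel)"
        using w01 supp by (intro nn_integral_mono) (auto split: split_indicator simp: not_le)
      also have "\<dots> = emeasure lborel (cball (0::real\<times>real) R)" by simp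
      also have "\<dots> < \<infinity>" by (rule emeasure_bounded_finite) simp
      finally show ?thesis by simp
    qed
    ultimately have "ennreal (2 * e * sqrt (pi * mE)) \<le> ennreal e * I + ennreal (e * \<eta> * V)"
      by (simp add: ennreal_add_left_cancel_le)
    also have "\<dots> = ennreal e * (I + ennreal (\<eta> * V))"
      using \<open>0 < e\<close> \<open>0 < \<eta>\<close> \<open>0 \<le> V\<close> by (simp add: distrib_left ennreal_mult[symmetric] mult.assoc)
    finally have "ennreal (1 / e) * ennreal (2 * e * sqrt (pi * mE)) \<le> ennreal (1 / e) * (ennreal e * (I + ennreal (\<eta> * V)))"
      by (rule mult_left_mono) simp
    then show ?thesis
      using \<open>0 < e\<close> \<open>0 \<le> mE\<close> by (simp add: mult.assoc[symmetric] ennreal_mult[symmetric])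
  qed
  show ?thesis
  proof (cases "I = \<infinity>")
    case False
    have "ennreal (2 * sqrt (pi * mE)) \<le> I"
    proof (rule ennreal_le_epsilon)
      fix \<delta> :: real assume "0 < \<delta>" 
      have "ennreal (2 * sqrt (pi * mE)) \<le> I + ennreal (\<delta> / (V + 1) * V)"
        using \<open>0 < \<delta>\<close> \<open>0 \<le> V\<close> by (intro main) auto
      also have "\<delta> / (V + 1) * V \<le> \<delta>" using \<open>0 < \<delta>\<close> \<open>0 \<le> V\<close> by (simp add: field_simps)
      then have "I + ennreal (\<delta> / (V + 1) * V) \<le> I + ennreal \<delta>" by (intro add_left_mono ennreal_leI)
      finally show "ennreal (2 * sqrt (pi * mE)) \<le> I + ennreal \<delta>" .
    qed
    then show ?thesis by (simp add: I_def mE_def)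
  qed (simp add: I_def)
qed

section \<open>Level sets of the density of an entire function\<close>

text \<open>\<open>p\<close> is a trapezoid: it rises on \<open>[0, k]\<close>, stays at
  \<open>1 / (d - k)\<close> and falls on \<open>[d - k, d]\<close>. A linear step would have the
  optimal slope \<open>1 / d\<close> but a discontinuous derivative; \<open>k\<close> measures what
  is lost by smoothing it.\<close>

lemma smooth_step_exists:
  fixes d k :: real
  assumes "0 < k" "2 * k < d"
  obtains P p :: "real \<Rightarrow> real"
  where "\<And>l. (P has_real_derivative p l) (at l)" "continuous_on UNIV p"
    "\<And>l. 0 \<le> p l" "\<And>l. p l \<le> 1 / (d - k)" "\<And>l. l \<le> 0 \<Longrightarrow> p l = 0" "\<And>l. d \<le> l \<Longrightarrow> p l = 0"
    "\<And>l. l \<le> 0 \<Longrightarrow> P l = 0" "\<And>l. d \<le> l \<Longrightarrow> P l = 1" "\<And>l. 0 \<le> P l" "\<And>l. P l \<le> 1"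
proof -
  define q where "q l = (max 0 l)\<^sup>2 / 2" for l :: real
  have q: "(q has_real_derivative max 0 l) (at l)" for l
  proof -
    consider "l < 0" | "l > 0" | "l = 0" by linarith
    then show ?thesis
    proof cases
      case 1
      have "((\<lambda>l::real. 0) has_real_derivative 0) (at l)" by simp
      then have "(q has_real_derivative 0) (at l)"
        by (rule has_field_derivative_transform_within_open[of _ _ _ "{..<0}"]) (use 1 in \<open>auto simp: q_def\<close>)
      then show ?thesis using 1 by (simp add: max_def)
    next
      case 2
      have "((\<lambda>l::real. l\<^sup>2 / 2) has_real_derivative l) (at l)" by (auto intro!: derivative_eq_intros)
      then have "(q has_real_derivative l) (at l)"
        by (rule has_field_derivative_transform_within_open[of _ _ _ "{0<..}"]) (use 2 in \<open>auto simp: q_def\<close>)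
      then show ?thesis using 2 by (simp add: max_def)
    next
      case 3
      have "((\<lambda>h. (q (0 + h) - q 0) / h) \<longlongrightarrow> 0) (at 0)"
      proof (rule Lim_null_comparison)
        show "\<forall>\<^sub>F h in at 0. norm ((q (0 + h) - q 0) / h) \<le> \<bar>h\<bar>"
          by (rule always_eventually) (auto simp: q_def max_def power2_eq_square)
        show "((\<lambda>h::real. \<bar>h\<bar>) \<longlongrightarrow> 0) (at 0)"
          using tendsto_rabs[OF tendsto_ident_at[of "0::real" UNIV]] by simp
      qed
      then show ?thesis using 3 by (simp add: DERIV_def)
    qed
  qed
  \<comment> \<open>The area of the trapezoid with height \<open>k\<close>, base \<open>d\<close>
    and top \<open>d - 2 * k\<close>; dividing by it makes the step reach 1.\<close>
  define c where "c = k * (d - k)"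
  have c: "c > 0" using assms by (simp add: c_def)
  define P where "P l = (q l - q (l - k) - q (l - (d - k)) + q (l - d)) / c" for l
  define p where "p l = (max 0 l - max 0 (l - k) - max 0 (l - (d - k)) + max 0 (l - d)) / c" for l
  have der: "(P has_real_derivative p l) (at l)" for l
  proof -
    have s: "((\<lambda>l. q (l - a)) has_real_derivative max 0 (l - a)) (at l)" for a
    proof -
      have "((\<lambda>l. q (l - a)) has_real_derivative max 0 (l - a) * 1) (at l)"
        by (rule DERIV_chain2[where f = q and g = "\<lambda>l. l - a", OF q]) (auto intro!: derivative_eq_intros)
      then show ?thesis by simp
    qed
    show ?thesis unfolding P_def p_def
      by (intro DERIV_cdivide DERIV_add DERIV_diff q s)
  qed
  have p0: "0 \<le> p l" for l
    unfolding p_def using assms c by (intro divide_nonneg_pos) (auto simp: max_def)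
  have p1: "p l \<le> 1 / (d - k)" for l
  proof -
    have "max 0 l - max 0 (l - k) - max 0 (l - (d - k)) + max 0 (l - d) \<le> k"
      using assms by (auto simp: max_def)
    then have "p l \<le> k / c" unfolding p_def using c by (intro divide_right_mono) auto
    also have "k / c = 1 / (d - k)" using assms by (simp add: c_def)
    finally show ?thesis .
  qed
  have P0: "P l = 0" if "l \<le> 0" for l using that assms by (simp add: P_def q_def)
  have P1: "P l = 1" if "d \<le> l" for l
  proof -
    have "q l - q (l - k) - q (l - (d - k)) + q (l - d) = c"
      using that assms by (simp add: q_def c_def power2_eq_square field_simps)
    then show ?thesis using c by (simp add: P_def)
  qed
  have mono: "P x \<le> P y" if "x \<le> y" for x y
    using DERIV_nonneg_imp_nondecreasing[OF that, of P] der p0 by blast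
  show thesis
  proof
    show "continuous_on UNIV p" unfolding p_def by (intro continuous_intros) (use c in auto)
    show "p l = 0" if "l \<le> 0" for l using that assms by (simp add: p_def)
    show "p l = 0" if "d \<le> l" for l using that assms by (simp add: p_def)
    show "0 \<le> P l" for l using mono[of "min 0 l" l] P0[of "min 0 l"] by simp
    show "P l \<le> 1" for l using mono[of l "max d l"] P1[of "max d l"] by simp
  qed (use der p0 p1 P0 P1 in auto)
qed

section \<open>Integrals of derivatives with bounded support\<close>

lemma integrable_compact_support:
  fixes h :: "'a::euclidean_space \<Rightarrow> real"
  assumes "continuous_on UNIV h" "\<And>z. R < norm z \<Longrightarrow> h z = 0"
  shows "integrable lborel h"
proof -
  have "integrable lborel (\<lambda>z. indicator (cball 0 R) z *\<^sub>R h z)"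
    using assms(1) continuous_on_subset by (intro borel_integrable_compact) auto
  also have "(\<lambda>z. indicator (cball 0 R) z *\<^sub>R h z) = h"
    using assms(2) by (auto split: split_indicator simp: not_le)
  finally show ?thesis .
qed

lemma integral_derivative_compact_support:
  fixes H h :: "real \<Rightarrow> real"
  assumes "\<And>x. (H has_real_derivative h x) (at x)" "continuous_on UNIV h"
    "\<And>x. R < \<bar>x\<bar> \<Longrightarrow> H x = 0 \<and> h x = 0"
  shows "(LINT x|lborel. h x) = 0"
proof -
  define S where "S = \<bar>R\<bar> + 1"
  have "(LINT x|lborel. h x) = (LINT x|lborel. indicator {-S..S} x *\<^sub>R h x)"
    using assms(3) by (intro Bochner_Integration.integral_cong) (auto split: split_indicator simp: S_def abs_le_iff)
  also have "\<dots> = H S - H (-S)"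
  proof (rule integral_FTC_Icc)
    show "(H has_vector_derivative h x) (at x within {-S..S})" for x
      using assms(1) has_real_derivative_iff_has_vector_derivative has_vector_derivative_at_within by blast
    show "continuous_on {-S..S} h" using assms(2) continuous_on_subset by blast
  qed (simp add: S_def)
  also have "\<dots> = 0" using assms(3)[of S] assms(3)[of "-S"] by (simp add: S_def)
  finally show ?thesis .
qed

text \<open>The divergence theorem one coordinate at a time, by Fubini and the one-dimensional case.
  For each component of a field only its own partial derivative has to be computed.\<close>

lemma integral_partial_derivatives_compact_support:
  fixes H h :: "real \<times> real \<Rightarrow> real"
  assumes "continuous_on UNIV h" "\<And>z. R < norm z \<Longrightarrow> H z = 0 \<and> h z = 0"
  shows "(\<And>x y. ((\<lambda>x. H (x, y)) has_real_derivative h (x, y)) (at x)) \<Longrightarrow> (LINT z|lborel. h z) = 0"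
    and "(\<And>x y. ((\<lambda>y. H (x, y)) has_real_derivative h (x, y)) (at y)) \<Longrightarrow> (LINT z|lborel. h z) = 0"
proof -
  have "integrable lborel h" using assms by (intro integrable_compact_support) auto
  then have int: "integrable (lborel \<Otimes>\<^sub>M lborel) h" by (simp add: lborel_prod)
  have bnd: "R < \<bar>x\<bar> \<Longrightarrow> R < norm (x, y)" "R < \<bar>y\<bar> \<Longrightarrow> R < norm (x, y)" for x y :: real
    using norm_fst_le[of x y] norm_snd_le[of y x] by auto
  have cont: "continuous_on UNIV (\<lambda>x. h (x, y))" "continuous_on UNIV (\<lambda>y. h (x, y))" for x y
    by (rule continuous_on_compose2[OF assms(1)]; auto intro!: continuous_intros)+
  show "(LINT z|lborel. h z) = 0" if "\<And>x y. ((\<lambda>x. H (x, y)) has_real_derivative h (x, y)) (at x)"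
  proof -
    have "(LINT z|lborel. h z) = (LINT z|(lborel \<Otimes>\<^sub>M lborel). case_prod (\<lambda>x y. h (x, y)) z)"
      by (simp add: lborel_prod)
    also have "\<dots> = (LINT y|lborel. LINT x|lborel. h (x, y))"
      using int by (intro lborel_pair.integral_snd[symmetric]) simp
    also have "(\<lambda>y. LINT x|lborel. h (x, y)) = (\<lambda>y. 0)"
      using that cont assms(2) bnd
      by (intro ext integral_derivative_compact_support[where H = "\<lambda>x. H (x, _)" and R = R]) auto
    finally show ?thesis by simp
  qed
  show "(LINT z|lborel. h z) = 0" if "\<And>x y. ((\<lambda>y. H (x, y)) has_real_derivative h (x, y)) (at y)"
  proof -
    have "(LINT z|lborel. h z) = (LINT z|(lborel \<Otimes>\<^sub>M lborel). case_prod (\<lambda>x y. h (x, y)) z)"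
      by (simp add: lborel_prod)
    also have "\<dots> = (LINT x|lborel. LINT y|lborel. h (x, y))"
      using int by (intro lborel_pair.integral_fst[symmetric]) simp
    also have "(\<lambda>x. LINT y|lborel. h (x, y)) = (\<lambda>x. 0)"
      using that cont assms(2) bnd
      by (intro ext integral_derivative_compact_support[where H = "\<lambda>y. H (_, y)" and R = R]) auto
    finally show ?thesis by simp
  qed
qed

section \<open>The logarithm of a Fock density\<close>

text \<open>The integrand of the squared norm in the Bargmann--Fock space. For the Bargmann
  transform of \<open>f\<close> it is the squared modulus of the short-time Fourier transform, so
  the level-set analysis can be carried out for entire functions.\<close>

definition fock_density :: "(complex \<Rightarrow> complex) \<Rightarrow> real \<times> real \<Rightarrow> real" where
  "fock_density F z = (norm (F (Complex (fst z) (snd z))))\<^sup>2 * exp (- pi * (norm z)\<^sup>2)"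

definition log_deriv :: "(complex \<Rightarrow> complex) \<Rightarrow> complex \<Rightarrow> complex" where
  "log_deriv F \<zeta> = deriv F \<zeta> / F \<zeta>"

text \<open>With \<open>g = log_deriv F\<close>, the Cauchy--Riemann equations give
  \<open>ln |F|^2 = 2 * Re (log F)\<close> the gradient \<open>(2 * Re g, - 2 * Im g)\<close>. The
  quotient \<open>g\<close> is single valued off the zeros of \<open>F\<close>, where a global
  branch of \<open>log F\<close> need not exist.\<close>

definition log_density_grad :: "(complex \<Rightarrow> complex) \<Rightarrow> real \<times> real \<Rightarrow> real \<times> real" where
  "log_density_grad F z =
     (2 * Re (log_deriv F (Complex (fst z) (snd z))) - 2 * pi * fst z,
      - 2 * Im (log_deriv F (Complex (fst z) (snd z))) - 2 * pi * snd z)"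

lemma fock_density_nonneg [simp]: "0 \<le> fock_density F z"
  by (simp add: fock_density_def)

lemma fock_density_eq_0_iff: "fock_density F z = 0 \<longleftrightarrow> F (Complex (fst z) (snd z)) = 0"
  by (simp add: fock_density_def)

lemma continuous_on_Complex_pair: "continuous_on S (\<lambda>z::real\<times>real. Complex (fst z) (snd z))"
  by (auto simp: Complex_eq intro!: continuous_intros)

lemma continuous_fock_density:
  assumes "F holomorphic_on UNIV"
  shows "continuous_on UNIV (fock_density F)"
proof -
  have "continuous_on UNIV (\<lambda>z::real\<times>real. F (Complex (fst z) (snd z)))"
    by (rule continuous_on_compose2[OF holomorphic_on_imp_continuous_on[OF assms] continuous_on_Complex_pair]) simp
  then show ?thesis unfolding fock_density_def by (intro continuous_intros)
qed

text \<open>\<open>|F|^2\<close> is differentiated as the inner product of \<open>F\<close> with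
  itself, so that no logarithm of \<open>F\<close> has to be chosen.\<close>

lemma has_derivative_ln_fock_density:
  assumes F: "F holomorphic_on UNIV" and nz: "fock_density F z \<noteq> 0"
  shows "((\<lambda>z. ln (fock_density F z)) has_derivative (\<lambda>h. log_density_grad F z \<bullet> h)) (at z)"
proof -
  define \<zeta> where "\<zeta> z = Complex (fst z) (snd z)" for z :: "real \<times> real"
  have d\<zeta>: "(\<zeta> has_derivative \<zeta>) (at z)"
    unfolding \<zeta>_def Complex_eq by (auto intro!: derivative_eq_intros)
  have "(F has_field_derivative deriv F (\<zeta> z)) (at (\<zeta> z))"
    using F by (intro holomorphic_derivI[of F UNIV]) auto
  then have "(F has_derivative (*) (deriv F (\<zeta> z))) (at (\<zeta> z))"
    by (simp add: has_field_derivative_def)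
  from has_derivative_compose[OF d\<zeta> this]
  have dF: "((\<lambda>z. F (\<zeta> z)) has_derivative (\<lambda>h. deriv F (\<zeta> z) * \<zeta> h)) (at z)" .
  define f where "f = F (\<zeta> z)"
  have "f \<noteq> 0" using nz by (simp add: f_def \<zeta>_def fock_density_eq_0_iff)
  have u: "fock_density F = (\<lambda>z. (F (\<zeta> z) \<bullet> F (\<zeta> z)) * exp (- pi * (z \<bullet> z)))"
    by (simp add: fock_density_def[abs_def] \<zeta>_def dot_square_norm)
  have pos: "0 < fock_density F z" using nz fock_density_nonneg[of F z] by linarith
  define E where "E = exp (- pi * (z \<bullet> z))"
  have "E > 0" by (simp add: E_def)
  have du: "(fock_density F has_derivative (\<lambda>h. (2 * (f \<bullet> (deriv F (\<zeta> z) * \<zeta> h)) - 2 * pi * (z \<bullet> h) * (f \<bullet> f)) * E)) (at z)"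
    unfolding u
    by (rule derivative_eq_intros dF refl)+ (auto simp: fun_eq_iff f_def E_def algebra_simps inner_commute)
  have "((\<lambda>z. ln (fock_density F z)) has_derivative
     (\<lambda>h. (2 * (f \<bullet> (deriv F (\<zeta> z) * \<zeta> h)) - 2 * pi * (z \<bullet> h) * (f \<bullet> f)) * E / fock_density F z)) (at z)"
    using has_derivative_ln[OF pos du] by (simp add: divide_inverse)
  also have "(\<lambda>h. (2 * (f \<bullet> (deriv F (\<zeta> z) * \<zeta> h)) - 2 * pi * (z \<bullet> h) * (f \<bullet> f)) * E / fock_density F z)
     = (\<lambda>h. log_density_grad F z \<bullet> h)"
  proof
    fix h
    have "fock_density F z = (f \<bullet> f) * E" by (simp add: u f_def E_def)
    then have "(2 * (f \<bullet> (deriv F (\<zeta> z) * \<zeta> h)) - 2 * pi * (z \<bullet> h) * (f \<bullet> f)) * E / fock_density F z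
      = 2 * ((f \<bullet> (deriv F (\<zeta> z) * \<zeta> h)) / (f \<bullet> f)) - 2 * pi * (z \<bullet> h)"
      using \<open>E > 0\<close> \<open>f \<noteq> 0\<close> by (simp add: field_simps)
    also have "(f \<bullet> (deriv F (\<zeta> z) * \<zeta> h)) / (f \<bullet> f) = Re (deriv F (\<zeta> z) / f) * fst h - Im (deriv F (\<zeta> z) / f) * snd h"
      by (simp add: inner_complex_def Re_divide Im_divide \<zeta>_def power2_eq_square[symmetric] diff_divide_distrib add_divide_distrib)
        (simp add: algebra_simps add_divide_distrib diff_divide_distrib)
    finally show "(2 * (f \<bullet> (deriv F (\<zeta> z) * \<zeta> h)) - 2 * pi * (z \<bullet> h) * (f \<bullet> f)) * E / fock_density F z
      = log_density_grad F z \<bullet> h"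
      by (simp add: log_density_grad_def log_deriv_def \<zeta>_def f_def inner_prod_def algebra_simps)
  qed
  finally show ?thesis .
qed

lemma holomorphic_log_deriv:
  assumes "F holomorphic_on UNIV"
  shows "log_deriv F holomorphic_on {\<zeta>. F \<zeta> \<noteq> 0}" "open {\<zeta>. F \<zeta> \<noteq> 0}"
proof -
  show "open {\<zeta>. F \<zeta> \<noteq> 0}"
    using holomorphic_on_imp_continuous_on[OF assms] by (intro open_Collect_neq continuous_intros)
  have "F holomorphic_on {\<zeta>. F \<zeta> \<noteq> 0}" "deriv F holomorphic_on {\<zeta>. F \<zeta> \<noteq> 0}"
    using assms holomorphic_deriv[OF assms] by (auto intro: holomorphic_on_subset)
  then show "log_deriv F holomorphic_on {\<zeta>. F \<zeta> \<noteq> 0}"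
    unfolding log_deriv_def[abs_def] by (intro holomorphic_on_divide) auto
qed

text \<open>The terms with the derivative of \<open>log_deriv F\<close> carry opposite signs because
  \<open>ln |F|^2\<close> is harmonic off the zeros; the sum of the two derivatives is the Laplacian
  \<open>- 4 * pi\<close>.\<close>

lemma log_density_grad_partial:
  assumes F: "F holomorphic_on UNIV" and nz: "fock_density F (x, y) \<noteq> 0"
  shows "((\<lambda>x. fst (log_density_grad F (x, y))) has_real_derivative
           2 * Re (deriv (log_deriv F) (Complex x y)) - 2 * pi) (at x)"
    and "((\<lambda>y. snd (log_density_grad F (x, y))) has_real_derivative
           - 2 * Re (deriv (log_deriv F) (Complex x y)) - 2 * pi) (at y)"
proof -
  have g: "(log_deriv F has_field_derivative deriv (log_deriv F) (Complex x y)) (at (Complex x y))"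
    using holomorphic_log_deriv[OF F] nz by (intro holomorphic_derivI) (auto simp: fock_density_eq_0_iff)
  have "((\<lambda>x. Complex x y) has_vector_derivative 1) (at x)"
    unfolding Complex_eq by (auto intro!: derivative_eq_intros)
  from field_vector_diff_chain_at[OF this g]
  have 1: "((\<lambda>x. log_deriv F (Complex x y)) has_vector_derivative deriv (log_deriv F) (Complex x y)) (at x)"
    by (simp add: o_def)
  have "((\<lambda>y. Complex x y) has_vector_derivative \<i>) (at y)"
    unfolding Complex_eq by (auto intro!: derivative_eq_intros)
  from field_vector_diff_chain_at[OF this g]
  have 2: "((\<lambda>y. log_deriv F (Complex x y)) has_vector_derivative \<i> * deriv (log_deriv F) (Complex x y)) (at y)"
    by (simp add: o_def)
  have "((\<lambda>x. Re (log_deriv F (Complex x y))) has_real_derivative Re (deriv (log_deriv F) (Complex x y))) (at x)"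
    using bounded_linear.has_vector_derivative[OF bounded_linear_Re 1]
    by (simp add: has_real_derivative_iff_has_vector_derivative)
  then show "((\<lambda>x. fst (log_density_grad F (x, y))) has_real_derivative
           2 * Re (deriv (log_deriv F) (Complex x y)) - 2 * pi) (at x)"
    using DERIV_diff[OF DERIV_cmult[where c = 2] DERIV_cmult[OF DERIV_ident, where c = "2 * pi"]]
    by (simp add: log_density_grad_def)
  have "((\<lambda>y. Im (log_deriv F (Complex x y))) has_real_derivative Re (deriv (log_deriv F) (Complex x y))) (at y)"
    using bounded_linear.has_vector_derivative[OF bounded_linear_Im 2]
    by (simp add: has_real_derivative_iff_has_vector_derivative)
  then show "((\<lambda>y. snd (log_density_grad F (x, y))) has_real_derivative
           - 2 * Re (deriv (log_deriv F) (Complex x y)) - 2 * pi) (at y)"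
    using DERIV_diff[OF DERIV_cmult[where c = "-2"] DERIV_cmult[OF DERIV_ident, where c = "2 * pi"]]
    by (simp add: log_density_grad_def)
qed

text \<open>Two open sets cover the plane: the one where the density is nonzero, and the one where
  it is below \<open>a\<close> and \<open>H\<close> vanishes identically. The zeros of
  \<open>F\<close> lie inside the second.\<close>

lemma continuous_on_zero_extension:
  fixes H :: "real \<times> real \<Rightarrow> 'b::real_normed_vector"
  assumes F: "F holomorphic_on UNIV" and "0 < a"
    and H: "continuous_on {z. fock_density F z \<noteq> 0} H" "\<And>z. fock_density F z < a \<Longrightarrow> H z = 0"
  shows "continuous_on UNIV H"
proof -
  note c = continuous_fock_density[OF F]
  have "continuous_on ({z. fock_density F z \<noteq> 0} \<union> {z. fock_density F z < a}) H"
  proof (rule continuous_on_open_Un)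
    show "open {z. fock_density F z \<noteq> 0}" using c by (intro open_Collect_neq continuous_intros)
    show "open {z. fock_density F z < a}" using c by (intro open_Collect_less continuous_intros)
    show "continuous_on {z. fock_density F z < a} H"
      using H(2) by (intro continuous_on_eq[OF continuous_on_const[of _ 0]]) auto
  qed (rule H)
  also have "{z. fock_density F z \<noteq> 0} \<union> {z. fock_density F z < a} = UNIV" using \<open>0 < a\<close> by auto
  finally show ?thesis .
qed

text \<open>The divergence theorem for the field \<open>P (ln u - \<alpha>) \<nabla>(ln u)\<close>, where \<open>\<Delta>(ln u) = -4 \<pi>\<close> off the zeros of \<open>u\<close>.\<close>

lemma integral_energy_eq:
  fixes F :: "complex \<Rightarrow> complex" and P p :: "real \<Rightarrow> real" and \<alpha> :: real
  defines "u \<equiv> fock_density F" and "G \<equiv> log_density_grad F"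
  assumes F: "F holomorphic_on UNIV" and bdd: "\<And>z. R < norm z \<Longrightarrow> u z < exp \<alpha>"
    and P: "\<And>l. (P has_real_derivative p l) (at l)" "continuous_on UNIV p"
      "\<And>l. l \<le> 0 \<Longrightarrow> p l = 0" "\<And>l. l \<le> 0 \<Longrightarrow> P l = 0"
  defines "W \<equiv> \<lambda>z. if u z = 0 then 0 else P (ln (u z) - \<alpha>)"
    and "D \<equiv> \<lambda>z. if u z = 0 then 0 else p (ln (u z) - \<alpha>)"
  shows "(W has_derivative (\<lambda>h. (D z *\<^sub>R G z) \<bullet> h)) (at z)"
    and "continuous_on UNIV (\<lambda>z. D z *\<^sub>R G z)" "continuous_on UNIV D" "continuous_on UNIV W"
    and "integrable lborel (\<lambda>z. D z * (norm (G z))\<^sup>2)" "integrable lborel W"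
    and "(LINT z|lborel. D z * (norm (G z))\<^sup>2) = 4 * pi * (LINT z|lborel. W z)"
proof -
  note cu = continuous_fock_density[OF F, folded u_def]
  have u0: "0 \<le> u z" for z by (simp add: u_def)
  have neg: "ln (u z) - \<alpha> \<le> 0" if "u z < exp \<alpha>" "u z \<noteq> 0" for z
  proof -
    have "0 < u z" using that(2) u0[of z] by simp
    then have "ln (u z) \<le> ln (exp \<alpha>)" using that(1) by (intro ln_mono) auto
    then show ?thesis by simp
  qed
  \<comment> \<open>\<open>W\<close> and \<open>D\<close> vanish on a whole neighbourhood of the
    zeros of \<open>u\<close> and outside the ball of radius \<open>R\<close>, so the singularities
    of \<open>ln u\<close> and \<open>G\<close> are cut away and all supports are bounded.\<close>
  have zero: "W z = 0" "D z = 0" if "u z < exp \<alpha>" for z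
    using neg[OF that] P(3,4) by (auto simp: W_def D_def)
  have dl: "((\<lambda>z. ln (u z)) has_derivative (\<lambda>h. G z \<bullet> h)) (at z)" if "u z \<noteq> 0" for z
    using has_derivative_ln_fock_density[OF F, of z] that unfolding u_def G_def .
  have open_nz: "open {z. u z \<noteq> 0}" using cu by (intro open_Collect_neq continuous_intros)
  have open_lt: "open {z. u z < exp \<alpha>}" using cu by (intro open_Collect_less continuous_intros)
  show dW: "(W has_derivative (\<lambda>h. (D z *\<^sub>R G z) \<bullet> h)) (at z)" for z
  proof (cases "u z = 0")
    case False
    have "((\<lambda>z. ln (u z) - \<alpha>) has_derivative (\<lambda>h. G z \<bullet> h)) (at z)"
      using has_derivative_diff[OF dl[OF False] has_derivative_const] by simp
    from has_derivative_compose[OF this P(1)[of "ln (u z) - \<alpha>", unfolded has_field_derivative_def]]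
    have "((\<lambda>z. P (ln (u z) - \<alpha>)) has_derivative (\<lambda>h. (D z *\<^sub>R G z) \<bullet> h)) (at z)"
      using False by (simp add: D_def)
    then show ?thesis
      by (rule has_derivative_transform_within_open[OF _ open_nz]) (use False in \<open>auto simp: W_def\<close>)
  next
    case True
    then have "u z < exp \<alpha>" by simp
    have "((\<lambda>z::real\<times>real. 0::real) has_derivative (\<lambda>h. (D z *\<^sub>R G z) \<bullet> h)) (at z)"
      using True by (simp add: D_def)
    then show ?thesis
      by (rule has_derivative_transform_within_open[OF _ open_lt]) (use \<open>u z < exp \<alpha>\<close> zero in auto)
  qed
  have ext: "continuous_on UNIV H"
    if "continuous_on {z. u z \<noteq> 0} H" "\<And>z. u z < exp \<alpha> \<Longrightarrow> H z = 0" for H :: "real \<times> real \<Rightarrow> 'b::real_normed_vector"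
    using continuous_on_zero_extension[OF F exp_gt_zero[of \<alpha>], of H] that by (simp add: u_def)
  have cl: "continuous_on {z. u z \<noteq> 0} (\<lambda>z. ln (u z) - \<alpha>)"
    using continuous_on_subset[OF cu] by (intro continuous_intros) auto
  have cD: "continuous_on {z. u z \<noteq> 0} D"
    by (rule continuous_on_eq[OF continuous_on_compose2[OF P(2) cl]]) (auto simp: D_def)
  have cP: "continuous_on UNIV P" using P(1) DERIV_isCont by (blast intro: continuous_at_imp_continuous_on)
  have cW: "continuous_on {z. u z \<noteq> 0} W"
    by (rule continuous_on_eq[OF continuous_on_compose2[OF cP cl]]) (auto simp: W_def)
  note hl = holomorphic_log_deriv[OF F]
  have c\<zeta>: "continuous_on {z. u z \<noteq> 0} (\<lambda>z. f (Complex (fst z) (snd z)))"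
    if "f holomorphic_on {\<zeta>. F \<zeta> \<noteq> 0}" for f
    by (rule continuous_on_compose2[OF holomorphic_on_imp_continuous_on[OF that] continuous_on_Complex_pair])
       (auto simp: u_def fock_density_eq_0_iff)
  have cG: "continuous_on {z. u z \<noteq> 0} G"
    unfolding G_def log_density_grad_def by (intro continuous_intros c\<zeta> hl)
  show "continuous_on UNIV (\<lambda>z. D z *\<^sub>R G z)" by (intro ext continuous_intros cD cG) (simp add: zero)
  show cDU: "continuous_on UNIV D" by (intro ext cD) (simp add: zero)
  show cWU: "continuous_on UNIV W" by (intro ext cW) (simp add: zero)
  show iW: "integrable lborel W"
    by (rule integrable_compact_support[OF cWU]) (use bdd zero in auto)
  have cDG: "continuous_on UNIV (\<lambda>z. D z * (norm (G z))\<^sup>2)"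
    by (intro ext continuous_intros cD cG) (simp add: zero)
  then show iD: "integrable lborel (\<lambda>z. D z * (norm (G z))\<^sup>2)"
    by (rule integrable_compact_support[where R = R]) (use bdd zero in auto)
  define L where "L z = 2 * Re (deriv (log_deriv F) (Complex (fst z) (snd z)))" for z
  have cL: "continuous_on {z. u z \<noteq> 0} L"
    unfolding L_def by (intro continuous_intros c\<zeta> holomorphic_deriv hl)
  \<comment> \<open>\<open>h1\<close> and \<open>h2\<close> are the two diagonal partial derivatives
    of the field \<open>W z *\<^sub>R G z\<close>. In their sum \<open>L\<close> cancels, which
    leaves the energy density minus \<open>4 * pi * W z\<close>.\<close>
  define h1 where "h1 z = D z * (fst (G z))\<^sup>2 + W z * (L z - 2 * pi)" for z
  define h2 where "h2 z = D z * (snd (G z))\<^sup>2 + W z * (- L z - 2 * pi)" for z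
  have ch: "continuous_on UNIV h1" "continuous_on UNIV h2"
    unfolding h1_def h2_def by ((intro ext continuous_intros cD cG cW cL), simp add: zero)+
  have DW: "((\<lambda>x. W (x, y)) has_real_derivative D (x, y) * fst (G (x, y))) (at x)"
       "((\<lambda>y. W (x, y)) has_real_derivative D (x, y) * snd (G (x, y))) (at y)" for x y
  proof -
    have "((\<lambda>x. (x, y)) has_derivative (\<lambda>h. (h, 0))) (at x)" by (auto intro!: derivative_eq_intros)
    from has_derivative_compose[OF this dW[of "(x, y)"]]
    show "((\<lambda>x. W (x, y)) has_real_derivative D (x, y) * fst (G (x, y))) (at x)"
      by (simp add: has_field_derivative_def inner_prod_def mult_commute_abs)
    have "((\<lambda>y. (x, y)) has_derivative (\<lambda>h. (0, h))) (at y)" by (auto intro!: derivative_eq_intros)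
    from has_derivative_compose[OF this dW[of "(x, y)"]]
    show "((\<lambda>y. W (x, y)) has_real_derivative D (x, y) * snd (G (x, y))) (at y)"
      by (simp add: has_field_derivative_def inner_prod_def mult_commute_abs)
  qed
  have h1: "((\<lambda>x. W (x, y) * fst (G (x, y))) has_real_derivative h1 (x, y)) (at x)" for x y
  proof (cases "u (x, y) = 0")
    case False
    then have "((\<lambda>x. fst (G (x, y))) has_real_derivative L (x, y) - 2 * pi) (at x)"
      using log_density_grad_partial(1)[OF F, of x y] by (simp add: u_def G_def L_def)
    from DERIV_mult[OF DW(1) this] show ?thesis
      by (simp add: h1_def power2_eq_square algebra_simps)
  next
    case True
    have op: "open {x. u (x, y) < exp \<alpha>}"
      by (intro open_Collect_less continuous_on_compose2[OF cu] continuous_intros) auto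
    have "((\<lambda>x::real. 0::real) has_real_derivative h1 (x, y)) (at x)"
      using True by (simp add: h1_def D_def W_def)
    then show ?thesis
      by (rule has_field_derivative_transform_within_open[OF _ op]) (use True zero in auto)
  qed
  have h2: "((\<lambda>y. W (x, y) * snd (G (x, y))) has_real_derivative h2 (x, y)) (at y)" for x y
  proof (cases "u (x, y) = 0")
    case False
    then have "((\<lambda>y. snd (G (x, y))) has_real_derivative - L (x, y) - 2 * pi) (at y)"
      using log_density_grad_partial(2)[OF F, of x y] by (simp add: u_def G_def L_def)
    from DERIV_mult[OF DW(2) this] show ?thesis
      by (simp add: h2_def power2_eq_square algebra_simps)
  next
    case True
    have op: "open {y. u (x, y) < exp \<alpha>}"
      by (intro open_Collect_less continuous_on_compose2[OF cu] continuous_intros) auto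
    have "((\<lambda>y::real. 0::real) has_real_derivative h2 (x, y)) (at y)"
      using True by (simp add: h2_def D_def W_def)
    then show ?thesis
      by (rule has_field_derivative_transform_within_open[OF _ op]) (use True zero in auto)
  qed
  have h0: "h1 z = 0" "h2 z = 0" if "R < norm z" for z
    using bdd[OF that] by (auto simp: zero h1_def h2_def)
  have "(LINT z|lborel. h1 z) = 0"
    by (rule integral_partial_derivatives_compact_support(1)[OF ch(1), of R "\<lambda>z. W z * fst (G z)"])
       (use bdd zero h0 h1 in auto)
  moreover have "(LINT z|lborel. h2 z) = 0"
    by (rule integral_partial_derivatives_compact_support(2)[OF ch(2), of R "\<lambda>z. W z * snd (G z)"])
       (use bdd zero h0 h2 in auto)
  moreover have "integrable lborel h1" "integrable lborel h2"
    using ch h0 by (auto intro: integrable_compact_support[where R = R])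
  ultimately have "(LINT z|lborel. h1 z + h2 z) = 0" by simp
  also have "(\<lambda>z. h1 z + h2 z) = (\<lambda>z. D z * (norm (G z))\<^sup>2 - 4 * pi * W z)"
  proof
    fix z
    have "(norm (G z))\<^sup>2 = (fst (G z))\<^sup>2 + (snd (G z))\<^sup>2" by (cases "G z") (simp add: norm_Pair)
    then show "h1 z + h2 z = D z * (norm (G z))\<^sup>2 - 4 * pi * W z"
      by (simp add: h1_def h2_def algebra_simps)
  qed
  finally show "(LINT z|lborel. D z * (norm (G z))\<^sup>2) = 4 * pi * (LINT z|lborel. W z)"
    using iW iD by simp
qed

section \<open>Decay of the areas of superlevel sets\<close>

lemma
  assumes F: "F holomorphic_on UNIV" and bdd: "\<And>r. 0 < r \<Longrightarrow> bounded {z. r \<le> fock_density F z}"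
    and "0 < r"
  shows emeasure_superlevel: "emeasure lborel {z. r < fock_density F z} = ennreal (measure lborel {z. r < fock_density F z})"
    and fmeasurable_superlevel: "{z. r < fock_density F z} \<in> fmeasurable lborel"
proof -
  have "open {z. r < fock_density F z}"
    using continuous_fock_density[OF F] by (intro open_Collect_less continuous_intros)
  moreover have "bounded {z. r < fock_density F z}"
    by (rule bounded_subset[OF bdd[OF \<open>0 < r\<close>]]) auto
  ultimately show "{z. r < fock_density F z} \<in> fmeasurable lborel"
    using emeasure_bounded_finite by (auto simp: fmeasurable_def)
  then show "emeasure lborel {z. r < fock_density F z} = ennreal (measure lborel {z. r < fock_density F z})"
    by (simp add: emeasure_eq_measure2)
qed

lemma sets_superlevel:
  assumes "F holomorphic_on UNIV"
  shows "{z. r < fock_density F z} \<in> sets borel"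
  using continuous_fock_density[OF assms] by (intro borel_open open_Collect_less continuous_intros)

text \<open>A finite-difference form of \<open>- r * m'(r) >= 1\<close>. The isoperimetric
  inequality sees the inner area \<open>m b\<close> and the divergence theorem the outer area
  \<open>m a\<close>, so the two cancel only in the limit of nearby levels; between distant levels
  the factor \<open>m b / m a\<close> remains.\<close>

lemma measure_superlevel_step:
  fixes F :: "complex \<Rightarrow> complex"
  defines "m \<equiv> \<lambda>r. measure lborel {z. r < fock_density F z}"
  assumes F: "F holomorphic_on UNIV" and bdd: "\<And>r. 0 < r \<Longrightarrow> bounded {z. r \<le> fock_density F z}"
    and ab: "0 < a" "a < b"
  shows "m b * (ln b - ln a) \<le> (m a - m b) * m a"
proof -
  define u where "u = fock_density F"
  define G where "G = log_density_grad F"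
  define d where "d = ln b - ln a"
  have "0 < d" using ab by (simp add: d_def)
  have m0: "0 \<le> m r" for r by (simp add: m_def)
  have mab: "m b \<le> m a"
    unfolding m_def using ab by (intro measure_mono_fmeasurable fmeasurable_superlevel F bdd) (auto intro: sets_superlevel[OF F])
  have main: "m b * (d - k) \<le> (m a - m b) * m a" if k: "0 < k" "2 * k < d" for k
  proof -
    obtain P p where P: "\<And>l. (P has_real_derivative p l) (at l)" "continuous_on UNIV p"
      "\<And>l. 0 \<le> p l" "\<And>l. p l \<le> 1 / (d - k)" "\<And>l. l \<le> 0 \<Longrightarrow> p l = 0" "\<And>l. d \<le> l \<Longrightarrow> p l = 0"
      "\<And>l. l \<le> 0 \<Longrightarrow> P l = 0" "\<And>l. d \<le> l \<Longrightarrow> P l = 1" "\<And>l. 0 \<le> P l" "\<And>l. P l \<le> 1"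
      using smooth_step_exists[OF k] by blast
    have "\<exists>R. \<forall>z\<in>{z. a \<le> u z}. norm z \<le> R"
      using bdd[OF ab(1)] unfolding bounded_iff u_def .
    then obtain R where R: "\<And>z. a \<le> u z \<Longrightarrow> norm z \<le> R" by blast
    have R': "u z < exp (ln a)" if "R < norm z" for z
      using R[of z] that ab by force
    define W where "W z = (if u z = 0 then 0 else P (ln (u z) - ln a))" for z
    define D where "D z = (if u z = 0 then 0 else p (ln (u z) - ln a))" for z
    note E = integral_energy_eq[OF F R'[unfolded u_def] P(1,2,5,7), folded u_def G_def, folded W_def D_def]
    have u0: "0 \<le> u z" for z by (simp add: u_def)
    have D0: "0 \<le> D z" for z using P(3) by (simp add: D_def)
    have D1: "D z \<le> 1 / (d - k) * indicator ({z. a < u z} - {z. b < u z}) z" for z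
    proof -
      have "D z = 0" if "u z \<le> a"
      proof (cases "u z = 0")
        case False
        then have "ln (u z) \<le> ln a" using that u0[of z] ab by (intro ln_mono) auto
        then show ?thesis using P(5) by (simp add: D_def)
      qed (simp add: D_def)
      moreover have "D z = 0" if "b < u z"
      proof -
        have "ln b \<le> ln (u z)" using that ab by (intro ln_mono) auto
        then show ?thesis using P(6)[of "ln (u z) - ln a"] by (simp add: D_def d_def)
      qed
      moreover have "D z \<le> 1 / (d - k)" using P(4) k by (simp add: D_def)
      ultimately show ?thesis by (auto simp: indicator_def not_less)
    qed
    have W01: "0 \<le> W z" "W z \<le> 1" for z using P(9,10) by (auto simp: W_def)
    have W1: "W z \<le> indicator {z. a < u z} z" for z
    proof (cases "a < u z")
      case False
      have "W z = 0"
      proof (cases "u z = 0")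
        case nz: False
        then have "ln (u z) \<le> ln a" using False u0[of z] ab by (intro ln_mono) auto
        then show ?thesis using P(7) by (simp add: W_def)
      qed (simp add: W_def)
      then show ?thesis by simp
    qed (use W01 in simp)
    have Wb: "1 \<le> W z" if "b < u z" for z
    proof -
      have "ln b \<le> ln (u z)" using that ab by (intro ln_mono) auto
      then have "P (ln (u z) - ln a) = 1" by (intro P(8)) (simp add: d_def)
      then show ?thesis using that ab by (simp add: W_def)
    qed
    have supW: "W z = 0" if "R < norm z" for z
      using W1[of z] W01[of z] R'[OF that] ab by simp
    have bW: "bounded {z. 1 \<le> W z}"
      by (rule bounded_subset[of "cball 0 R"]) (use supW in \<open>auto simp: not_less[symmetric]\<close>)
    have clW: "closed {z. 1 \<le> W z}" using E(4) by (intro closed_Collect_le continuous_intros)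
    have fmW: "{z. 1 \<le> W z} \<in> fmeasurable lborel"
      using clW bW emeasure_bounded_finite by (auto simp: fmeasurable_def)
    have "m b \<le> measure lborel {z. 1 \<le> W z}"
      unfolding m_def using Wb ab
      by (intro measure_mono_fmeasurable fmW) (auto simp: u_def intro: sets_superlevel[OF F])
    then have "ennreal (2 * sqrt (pi * m b)) \<le> ennreal (2 * sqrt (pi * measure lborel {z. 1 \<le> W z}))"
      by (intro ennreal_leI) simp
    also have "\<dots> \<le> (\<integral>\<^sup>+z. ennreal (norm (D z *\<^sub>R G z)) \<partial>lborel)"
      by (rule nn_integral_norm_gradient_ge[OF E(1,2), where R = R]) (use supW W01 in auto)
    finally have 1: "ennreal (2 * sqrt (pi * m b)) \<le> (\<integral>\<^sup>+z. ennreal (norm (D z *\<^sub>R G z)) \<partial>lborel)" .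
    have [measurable]: "D \<in> borel_measurable borel" "(\<lambda>z. D z *\<^sub>R G z) \<in> borel_measurable borel"
      "(\<lambda>z. D z * (norm (G z))\<^sup>2) \<in> borel_measurable borel"
      using E(2,3,5) by (auto intro: borel_measurable_continuous_onI)
    have gm: "(\<lambda>z. sqrt (D z) * norm (G z)) \<in> borel_measurable borel"
    proof -
      have "(\<lambda>z. sqrt (D z) * norm (G z)) = (\<lambda>z. sqrt (D z * (norm (G z))\<^sup>2))"
        by (simp add: real_sqrt_mult)
      then show ?thesis by simp
    qed
    \<comment> \<open>The integrand is split as \<open>sqrt (D z)\<close> times
      \<open>sqrt (D z) * norm (G z)\<close>. The square of the first factor integrates to at most
      the area of the shell over \<open>d - k\<close>, that of the second to the energy, which
      equals \<open>4 * pi\<close> times the integral of \<open>W\<close>.\<close>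
    have "(ennreal (2 * sqrt (pi * m b)))\<^sup>2 \<le> (\<integral>\<^sup>+z. ennreal (norm (D z *\<^sub>R G z)) \<partial>lborel)\<^sup>2"
      by (intro power_mono 1) simp
    also have "(\<integral>\<^sup>+z. ennreal (norm (D z *\<^sub>R G z)) \<partial>lborel)
        = (\<integral>\<^sup>+z. ennreal (sqrt (D z)) * ennreal (sqrt (D z) * norm (G z)) \<partial>lborel)"
      using D0 by (intro nn_integral_cong) (simp add: ennreal_mult[symmetric] mult.assoc[symmetric])
    also have "\<dots>\<^sup>2 \<le> (\<integral>\<^sup>+z. (ennreal (sqrt (D z)))\<^sup>2 \<partial>lborel) * (\<integral>\<^sup>+z. (ennreal (sqrt (D z) * norm (G z)))\<^sup>2 \<partial>lborel)"
      using gm by (intro Cauchy_Schwarz_nn_integral) auto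
    also have "(\<integral>\<^sup>+z. (ennreal (sqrt (D z)))\<^sup>2 \<partial>lborel) = (\<integral>\<^sup>+z. ennreal (D z) \<partial>lborel)"
      using D0 by (intro nn_integral_cong) (simp add: ennreal_power)
    also have "\<dots> \<le> (\<integral>\<^sup>+z. ennreal (1 / (d - k)) * indicator ({z. a < u z} - {z. b < u z}) z \<partial>lborel)"
      using k D1 by (intro nn_integral_mono) (auto simp: ennreal_mult[symmetric] ennreal_indicator[symmetric] ennreal_leI simp del: ennreal_indicator)
    also have "\<dots> = ennreal (1 / (d - k)) * emeasure lborel ({z. a < u z} - {z. b < u z})"
      by (rule nn_integral_cmult_indicator) (use sets_superlevel[OF F] in \<open>auto simp: u_def\<close>)
    also have "emeasure lborel ({z. a < u z} - {z. b < u z}) = ennreal (m a - m b)"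
      unfolding m_def u_def using ab
      by (subst emeasure_Diff) (auto simp: emeasure_superlevel[OF F bdd] ennreal_minus intro!: sets_superlevel[OF F])
    also have "(\<integral>\<^sup>+z. (ennreal (sqrt (D z) * norm (G z)))\<^sup>2 \<partial>lborel) = (\<integral>\<^sup>+z. ennreal (D z * (norm (G z))\<^sup>2) \<partial>lborel)"
      using D0 by (intro nn_integral_cong) (simp add: ennreal_power power_mult_distrib)
    also have "\<dots> = ennreal (4 * pi * (LINT z|lborel. W z))"
      using D0 by (subst nn_integral_eq_integral[OF E(5)]) (auto simp: E(7))
    also have "\<dots> \<le> ennreal (4 * pi * m a)"
    proof -
      have "(LINT z|lborel. W z) \<le> (LINT z|lborel. indicator {z. a < u z} z)"
        using W1 E(6) fmeasurable_superlevel[OF F bdd ab(1)]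
        by (intro integral_mono) (auto simp: u_def fmeasurable_def intro!: integrable_real_indicator)
      also have "\<dots> = m a" by (simp add: m_def u_def)
      finally show ?thesis by (intro ennreal_leI) simp
    qed
    finally have "(ennreal (2 * sqrt (pi * m b)))\<^sup>2 \<le> ennreal (1 / (d - k)) * ennreal (m a - m b) * ennreal (4 * pi * m a)"
      by (simp add: mult_left_mono mult_right_mono)
    then have "ennreal (4 * pi * m b) \<le> ennreal (1 / (d - k) * (m a - m b) * (4 * pi * m a))"
      using mab m0 k by (simp add: ennreal_power power_mult_distrib ennreal_mult[symmetric])
    then have "4 * pi * m b \<le> 1 / (d - k) * (m a - m b) * (4 * pi * m a)"
      using mab m0 k by (subst (asm) ennreal_le_iff) auto
    then have "4 * pi * (m b * (d - k)) \<le> 4 * pi * ((m a - m b) * m a)"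
      using k by (simp add: field_simps)
    then show ?thesis by (simp only: mult_le_cancel_left_pos pi_gt_zero mult_pos_pos zero_less_numeral)
  qed
  have "m b * d \<le> (m a - m b) * m a + e" if "0 < e" for e
  proof -
    define k where "k = min (d / 3) (e / (m b + 1))"
    have k: "0 < k" "2 * k < d" using \<open>0 < d\<close> \<open>0 < e\<close> m0[of b] by (auto simp: k_def)
    have "m b * k \<le> (m b + 1) * (e / (m b + 1))"
      using m0[of b] k by (intro mult_mono) (auto simp: k_def)
    then have "m b * k \<le> e" using m0[of b] by simp
    then show ?thesis using main[OF k] by (simp add: algebra_simps)
  qed
  then show ?thesis unfolding d_def by (rule field_le_epsilon)
qed

text \<open>Subdividing and telescoping \<open>x\<^sub>i - x\<^sub>i\<^sub>+\<^sub>1 \<ge> h x\<^sub>i\<^sub>+\<^sub>1 / x\<^sub>i \<ge> h (1 + ln x\<^sub>i\<^sub>+\<^sub>1 - ln x\<^sub>i)\<close>.\<close>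

lemma decrease_of_quotient_step:
  fixes M :: "real \<Rightarrow> real"
  assumes pos: "\<And>t. s \<le> t \<Longrightarrow> t \<le> s + d \<Longrightarrow> 0 < M t" and "0 \<le> d"
    and step: "\<And>t t'. s \<le> t \<Longrightarrow> t < t' \<Longrightarrow> t' \<le> s + d \<Longrightarrow> M t' * (t' - t) \<le> (M t - M t') * M t"
  shows "d \<le> M s - M (s + d)"
proof (cases "d = 0")
  case False
  then have "0 < d" using assms by simp
  \<comment> \<open>The logarithmic corrections of all steps telescope to this single number.
    Multiplied by the step length \<open>d / n\<close> they disappear as the subdivision is
    refined.\<close>
  define c where "c = ln (M (s + d)) - ln (M s)"
  have fin: "d * (1 + c / real n) \<le> M s - M (s + d)" if "0 < n" for n
  proof -
    define h where "h = d / real n"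
    have "0 < h" using \<open>0 < d\<close> that by (simp add: h_def)
    define x where "x i = M (s + real i * h)" for i
    have rng: "s \<le> s + real i * h" "s + real i * h \<le> s + d" if "i \<le> n" for i
    proof -
      have "real i * h \<le> real n * h" using that \<open>0 < h\<close> by (intro mult_right_mono) auto
      then show "s + real i * h \<le> s + d" using \<open>0 < n\<close> by (simp add: h_def)
    qed (use \<open>0 < h\<close> in auto)
    have "h * (1 + (ln (x (Suc i)) - ln (x i))) \<le> x i - x (Suc i)" if "i < n" for i
    proof -
      have p: "0 < x i" "0 < x (Suc i)" using rng[of i] rng[of "Suc i"] that by (auto simp: x_def intro!: pos)
      have "x (Suc i) * h \<le> (x i - x (Suc i)) * x i"
        using step[of "s + real i * h" "s + real (Suc i) * h"] rng[of i] rng[of "Suc i"] that \<open>0 < h\<close>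
        by (simp add: x_def algebra_simps)
      then have "h * (x (Suc i) / x i) \<le> x i - x (Suc i)" using p by (simp add: field_simps)
      moreover have "ln (x (Suc i) / x i) \<le> x (Suc i) / x i - 1" using p by (intro ln_le_minus_one) simp
      then have "h * (1 + (ln (x (Suc i)) - ln (x i))) \<le> h * (x (Suc i) / x i)"
        using p \<open>0 < h\<close> by (intro mult_left_mono) (auto simp: ln_div)
      ultimately show ?thesis by simp
    qed
    then have "(\<Sum>i<n. h * (1 + (ln (x (Suc i)) - ln (x i)))) \<le> (\<Sum>i<n. x i - x (Suc i))"
      by (intro sum_mono) auto
    also have "\<dots> = x 0 - x n" by (rule sum_lessThan_telescope')
    also have "(\<Sum>i<n. h * (1 + (ln (x (Suc i)) - ln (x i)))) = h * (real n + (ln (x n) - ln (x 0)))"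
      using sum_lessThan_telescope[of "\<lambda>i. ln (x i)" n] by (simp add: sum_distrib_left[symmetric] sum.distrib)
    finally show ?thesis using that by (simp add: x_def h_def c_def field_simps)
  qed
  have "(\<lambda>n. d * (1 + c / real n)) \<longlonglongrightarrow> d * (1 + 0)"
    by (intro tendsto_intros lim_const_over_n)
  then have "(\<lambda>n. d * (1 + c / real n)) \<longlonglongrightarrow> d" by simp
  then show ?thesis
    by (rule LIMSEQ_le_const2) (use fin in \<open>auto intro!: exI[of _ 1]\<close>)
qed simp

text \<open>In the variable \<open>t = ln r\<close> the step inequality has the form that
  \<open>decrease_of_quotient_step\<close> requires. The assumption \<open>0 < m b\<close> keeps the
  areas at all levels in between positive, so that their logarithms can be used.\<close>

lemma measure_superlevel_decrease:
  fixes F :: "complex \<Rightarrow> complex"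
  defines "m \<equiv> \<lambda>r. measure lborel {z. r < fock_density F z}"
  assumes F: "F holomorphic_on UNIV" and bdd: "\<And>r. 0 < r \<Longrightarrow> bounded {z. r \<le> fock_density F z}"
    and ab: "0 < a" "a \<le> b" and "0 < m b"
  shows "ln b - ln a \<le> m a - m b"
proof -
  have mono: "m y \<le> m x" if "0 < x" "x \<le> y" for x y
    unfolding m_def using that
    by (intro measure_mono_fmeasurable fmeasurable_superlevel F bdd) (auto intro: sets_superlevel[OF F])
  have "ln b - ln a \<le> m (exp (ln a)) - m (exp (ln a + (ln b - ln a)))"
  proof (rule decrease_of_quotient_step[where M = "\<lambda>t. m (exp t)"])
    fix t assume "ln a \<le> t" "t \<le> ln a + (ln b - ln a)"
    then have "exp t \<le> exp (ln b)" by (subst exp_le_cancel_iff) simp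
    then have "m b \<le> m (exp t)" using ab by (intro mono) auto
    then show "0 < m (exp t)" using \<open>0 < m b\<close> by simp
  next
    fix t t' :: real assume "t < t'"
    then show "m (exp t') * (t' - t) \<le> (m (exp t) - m (exp t')) * m (exp t)"
      using measure_superlevel_step[OF F bdd, of "exp t" "exp t'"] by (simp add: m_def)
  qed (use ab in auto)
  then show ?thesis using ab by simp
qed

section \<open>Square-integrable functions and Plancherel's theorem\<close>

text \<open>The counterpart of \<open>L2_space\<close> over an arbitrary measure. Over
  \<open>lborel\<close> it demands Borel measurable functions, which behave well under products and
  Fubini; \<open>L2_space_rep\<close> links the two notions.\<close>

definition square_integrable :: "'a measure \<Rightarrow> ('a \<Rightarrow> complex) \<Rightarrow> bool" where
  "square_integrable M f \<longleftrightarrow> f \<in> borel_measurable M \<and> integrable M (\<lambda>x. (norm (f x))\<^sup>2)"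

abbreviation sqnorm :: "('a::euclidean_space \<Rightarrow> complex) \<Rightarrow> real" where
  "sqnorm f \<equiv> LINT y|lborel. (norm (f y))\<^sup>2"

lemma square_integrableD:
  assumes "square_integrable M f"
  shows "f \<in> borel_measurable M" "integrable M (\<lambda>x. (norm (f x))\<^sup>2)"
  using assms by (auto simp: square_integrable_def)

lemma norm_square_integral_nonneg [simp]: "0 \<le> (LINT x|M. (norm (f x))\<^sup>2)"
  by (rule Bochner_Integration.integral_nonneg) simp

lemma borel_measurable_cnj [measurable (raw)]:
  "f \<in> borel_measurable M \<Longrightarrow> (\<lambda>x. cnj (f x)) \<in> borel_measurable M"
  by (rule borel_measurable_continuous_on[OF continuous_on_cnj[OF continuous_on_id]])

lemma integrable_norm_mult:
  assumes f: "square_integrable M f" and g: "square_integrable M g"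
  shows "integrable M (\<lambda>x. norm (f x) * norm (g x))"
proof (rule Bochner_Integration.integrable_bound)
  show "integrable M (\<lambda>x. (norm (f x))\<^sup>2 + (norm (g x))\<^sup>2)"
    using square_integrableD[OF f] square_integrableD[OF g] by auto
  show "(\<lambda>x. norm (f x) * norm (g x)) \<in> borel_measurable M"
    using square_integrableD[OF f] square_integrableD[OF g] by auto
  show "AE x in M. norm (norm (f x) * norm (g x)) \<le> norm ((norm (f x))\<^sup>2 + (norm (g x))\<^sup>2)"
  proof (rule AE_I2)
    fix x
    have "2 * (norm (f x) * norm (g x)) \<le> (norm (f x))\<^sup>2 + (norm (g x))\<^sup>2"
      using sum_squares_bound[of "norm (f x)" "norm (g x)"] by (simp add: mult.assoc)
    then show "norm (norm (f x) * norm (g x)) \<le> norm ((norm (f x))\<^sup>2 + (norm (g x))\<^sup>2)"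
    proof -
      have "norm (norm (f x) * norm (g x)) = norm (f x) * norm (g x)"
        "norm ((norm (f x))\<^sup>2 + (norm (g x))\<^sup>2) = (norm (f x))\<^sup>2 + (norm (g x))\<^sup>2"
        "0 \<le> norm (f x) * norm (g x)" by simp_all
      then show ?thesis using \<open>2 * (norm (f x) * norm (g x)) \<le> (norm (f x))\<^sup>2 + (norm (g x))\<^sup>2\<close> by linarith
    qed
  qed
qed

lemma integrable_mult_cnj:
  assumes f: "square_integrable M f" and g: "square_integrable M g"
  shows "integrable M (\<lambda>x. f x * cnj (g x))"
  by (rule Bochner_Integration.integrable_bound[OF integrable_norm_mult[OF f g]])
     (use square_integrableD[OF f] square_integrableD[OF g] in \<open>auto simp: norm_mult\<close>)

lemma integral_norm_mult_le:
  assumes f: "square_integrable M f" and g: "square_integrable M g"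
  shows "(LINT x|M. norm (f x) * norm (g x))
    \<le> sqrt (LINT x|M. (norm (f x))\<^sup>2) * sqrt (LINT x|M. (norm (g x))\<^sup>2)"
proof -
  define A where "A = (LINT x|M. norm (f x) * norm (g x))"
  have [measurable]: "f \<in> borel_measurable M" "g \<in> borel_measurable M"
    using f g square_integrableD by auto
  have "0 \<le> A" unfolding A_def by (rule Bochner_Integration.integral_nonneg) simp
  have "ennreal A = (\<integral>\<^sup>+x. ennreal (norm (f x)) * ennreal (norm (g x)) \<partial>M)"
    unfolding A_def by (subst nn_integral_eq_integral[symmetric, OF integrable_norm_mult[OF f g]])
      (auto simp: ennreal_mult)
  then have "(ennreal A)\<^sup>2 \<le> (\<integral>\<^sup>+x. (ennreal (norm (f x)))\<^sup>2 \<partial>M) * (\<integral>\<^sup>+x. (ennreal (norm (g x)))\<^sup>2 \<partial>M)"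
    by (simp add: Cauchy_Schwarz_nn_integral)
  also have "(\<integral>\<^sup>+x. (ennreal (norm (f x)))\<^sup>2 \<partial>M) = ennreal (LINT x|M. (norm (f x))\<^sup>2)"
    by (subst nn_integral_eq_integral[symmetric]) (use f square_integrableD in \<open>auto simp: ennreal_power\<close>)
  also have "(\<integral>\<^sup>+x. (ennreal (norm (g x)))\<^sup>2 \<partial>M) = ennreal (LINT x|M. (norm (g x))\<^sup>2)"
    by (subst nn_integral_eq_integral[symmetric]) (use g square_integrableD in \<open>auto simp: ennreal_power\<close>)
  finally have "A\<^sup>2 \<le> (LINT x|M. (norm (f x))\<^sup>2) * (LINT x|M. (norm (g x))\<^sup>2)"
    using \<open>0 \<le> A\<close> by (simp add: ennreal_power ennreal_mult[symmetric])
  then have "sqrt (A\<^sup>2) \<le> sqrt ((LINT x|M. (norm (f x))\<^sup>2) * (LINT x|M. (norm (g x))\<^sup>2))"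
    by (rule real_sqrt_le_mono)
  then show ?thesis using \<open>0 \<le> A\<close> by (simp add: A_def real_sqrt_mult)
qed

lemma norm_integral_mult_cnj_le:
  assumes f: "square_integrable M f" and g: "square_integrable M g"
  shows "norm (LINT x|M. f x * cnj (g x))
    \<le> sqrt (LINT x|M. (norm (f x))\<^sup>2) * sqrt (LINT x|M. (norm (g x))\<^sup>2)"
proof -
  have "norm (LINT x|M. f x * cnj (g x)) \<le> (LINT x|M. norm (f x * cnj (g x)))"
    by (rule integral_norm_bound)
  then show ?thesis using integral_norm_mult_le[OF f g] by (simp add: norm_mult)
qed

lemma square_integrable_cmult:
  "square_integrable M f \<Longrightarrow> square_integrable M (\<lambda>x. c * f x)"
  by (auto simp: square_integrable_def norm_mult power_mult_distrib)

lemma square_integrable_add: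
  assumes f: "square_integrable M f" and g: "square_integrable M g"
  shows "square_integrable M (\<lambda>x. f x + g x)"
  unfolding square_integrable_def
proof
  show m: "(\<lambda>x. f x + g x) \<in> borel_measurable M"
    using square_integrableD(1)[OF f] square_integrableD(1)[OF g] by measurable
  show "integrable M (\<lambda>x. (norm (f x + g x))\<^sup>2)"
  proof (rule Bochner_Integration.integrable_bound)
    show "integrable M (\<lambda>x. 2 * ((norm (f x))\<^sup>2 + (norm (g x))\<^sup>2))"
      using square_integrableD(2)[OF f] square_integrableD(2)[OF g] by auto
    show "AE x in M. norm ((norm (f x + g x))\<^sup>2) \<le> norm (2 * ((norm (f x))\<^sup>2 + (norm (g x))\<^sup>2))"
    proof (rule AE_I2)
      fix x
      have "(norm (f x + g x))\<^sup>2 \<le> (norm (f x) + norm (g x))\<^sup>2"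
        by (intro power_mono norm_triangle_ineq) simp
      also have "\<dots> \<le> 2 * ((norm (f x))\<^sup>2 + (norm (g x))\<^sup>2)"
        using sum_squares_bound[of "norm (f x)" "norm (g x)"] by (simp add: power2_sum)
      finally show "norm ((norm (f x + g x))\<^sup>2) \<le> norm (2 * ((norm (f x))\<^sup>2 + (norm (g x))\<^sup>2))" by simp
    qed
  qed (use m in measurable)
qed

lemma square_integrable_diff:
  assumes "square_integrable M f" "square_integrable M g"
  shows "square_integrable M (\<lambda>x. f x - g x)"
  using square_integrable_add[OF assms(1) square_integrable_cmult[OF assms(2), of "-1"]] by simp

lemma square_integrable_translate:
  fixes h :: "real \<Rightarrow> complex"
  assumes "square_integrable lborel h" 
  shows "square_integrable lborel (\<lambda>y. h (y - t))"
    "(LINT y|lborel. (norm (h (y - t)))\<^sup>2) = sqnorm h"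
proof -
  have [measurable]: "h \<in> borel_measurable borel" using square_integrableD[OF assms] by simp
  have "integrable lborel (\<lambda>y. (norm (h (- t + 1 * y)))\<^sup>2)"
    using square_integrableD[OF assms] by (intro lborel_integrable_real_affine) auto
  then show "square_integrable lborel (\<lambda>y. h (y - t))" by (simp add: square_integrable_def)
  show "(LINT y|lborel. (norm (h (y - t)))\<^sup>2) = sqnorm h"
    by (subst lborel_integral_real_affine[of 1 "\<lambda>y. (norm (h y))\<^sup>2" "-t"]) auto
qed

lemma norm_square_triangle3: "(norm (a + b + c))\<^sup>2 \<le> 3 * ((norm a)\<^sup>2 + (norm b)\<^sup>2 + (norm (c::complex))\<^sup>2)"
proof -
  have "(norm (a + b + c))\<^sup>2 \<le> (norm a + norm b + norm c)\<^sup>2"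
    by (intro power_mono norm_triangle_le add_mono norm_triangle_ineq) auto
  also have "\<dots> \<le> 3 * ((norm a)\<^sup>2 + (norm b)\<^sup>2 + (norm c)\<^sup>2)"
    using sum_squares_bound[of "norm a" "norm b"] sum_squares_bound[of "norm a" "norm c"]
      sum_squares_bound[of "norm b" "norm c"]
    by (simp add: power2_eq_square algebra_simps)
  finally show ?thesis .
qed

section \<open>Continuous approximation and continuity of translation\<close>

lemma square_integrable_approx_bounded:
  fixes h :: "real \<Rightarrow> complex"
  assumes "square_integrable lborel h" "0 < \<eta>"
  obtains n :: nat where
    "(LINT y|lborel. (norm (h y - (if \<bar>y\<bar> \<le> real n \<and> norm (h y) \<le> real n then h y else 0)))\<^sup>2) < \<eta>"
proof -
  have [measurable]: "h \<in> borel_measurable borel" using square_integrableD[OF assms(1)] by simp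
  have "(\<lambda>n. LINT y|lborel. (norm (h y - (if \<bar>y\<bar> \<le> real n \<and> norm (h y) \<le> real n then h y else 0)))\<^sup>2)
    \<longlonglongrightarrow> integral\<^sup>L (lborel :: real measure) (\<lambda>y. 0 :: real)"
  proof (rule integral_dominated_convergence[where w = "\<lambda>y. (norm (h y))\<^sup>2"])
    show "AE y in lborel. (\<lambda>n. (norm (h y - (if \<bar>y\<bar> \<le> real n \<and> norm (h y) \<le> real n then h y else 0)))\<^sup>2) \<longlonglongrightarrow> 0"
    proof (rule AE_I2)
      fix y
      have "\<forall>\<^sub>F n in sequentially. \<bar>y\<bar> \<le> real n \<and> norm (h y) \<le> real n"
      proof -
        obtain N where "max \<bar>y\<bar> (norm (h y)) \<le> real N" using real_arch_simple by blast
        then show ?thesis unfolding eventually_sequentially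
          by (intro exI[of _ N]) (auto intro: order_trans[OF _ of_nat_mono])
      qed
      then have "\<forall>\<^sub>F n in sequentially. (norm (h y - (if \<bar>y\<bar> \<le> real n \<and> norm (h y) \<le> real n then h y else 0)))\<^sup>2 = 0"
        by eventually_elim simp
      then show "(\<lambda>n. (norm (h y - (if \<bar>y\<bar> \<le> real n \<and> norm (h y) \<le> real n then h y else 0)))\<^sup>2) \<longlonglongrightarrow> 0"
        by (rule tendsto_eventually)
    qed
  qed (use square_integrableD[OF assms(1)] in auto)
  then have "\<forall>\<^sub>F n in sequentially. (LINT y|lborel. (norm (h y - (if \<bar>y\<bar> \<le> real n \<and> norm (h y) \<le> real n then h y else 0)))\<^sup>2) < \<eta>"
    using assms(2) by (intro order_tendstoD(2)) auto
  then show thesis using that by (auto dest: eventually_happens)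
qed

text \<open>A truncation of \<open>h\<close> is an almost everywhere limit of continuous functions.
  These are retracted to a ball in the complex plane and multiplied by a cut-off, so that dominated
  convergence gives approximation in the mean.\<close>

lemma square_integrable_approx_continuous:
  fixes h :: "real \<Rightarrow> complex"
  assumes "square_integrable lborel h" "0 < \<eta>"
  obtains g R B where "continuous_on UNIV g" "\<And>y. R < \<bar>y\<bar> \<Longrightarrow> g y = 0" "\<And>y. norm (g y) \<le> B"
    "(LINT y|lborel. (norm (h y - g y))\<^sup>2) < \<eta>"
proof -
  have [measurable]: "h \<in> borel_measurable borel" using square_integrableD[OF assms(1)] by simp
  obtain n where n: "(LINT y|lborel. (norm (h y - (if \<bar>y\<bar> \<le> real n \<and> norm (h y) \<le> real n then h y else 0)))\<^sup>2) < \<eta> / 4"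
    using square_integrable_approx_bounded[OF assms(1), of "\<eta>/4"] assms(2) by auto
  define f where "f y = (if \<bar>y\<bar> \<le> real n \<and> norm (h y) \<le> real n then h y else 0)" for y
  have [measurable]: "f \<in> borel_measurable borel" unfolding f_def by measurable
  have fn: "norm (f y) \<le> real n" for y by (simp add: f_def)
  have "f measurable_on UNIV"
    by (rule lebesgue_measurable_imp_measurable_on) (simp_all add: measurable_completion)
  then obtain N G where N: "negligible N" and G: "\<And>k. continuous_on UNIV (G k)"
    "\<And>x. x \<notin> N \<Longrightarrow> (\<lambda>k::nat. G k x) \<longlonglongrightarrow> f x"
    unfolding measurable_on_def by auto
  \<comment> \<open>One more than the truncation bound: \<open>cut\<close> is 1 where
    \<open>\<bar>y\<bar> \<le> real n\<close> and descends to 0 over the remaining unit.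
    \<open>c\<close> is the radial retraction onto the ball of radius \<open>m\<close>, hence the
    identity on the values of \<open>f\<close>.\<close>
  define m where "m = real n + 1"
  have "m > 0" by (simp add: m_def)
  define c where "c z = (1 / max 1 (norm z / m)) *\<^sub>R z" for z :: complex
  have c_cont: "continuous_on UNIV c"
    unfolding c_def by (intro continuous_intros) (use \<open>m > 0\<close> in auto)
  have c_norm: "norm (c z) \<le> m" for z
    using \<open>m > 0\<close> by (auto simp: c_def max_def field_simps)
  have c_id: "c z = z" if "norm z \<le> m" for z
    using that \<open>m > 0\<close> by (simp add: c_def max_def field_simps)
  define cut where "cut y = max 0 (min 1 (m - \<bar>y\<bar>))" for y :: real
  have cut01: "0 \<le> cut y" "cut y \<le> 1" for y by (auto simp: cut_def)
  define g where "g k y = cut y *\<^sub>R c (G k y)" for k y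
  have gc: "continuous_on UNIV (g k)" for k
    unfolding g_def cut_def by (intro continuous_intros continuous_on_compose2[OF c_cont G(1)]) auto
  then have [measurable]: "g k \<in> borel_measurable borel" for k by (rule borel_measurable_continuous_onI)
  have g0: "g k y = 0" if "m < \<bar>y\<bar>" for k y using that by (simp add: g_def cut_def)
  have gB: "norm (g k y) \<le> m" for k y
  proof -
    have "norm (g k y) = cut y * norm (c (G k y))" using cut01 by (simp add: g_def)
    also have "\<dots> \<le> 1 * m" using cut01 c_norm by (intro mult_mono) auto
    finally show ?thesis by simp
  qed
  have "(\<lambda>k. LINT y|lborel. (norm (f y - g k y))\<^sup>2) \<longlonglongrightarrow> integral\<^sup>L (lborel :: real measure) (\<lambda>y. 0 :: real)"
  proof (rule integral_dominated_convergence[where w = "\<lambda>y. indicator {-m..m} y *\<^sub>R (2 * m)\<^sup>2"])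
    show "integrable lborel (\<lambda>y. indicator {-m..m} y *\<^sub>R (2 * m)\<^sup>2)"
      using borel_integrable_compact[of "{-m..m}" "\<lambda>y. (2 * m)\<^sup>2"] by simp
    show "AE y in lborel. norm ((norm (f y - g k y))\<^sup>2) \<le> indicator {-m..m} y *\<^sub>R (2 * m)\<^sup>2" for k
    proof (rule AE_I2)
      fix y
      show "norm ((norm (f y - g k y))\<^sup>2) \<le> indicator {-m..m} y *\<^sub>R (2 * m)\<^sup>2"
      proof (cases "\<bar>y\<bar> \<le> m")
        case True
        have "norm (f y - g k y) \<le> 2 * m"
          using norm_triangle_ineq4[of "f y" "g k y"] fn[of y] gB[of k y] by (simp add: m_def)
        then have "(norm (f y - g k y))\<^sup>2 \<le> (2 * m)\<^sup>2" by (intro power_mono) auto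
        then show ?thesis using True by (simp add: abs_le_iff)
      next
        case False
        then have "f y = 0" "g k y = 0" using g0 by (auto simp: f_def m_def)
        then show ?thesis by simp
      qed
    qed
    have "AE y in lborel. y \<notin> N"
      using N by (metis AE_completion_iff AE_not_in negligible_iff_null_sets)
    then show "AE y in lborel. (\<lambda>k. (norm (f y - g k y))\<^sup>2) \<longlonglongrightarrow> 0"
    proof eventually_elim
      fix y assume "y \<notin> N"
      have "(\<lambda>k. c (G k y)) \<longlonglongrightarrow> c (f y)"
        using continuous_on_tendsto_compose[OF c_cont G(2)[OF \<open>y \<notin> N\<close>]] by simp
      then have "(\<lambda>k. g k y) \<longlonglongrightarrow> cut y *\<^sub>R c (f y)"
        unfolding g_def by (intro tendsto_intros)
      also have "cut y *\<^sub>R c (f y) = f y"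
        using fn[of y] c_id[of "f y"] by (auto simp: m_def cut_def f_def)
      finally have "(\<lambda>k. (norm (f y - g k y))\<^sup>2) \<longlonglongrightarrow> (norm (f y - f y))\<^sup>2"
        by (intro tendsto_intros)
      then show "(\<lambda>k. (norm (f y - g k y))\<^sup>2) \<longlonglongrightarrow> 0" by simp
    qed
  qed auto
  then have "\<forall>\<^sub>F k in sequentially. (LINT y|lborel. (norm (f y - g k y))\<^sup>2) < \<eta> / 4"
    using assms(2) by (intro order_tendstoD(2)) auto
  then obtain k where k: "(LINT y|lborel. (norm (f y - g k y))\<^sup>2) < \<eta> / 4"
    by (auto dest: eventually_happens)
  have sf: "square_integrable lborel f"
    unfolding square_integrable_def
    by (auto intro!: Bochner_Integration.integrable_bound[OF square_integrableD(2)[OF assms(1)]] simp: f_def)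
  have sg: "square_integrable lborel (g k)"
  proof -
    have "integrable lborel (\<lambda>y. indicator {-m..m} y *\<^sub>R (norm (g k y))\<^sup>2)"
      using continuous_on_subset[OF gc] by (intro borel_integrable_compact continuous_intros) auto
    also have "(\<lambda>y. indicator {-m..m} y *\<^sub>R (norm (g k y))\<^sup>2) = (\<lambda>y. (norm (g k y))\<^sup>2)"
      using g0 by (fastforce split: split_indicator simp: abs_le_iff not_le)
    finally show ?thesis by (simp add: square_integrable_def)
  qed
  have "(LINT y|lborel. (norm (h y - g k y))\<^sup>2) \<le> (LINT y|lborel. 2 * (norm (h y - f y))\<^sup>2 + 2 * (norm (f y - g k y))\<^sup>2)"
  proof (rule integral_mono)
    show "integrable lborel (\<lambda>y. (norm (h y - g k y))\<^sup>2)"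
      using square_integrableD square_integrable_diff[OF assms(1) sg] by blast
    show "integrable lborel (\<lambda>y. 2 * (norm (h y - f y))\<^sup>2 + 2 * (norm (f y - g k y))\<^sup>2)"
      using square_integrableD(2)[OF square_integrable_diff[OF assms(1) sf]] square_integrableD(2)[OF square_integrable_diff[OF sf sg]]
      by auto
    fix y
    have "(norm ((h y - f y) + (f y - g k y)))\<^sup>2 \<le> (norm (h y - f y) + norm (f y - g k y))\<^sup>2"
      by (intro power_mono norm_triangle_ineq) simp
    also have "\<dots> \<le> 2 * (norm (h y - f y))\<^sup>2 + 2 * (norm (f y - g k y))\<^sup>2"
      using sum_squares_bound[of "norm (h y - f y)" "norm (f y - g k y)"] by (simp add: power2_sum)
    finally show "(norm (h y - g k y))\<^sup>2 \<le> 2 * (norm (h y - f y))\<^sup>2 + 2 * (norm (f y - g k y))\<^sup>2" by simp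
  qed
  also have "\<dots> = 2 * (LINT y|lborel. (norm (h y - f y))\<^sup>2) + 2 * (LINT y|lborel. (norm (f y - g k y))\<^sup>2)"
    using square_integrableD(2)[OF square_integrable_diff[OF assms(1) sf]] square_integrableD(2)[OF square_integrable_diff[OF sf sg]]
    by simp
  also have "\<dots> < \<eta>" using n k by (simp add: f_def[symmetric])
  finally show thesis using that[of "g k" m m] gc g0 gB by blast
qed

text \<open>Translation is continuous in the mean on continuous functions of bounded support, by
  dominated convergence, and the approximation carries this over to \<open>h\<close>.\<close>

lemma integral_translate_diff_tendsto_0:
  fixes h :: "real \<Rightarrow> complex" and t :: "nat \<Rightarrow> real"
  assumes h: "square_integrable lborel h" and t: "t \<longlonglongrightarrow> 0"
  shows "(\<lambda>k. LINT y|lborel. (norm (h y - h (y - t k)))\<^sup>2) \<longlonglongrightarrow> 0"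
proof (rule LIMSEQ_I)
  fix \<eta> :: real assume "0 < \<eta>"
  \<comment> \<open>Three terms below \<open>\<eta> / 12\<close> and the factor 3 of
    \<open>norm_square_triangle3\<close> leave a total below \<open>3 / 4 * \<eta>\<close>.\<close>
  obtain g R B where g: "continuous_on UNIV g" "\<And>y. R < \<bar>y\<bar> \<Longrightarrow> g y = 0" "\<And>y. norm (g y) \<le> B"
    "(LINT y|lborel. (norm (h y - g y))\<^sup>2) < \<eta> / 12"
    using square_integrable_approx_continuous[OF h, of "\<eta> / 12"] \<open>0 < \<eta>\<close> by auto
  have [measurable]: "h \<in> borel_measurable borel" using square_integrableD[OF h] by simp
  have [measurable]: "g \<in> borel_measurable borel" using g(1) by (rule borel_measurable_continuous_onI)
  have sg: "square_integrable lborel g"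
  proof -
    have "integrable lborel (\<lambda>y. indicator {-R..R} y *\<^sub>R (norm (g y))\<^sup>2)"
      using continuous_on_subset[OF g(1)] by (intro borel_integrable_compact continuous_intros) auto
    also have "(\<lambda>y. indicator {-R..R} y *\<^sub>R (norm (g y))\<^sup>2) = (\<lambda>y. (norm (g y))\<^sup>2)"
      using g(2) by (fastforce split: split_indicator simp: abs_le_iff not_le)
    finally show ?thesis by (simp add: square_integrable_def)
  qed
  obtain T where T: "\<And>k. \<bar>t k\<bar> \<le> T" 
    using convergent_imp_Bseq[of t] t unfolding Bseq_def convergent_def real_norm_def by blast
  have "B \<ge> 0" using g(3)[of 0] norm_ge_zero order_trans by blast
  define S where "S = R + T"
  have "(\<lambda>k. LINT y|lborel. (norm (g y - g (y - t k)))\<^sup>2) \<longlonglongrightarrow> integral\<^sup>L (lborel :: real measure) (\<lambda>y. 0 :: real)"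
  proof (rule integral_dominated_convergence[where w = "\<lambda>y. indicator {-S..S} y *\<^sub>R (2 * B)\<^sup>2"])
    show "integrable lborel (\<lambda>y. indicator {-S..S} y *\<^sub>R (2 * B)\<^sup>2)"
      using borel_integrable_compact[of "{-S..S}" "\<lambda>y. (2 * B)\<^sup>2"] by simp
    show "AE y in lborel. norm ((norm (g y - g (y - t k)))\<^sup>2) \<le> indicator {-S..S} y *\<^sub>R (2 * B)\<^sup>2" for k
    proof (rule AE_I2)
      fix y
      show "norm ((norm (g y - g (y - t k)))\<^sup>2) \<le> indicator {-S..S} y *\<^sub>R (2 * B)\<^sup>2"
      proof (cases "\<bar>y\<bar> \<le> S")
        case True
        have "norm (g y - g (y - t k)) \<le> 2 * B"
          using norm_triangle_ineq4[of "g y" "g (y - t k)"] g(3)[of y] g(3)[of "y - t k"] by simp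
        then have "(norm (g y - g (y - t k)))\<^sup>2 \<le> (2 * B)\<^sup>2" by (intro power_mono) auto
        then show ?thesis using True by (simp add: abs_le_iff)
      next
        case False
        then have "g y = 0" "g (y - t k) = 0" using T[of k] by (auto simp: S_def intro!: g(2))
        then show ?thesis by simp
      qed
    qed
    show "AE y in lborel. (\<lambda>k. (norm (g y - g (y - t k)))\<^sup>2) \<longlonglongrightarrow> 0"
    proof (rule AE_I2)
      fix y
      have "(\<lambda>k. y - t k) \<longlonglongrightarrow> y - 0" by (intro tendsto_intros t)
      then have "(\<lambda>k. g (y - t k)) \<longlonglongrightarrow> g y"
        using continuous_on_tendsto_compose[OF g(1), of "\<lambda>k. y - t k" y] by simp
      then have "(\<lambda>k. (norm (g y - g (y - t k)))\<^sup>2) \<longlonglongrightarrow> (norm (g y - g y))\<^sup>2" by (intro tendsto_intros)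
      then show "(\<lambda>k. (norm (g y - g (y - t k)))\<^sup>2) \<longlonglongrightarrow> 0" by simp
    qed
  qed auto
  then have "\<forall>\<^sub>F k in sequentially. (LINT y|lborel. (norm (g y - g (y - t k)))\<^sup>2) < \<eta> / 12"
    using \<open>0 < \<eta>\<close> by (intro order_tendstoD(2)) auto
  then obtain N where N: "\<And>k. k \<ge> N \<Longrightarrow> (LINT y|lborel. (norm (g y - g (y - t k)))\<^sup>2) < \<eta> / 12"
    unfolding eventually_sequentially by blast
  have "(LINT y|lborel. (norm (h y - h (y - t k)))\<^sup>2) < \<eta>" if "k \<ge> N" for k
  proof -
    have s1: "square_integrable lborel (\<lambda>y. h y - g y)" using h sg by (rule square_integrable_diff)
    note s1' = square_integrable_translate[OF s1, of "t k"]
    have s2: "square_integrable lborel (\<lambda>y. g y - g (y - t k))"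
      by (intro square_integrable_diff square_integrable_translate sg)
    have s3: "square_integrable lborel (\<lambda>y. h y - h (y - t k))"
      by (intro square_integrable_diff square_integrable_translate h)
    have "(LINT y|lborel. (norm (h y - h (y - t k)))\<^sup>2) \<le> (LINT y|lborel. 3 * ((norm (h y - g y))\<^sup>2
        + (norm (g y - g (y - t k)))\<^sup>2 + (norm (h (y - t k) - g (y - t k)))\<^sup>2))"
    proof (rule integral_mono)
      fix y
      show "(norm (h y - h (y - t k)))\<^sup>2 \<le> 3 * ((norm (h y - g y))\<^sup>2
        + (norm (g y - g (y - t k)))\<^sup>2 + (norm (h (y - t k) - g (y - t k)))\<^sup>2)"
        using norm_square_triangle3[of "h y - g y" "g y - g (y - t k)" "g (y - t k) - h (y - t k)"]
        by (simp add: norm_minus_commute)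
    qed (use square_integrableD(2)[OF s1] square_integrableD(2)[OF s1'(1)] square_integrableD(2)[OF s2]
        square_integrableD(2)[OF s3] in auto)
    also have "\<dots> = 3 * ((LINT y|lborel. (norm (h y - g y))\<^sup>2)
        + (LINT y|lborel. (norm (g y - g (y - t k)))\<^sup>2) + (LINT y|lborel. (norm (h (y - t k) - g (y - t k)))\<^sup>2))"
      using s1 s1' s2 by (simp add: square_integrable_def)
    also have "\<dots> < \<eta>" using s1'(2) g(4) N[OF that] \<open>0 < \<eta>\<close> by simp
    finally show ?thesis .
  qed
  then show "\<exists>N. \<forall>k\<ge>N. norm ((LINT y|lborel. (norm (h y - h (y - t k)))\<^sup>2) - 0) < \<eta>"
    by (intro exI[of _ N]) simp
qed

section \<open>The Fourier transform of Gaussians and Plancherel\<close>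

definition fourier :: "(real \<Rightarrow> complex) \<Rightarrow> real \<Rightarrow> complex" where
  "fourier h \<omega> = (LINT y|lborel. exp (- 2 * of_real pi * \<i> * of_real y * of_real \<omega>) * h y)"

lemma norm_exp_imag [simp]: "norm (exp (- (2 * of_real pi * \<i> * of_real y * of_real \<omega>))) = 1"
  "norm (exp (2 * of_real pi * \<i> * of_real y * of_real \<omega>)) = 1"
  by (simp_all add: norm_exp_eq_Re)

text \<open>The characteristic function of the standard normal law after the rescaling by
  \<open>k\<close>, which turns \<open>exp (- pi * c * x\<^sup>2)\<close> into the normal density up
  to the factor \<open>sqrt (2 * pi)\<close>.\<close>

lemma gaussian_fourier:
  assumes "0 < c"
  shows "integrable lborel (\<lambda>x. exp (- pi * c * x\<^sup>2))"
    and "fourier (\<lambda>x. of_real (exp (- pi * c * x\<^sup>2))) t = of_real (exp (- pi * t\<^sup>2 / c) / sqrt c)"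
proof -
  define k where "k = sqrt (2 * pi * c)"
  have k: "0 < k" "k\<^sup>2 = 2 * pi * c" using assms by (simp_all add: k_def)
  have dens: "std_normal_density (k * x) = exp (- pi * c * x\<^sup>2) / sqrt (2 * pi)" for x
    by (simp add: std_normal_density_def power_mult_distrib k)
  have "integrable lborel (\<lambda>x. std_normal_density (0 + k * x))"
    using k by (intro lborel_integrable_real_affine integrable_normal_density) auto
  then have "integrable lborel (\<lambda>x. sqrt (2 * pi) * (exp (- pi * c * x\<^sup>2) / sqrt (2 * pi)))"
    unfolding add_0_left dens by (intro integrable_mult_right)
  then show "integrable lborel (\<lambda>x. exp (- pi * c * x\<^sup>2))" by simp
  define s where "s = - 2 * pi * t / k"
  have "char std_normal_distribution s = (CLINT x|lborel. std_normal_density x *\<^sub>R iexp (s * x))"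
    unfolding char_def
    by (subst integral_density) auto
  also have "\<dots> = \<bar>k\<bar> *\<^sub>R (CLINT x|lborel. std_normal_density (0 + k * x) *\<^sub>R iexp (s * (0 + k * x)))"
    using k by (intro lborel_integral_real_affine) auto
  also have "(\<lambda>x. std_normal_density (0 + k * x) *\<^sub>R iexp (s * (0 + k * x)))
     = (\<lambda>x. of_real (1 / sqrt (2 * pi)) * (exp (- 2 * of_real pi * \<i> * of_real x * of_real t) * of_real (exp (- pi * c * x\<^sup>2))))"
  proof
    fix x
    have "s * (k * x) = - 2 * pi * x * t" using k by (simp add: s_def)
    then have "iexp (s * (0 + k * x)) = exp (- 2 * of_real pi * \<i> * of_real x * of_real t)"
      by (simp add: mult_ac)
    then show "std_normal_density (0 + k * x) *\<^sub>R iexp (s * (0 + k * x)) = 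
      of_real (1 / sqrt (2 * pi)) * (exp (- 2 * of_real pi * \<i> * of_real x * of_real t) * of_real (exp (- pi * c * x\<^sup>2)))"
      unfolding add_0_left dens by (simp add: scaleR_conv_of_real)
  qed
  also have "\<bar>k\<bar> *\<^sub>R (CLINT x|lborel. of_real (1 / sqrt (2 * pi)) * (exp (- 2 * of_real pi * \<i> * of_real x * of_real t) * of_real (exp (- pi * c * x\<^sup>2))))
    = of_real (k / sqrt (2 * pi)) * fourier (\<lambda>x. of_real (exp (- pi * c * x\<^sup>2))) t"
    using k by (simp add: fourier_def scaleR_conv_of_real)
  also have "k / sqrt (2 * pi) = sqrt c" by (simp add: k_def real_sqrt_mult)
  finally have "of_real (sqrt c) * fourier (\<lambda>x. of_real (exp (- pi * c * x\<^sup>2))) t = of_real (exp (- (s\<^sup>2) / 2))"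
    by (simp add: char_std_normal_distribution)
  also have "- (s\<^sup>2) / 2 = - pi * t\<^sup>2 / c"
    using k assms by (simp add: s_def power_divide power_mult_distrib field_simps power2_eq_square)
  finally have "of_real (1 / sqrt c) * (of_real (sqrt c) * fourier (\<lambda>x. of_real (exp (- pi * c * x\<^sup>2))) t)
     = of_real (1 / sqrt c) * (of_real (exp (- pi * t\<^sup>2 / c)) :: complex)" by simp
  then show "fourier (\<lambda>x. of_real (exp (- pi * c * x\<^sup>2))) t = of_real (exp (- pi * t\<^sup>2 / c) / sqrt c)"
    using assms by (simp add: mult.assoc[symmetric] of_real_mult[symmetric] del: of_real_mult)
qed

lemma integral_gaussian:
  assumes "0 < c"
  shows "(LINT x|lborel. exp (- pi * c * x\<^sup>2)) = 1 / sqrt c"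
proof -
  have "of_real (LINT x|lborel. exp (- pi * c * x\<^sup>2)) = fourier (\<lambda>x. of_real (exp (- pi * c * x\<^sup>2))) 0"
    by (simp add: fourier_def)
  also have "\<dots> = of_real (1 / sqrt c)" using gaussian_fourier(2)[OF assms, of 0] by simp
  finally show ?thesis by (simp only: of_real_eq_iff)
qed

text \<open>The bounded factor \<open>b\<close> couples the variables, and
  \<open>B * norm (f x) * norm (g y)\<close> is an integrable majorant.\<close>

lemma Fubini_kernel:
  fixes f :: "'a::euclidean_space \<Rightarrow> complex" and g :: "'b::euclidean_space \<Rightarrow> complex" and b :: "'a \<times> 'b \<Rightarrow> complex"
  assumes f: "integrable lborel f" and g: "integrable lborel g"
    and b[measurable]: "b \<in> borel_measurable borel" and B: "\<And>x. norm (b x) \<le> B"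
  shows "(LINT x|lborel. f x * (LINT y|lborel. g y * b (x, y))) = (LINT y|lborel. g y * (LINT x|lborel. f x * b (x, y)))"
    and "integrable lborel (\<lambda>x. f x * (LINT y|lborel. g y * b (x, y)))"
proof -
  have [measurable]: "f \<in> borel_measurable borel" "g \<in> borel_measurable borel"
    using f g by auto
  have bm[measurable]: "b \<in> borel_measurable (lborel \<Otimes>\<^sub>M lborel)" by (simp add: lborel_prod)
  have B0: "0 \<le> B" using B norm_ge_zero order_trans by blast
  have gi: "integrable lborel (\<lambda>y. g y * b (x, y))" for x
  proof (rule Bochner_Integration.integrable_bound)
    show "integrable lborel (\<lambda>y. B * norm (g y))" using g by auto
    show "AE y in lborel. norm (g y * b (x, y)) \<le> norm (B * norm (g y))"
      using B0 by (intro AE_I2) (auto simp: norm_mult abs_mult mult.commute[of "norm (g _)"] intro!: mult_right_mono B)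
  qed measurable
  have int: "integrable (lborel \<Otimes>\<^sub>M lborel) (\<lambda>(x, y). f x * (g y * b (x, y)))"
  proof (rule lborel_pair.Fubini_integrable)
    show "AE x in lborel. integrable lborel (\<lambda>y. case (x, y) of (x, y) \<Rightarrow> f x * (g y * b (x, y)))"
      using gi by simp
    show "integrable lborel (\<lambda>x. LINT y|lborel. norm (case (x, y) of (x, y) \<Rightarrow> f x * (g y * b (x, y))))"
    proof (rule Bochner_Integration.integrable_bound)
      show "integrable lborel (\<lambda>x. norm (f x) * (B * (LINT y|lborel. norm (g y))))"
        using f by (intro integrable_mult_left integrable_norm)
      show "AE x in lborel. norm (LINT y|lborel. norm (case (x, y) of (x, y) \<Rightarrow> f x * (g y * b (x, y))))
        \<le> norm (norm (f x) * (B * (LINT y|lborel. norm (g y))))"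
      proof (rule AE_I2)
        fix x
        have "(LINT y|lborel. norm (g y * b (x, y))) \<le> (LINT y|lborel. B * norm (g y))"
          using g B by (intro integral_mono[OF integrable_norm[OF gi]]) (auto simp: norm_mult mult.commute[of "norm (g _)"] intro!: mult_right_mono)
        then have "norm (f x) * (LINT y|lborel. norm (g y * b (x, y))) \<le> norm (f x) * (B * (LINT y|lborel. norm (g y)))"
          by (intro mult_left_mono) auto
        moreover have "0 \<le> (LINT y|lborel. norm (g y * b (x, y)))" by (intro Bochner_Integration.integral_nonneg) simp
        ultimately show "norm (LINT y|lborel. norm (case (x, y) of (x, y) \<Rightarrow> f x * (g y * b (x, y))))
          \<le> norm (norm (f x) * (B * (LINT y|lborel. norm (g y))))"
          using B0 by (simp add: norm_mult abs_mult)
      qed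
    qed measurable
  qed measurable
  have "(LINT x|lborel. f x * (LINT y|lborel. g y * b (x, y))) = (LINT x|lborel. LINT y|lborel. f x * (g y * b (x, y)))"
    by simp
  also have "\<dots> = (LINT y|lborel. LINT x|lborel. f x * (g y * b (x, y)))"
    using lborel_pair.Fubini_integral[OF int] by simp
  also have "(\<lambda>y. LINT x|lborel. f x * (g y * b (x, y))) = (\<lambda>y. LINT x|lborel. g y * (f x * b (x, y)))"
    by (simp add: mult_ac)
  also have "\<dots> = (\<lambda>y. g y * (LINT x|lborel. f x * b (x, y)))" by simp
  finally show "(LINT x|lborel. f x * (LINT y|lborel. g y * b (x, y))) = (LINT y|lborel. g y * (LINT x|lborel. f x * b (x, y)))" .
  show "integrable lborel (\<lambda>x. f x * (LINT y|lborel. g y * b (x, y)))"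
    using lborel_pair.integrable_fst[OF int] by simp
qed

lemma borel_measurable_fourier [measurable]:
  assumes "h \<in> borel_measurable borel"
  shows "fourier h \<in> borel_measurable borel"
  using assms unfolding fourier_def[abs_def] by (simp add: borel_prod measurable_lborel1) measurable

lemma norm_fourier_le: "norm (fourier h \<omega>) \<le> (LINT y|lborel. norm (h y))"
proof -
  have "norm (fourier h \<omega>) \<le> (LINT y|lborel. norm (exp (- 2 * of_real pi * \<i> * of_real y * of_real \<omega>) * h y))"
    unfolding fourier_def by (rule integral_norm_bound)
  then show ?thesis by (simp add: norm_mult)
qed

text \<open>The Gaussian weight makes the left side absolutely convergent before anything is known
  about the size of \<open>fourier h\<close>. Exchanging integrals replaces the weight by its
  Fourier transform \<open>K\<close>, an approximate identity of width
  \<open>sqrt c\<close>.\<close>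

lemma regularised_plancherel:
  assumes h: "integrable lborel h" and h2: "square_integrable lborel h" and "0 < c"
  shows "(LINT \<omega>|lborel. of_real (exp (- pi * c * \<omega>\<^sup>2)) * (fourier h \<omega> * cnj (fourier h \<omega>)))
    = (LINT t|lborel. of_real (exp (- pi * t\<^sup>2)) * (LINT y|lborel. h y * cnj (h (y - sqrt c * t))))"
proof -
  have [measurable]: "h \<in> borel_measurable borel" using h by auto
  define E where "E \<omega> = complex_of_real (exp (- pi * c * \<omega>\<^sup>2))" for \<omega>
  define e where "e y \<omega> = exp (- 2 * of_real pi * \<i> * of_real y * of_real \<omega> :: complex)" for y \<omega> :: real
  have [measurable]: "(\<lambda>p. e (fst p) (snd p)) \<in> borel_measurable borel" "(\<lambda>p. e (snd p) (fst p)) \<in> borel_measurable borel"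
    unfolding e_def by (intro borel_measurable_continuous_onI continuous_intros)+
  have ne: "norm (e y \<omega>) = 1" for y \<omega> by (simp add: e_def)
  have ce: "cnj (e y \<omega>) = e (- y) \<omega>" for y \<omega> by (simp add: e_def exp_cnj)
  have iE: "integrable lborel E" unfolding E_def using gaussian_fourier(1)[OF \<open>0 < c\<close>] by auto
  define K where "K t = complex_of_real (exp (- pi * t\<^sup>2 / c) / sqrt c)" for t
  have FE: "(LINT \<omega>|lborel. E \<omega> * e t \<omega>) = K t" for t
    using gaussian_fourier(2)[OF \<open>0 < c\<close>, of t] by (simp add: fourier_def E_def e_def K_def mult_ac)
  have ich: "integrable lborel (\<lambda>y. cnj (h y))" using h by simp
  have fc: "cnj (fourier h \<omega>) = (LINT y|lborel. cnj (h y) * e (- y) \<omega>)" for \<omega>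
    unfolding fourier_def Bochner_Integration.integral_cnj[symmetric] by (simp add: e_def exp_cnj mult_ac)
  have inner: "(LINT \<omega>|lborel. E \<omega> * cnj (fourier h \<omega>) * e y \<omega>) = (LINT y'|lborel. cnj (h y') * K (y - y'))" for y
  proof -
    have "(LINT \<omega>|lborel. E \<omega> * cnj (fourier h \<omega>) * e y \<omega>) =
       (LINT \<omega>|lborel. E \<omega> * (LINT y'|lborel. cnj (h y') * e (y - snd (\<omega>, y')) (fst (\<omega>, y'))))"
    proof (rule Bochner_Integration.integral_cong[OF refl])
      fix \<omega>
      have "cnj (fourier h \<omega>) * e y \<omega> = (LINT y'|lborel. cnj (h y') * e (- y') \<omega> * e y \<omega>)"
        unfolding fc by simp
      also have "(\<lambda>y'. cnj (h y') * e (- y') \<omega> * e y \<omega>) = (\<lambda>y'. cnj (h y') * e (y - y') \<omega>)"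
        by (simp add: e_def mult.assoc exp_add[symmetric] algebra_simps)
      finally show "E \<omega> * cnj (fourier h \<omega>) * e y \<omega> = E \<omega> * (LINT y'|lborel. cnj (h y') * e (y - snd (\<omega>, y')) (fst (\<omega>, y')))"
        by (simp add: mult.assoc)
    qed
    also have "\<dots> = (LINT y'|lborel. cnj (h y') * (LINT \<omega>|lborel. E \<omega> * e (y - snd (\<omega>, y')) (fst (\<omega>, y'))))"
    proof (rule Fubini_kernel(1)[OF iE ich, of "\<lambda>p. e (y - snd p) (fst p)" 1])
      show "(\<lambda>p. e (y - snd p) (fst p)) \<in> borel_measurable borel"
        unfolding e_def by (intro borel_measurable_continuous_onI continuous_intros)
    qed (simp add: ne)
    finally show ?thesis by (simp add: FE)
  qed
  have iEf: "integrable lborel (\<lambda>\<omega>. E \<omega> * cnj (fourier h \<omega>))"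
  proof (rule Bochner_Integration.integrable_bound)
    show "integrable lborel (\<lambda>\<omega>. norm (E \<omega>) * (LINT y|lborel. norm (h y)))" using iE by auto
    show "AE \<omega> in lborel. norm (E \<omega> * cnj (fourier h \<omega>)) \<le> norm (norm (E \<omega>) * (LINT y|lborel. norm (h y)))"
      using norm_fourier_le[of h] by (intro AE_I2) (auto simp: norm_mult abs_mult intro!: mult_left_mono)
  qed (unfold E_def, measurable)
  have "(LINT \<omega>|lborel. of_real (exp (- pi * c * \<omega>\<^sup>2)) * (fourier h \<omega> * cnj (fourier h \<omega>)))
     = (LINT \<omega>|lborel. (E \<omega> * cnj (fourier h \<omega>)) * (LINT y|lborel. h y * e (snd (\<omega>, y)) (fst (\<omega>, y))))"
    by (simp add: E_def fourier_def e_def mult_ac)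
  also have "\<dots> = (LINT y|lborel. h y * (LINT \<omega>|lborel. (E \<omega> * cnj (fourier h \<omega>)) * e (snd (\<omega>, y)) (fst (\<omega>, y))))"
    by (rule Fubini_kernel(1)[OF iEf h, of "\<lambda>p. e (snd p) (fst p)" 1]) (simp_all add: ne)
  also have "\<dots> = (LINT y|lborel. h y * (LINT y'|lborel. cnj (h y') * K (y - y')))"
    by (simp add: inner)
  also have "\<dots> = (LINT y|lborel. h y * (LINT t|lborel. of_real (exp (- pi * t\<^sup>2)) * cnj (h (y - sqrt c * t))))"
  proof (rule Bochner_Integration.integral_cong[OF refl])
    fix y
    \<comment> \<open>The substitution \<open>y' = y - sqrt c * t\<close> moves the parameter from
      the kernel into the shift, so that \<open>c\<close> tending to 0 becomes continuity of
      translation.\<close>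
    have "(LINT y'|lborel. cnj (h y') * K (y - y')) = \<bar>- sqrt c\<bar> *\<^sub>R (LINT t|lborel. cnj (h (y + - sqrt c * t)) * K (y - (y + - sqrt c * t)))"
      using \<open>0 < c\<close> by (intro lborel_integral_real_affine) simp
    also have "\<dots> = (LINT t|lborel. of_real (sqrt c) * (cnj (h (y + - sqrt c * t)) * K (y - (y + - sqrt c * t))))"
      using \<open>0 < c\<close> by (simp add: scaleR_conv_of_real)
    also have "\<dots> = (LINT t|lborel. of_real (exp (- pi * t\<^sup>2)) * cnj (h (y - sqrt c * t)))"
      using \<open>0 < c\<close> by (intro Bochner_Integration.integral_cong) (auto simp: K_def power_mult_distrib)
    finally show "h y * (LINT y'|lborel. cnj (h y') * K (y - y')) = h y * (LINT t|lborel. of_real (exp (- pi * t\<^sup>2)) * cnj (h (y - sqrt c * t)))"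
      by simp
  qed
  also have "\<dots> = (LINT y|lborel. LINT t|lborel. of_real (exp (- pi * t\<^sup>2)) * (h y * cnj (h (y - sqrt c * t))))"
    by (intro Bochner_Integration.integral_cong refl)
      (simp add: integral_mult_right_zero[symmetric] mult.left_commute del: integral_mult_right_zero)
  also have "\<dots> = (LINT t|lborel. LINT y|lborel. of_real (exp (- pi * t\<^sup>2)) * (h y * cnj (h (y - sqrt c * t))))"
  proof -
    define Q where "Q = (\<lambda>(t, y). of_real (exp (- pi * t\<^sup>2)) * (h y * cnj (h (y - sqrt c * t))) :: complex)"
    have tr: "square_integrable lborel (\<lambda>y. h (y - a))" for a by (rule square_integrable_translate(1)[OF h2])
    have "integrable (lborel \<Otimes>\<^sub>M lborel) Q"
    proof (rule lborel_pair.Fubini_integrable)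
      show m: "Q \<in> borel_measurable (lborel \<Otimes>\<^sub>M lborel)" unfolding Q_def by measurable
      show "AE t in lborel. integrable lborel (\<lambda>y. Q (t, y))"
        using integrable_mult_cnj[OF h2 tr] by (intro AE_I2) (simp add: Q_def)
      show "integrable lborel (\<lambda>t. LINT y|lborel. norm (Q (t, y)))"
      proof (rule Bochner_Integration.integrable_bound)
        show "integrable lborel (\<lambda>t. exp (- pi * t\<^sup>2) * sqnorm h)"
          using gaussian_fourier(1)[of 1] by simp
        show "AE t in lborel. norm (LINT y|lborel. norm (Q (t, y))) \<le> norm (exp (- pi * t\<^sup>2) * sqnorm h)"
        proof (rule AE_I2)
          fix t
          have "(LINT y|lborel. norm (Q (t, y))) = exp (- pi * t\<^sup>2) * (LINT y|lborel. norm (h y) * norm (h (y - sqrt c * t)))"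
            by (simp add: Q_def norm_mult)
          also have "\<dots> \<le> exp (- pi * t\<^sup>2) * sqnorm h"
            using integral_norm_mult_le[OF h2 tr, of "sqrt c * t"]
            by (intro mult_left_mono) (simp_all add: square_integrable_translate(2)[OF h2])
          finally have "(LINT y|lborel. norm (Q (t, y))) \<le> exp (- pi * t\<^sup>2) * sqnorm h" .
          moreover have "0 \<le> (LINT y|lborel. norm (Q (t, y)))" by (intro Bochner_Integration.integral_nonneg) simp
          ultimately show "norm (LINT y|lborel. norm (Q (t, y))) \<le> norm (exp (- pi * t\<^sup>2) * sqnorm h)"
            by simp
        qed
      qed (use m in measurable)
    qed
    from lborel_pair.Fubini_integral[of "\<lambda>t y. Q (t, y)"] this show ?thesis by (simp add: Q_def)
  qed
  finally show ?thesis by simp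
qed

text \<open>The regularised identity is evaluated in the limit in two ways: its right side converges
  to the squared norm by dominated convergence, its left side increases by monotone convergence. The
  latter also yields that \<open>fourier h\<close> is square integrable.\<close>

lemma plancherel:
  assumes h: "integrable lborel h" and h2: "square_integrable lborel h"
  shows "(\<integral>\<^sup>+\<omega>. ennreal ((norm (fourier h \<omega>))\<^sup>2) \<partial>lborel) = ennreal (sqnorm h)"
proof -
  have [measurable]: "h \<in> borel_measurable borel" using h by auto
  define H where "H = sqnorm h"
  define c where "c n = 1 / (real n + 1)" for n
  have c: "0 < c n" for n by (simp add: c_def)
  have c0: "c \<longlonglongrightarrow> 0" unfolding c_def using LIMSEQ_inverse_real_of_nat by (simp add: field_simps)
  define R where "R s = (LINT y|lborel. h y * cnj (h (y - s)))" for s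
  have tr: "square_integrable lborel (\<lambda>y. h (y - a))" for a by (rule square_integrable_translate(1)[OF h2])
  have R_bd: "norm (R s) \<le> H" for s
    using norm_integral_mult_cnj_le[OF h2 tr, of s] by (simp add: R_def H_def square_integrable_translate(2)[OF h2])
  have R0: "R 0 = of_real H"
    unfolding R_def H_def by (simp add: complex_norm_square[symmetric] del: of_real_power)
  have R_lim: "(\<lambda>n. R (s n)) \<longlonglongrightarrow> of_real H" if "s \<longlonglongrightarrow> 0" for s
  proof -
    have "(\<lambda>n. R (s n) - R 0) \<longlonglongrightarrow> 0"
    proof (rule Lim_null_comparison)
      show "\<forall>\<^sub>F n in sequentially. norm (R (s n) - R 0) \<le> sqrt H * sqrt (LINT y|lborel. (norm (h y - h (y - s n)))\<^sup>2)"
      proof (rule always_eventually, rule allI)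
        fix n
        have "R 0 - R (s n) = (LINT y|lborel. h y * cnj (h y - h (y - s n)))"
          unfolding R_def using integrable_mult_cnj[OF h2 tr[of "s n"]] integrable_mult_cnj[OF h2 h2]
          by (simp add: algebra_simps)
        then have "norm (R 0 - R (s n)) \<le> sqrt H * sqrt (LINT y|lborel. (norm (h y - h (y - s n)))\<^sup>2)"
          using norm_integral_mult_cnj_le[OF h2 square_integrable_diff[OF h2 tr[of "s n"]]] by (simp add: H_def)
        then show "norm (R (s n) - R 0) \<le> sqrt H * sqrt (LINT y|lborel. (norm (h y - h (y - s n)))\<^sup>2)"
          by (simp add: norm_minus_commute)
      qed
      have "(\<lambda>n. sqrt H * sqrt (LINT y|lborel. (norm (h y - h (y - s n)))\<^sup>2)) \<longlonglongrightarrow> sqrt H * sqrt 0"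
        by (intro tendsto_intros integral_translate_diff_tendsto_0 h2 that)
      then show "(\<lambda>n. sqrt H * sqrt (LINT y|lborel. (norm (h y - h (y - s n)))\<^sup>2)) \<longlonglongrightarrow> 0" by simp
    qed
    then show ?thesis by (simp add: LIM_zero_iff R0)
  qed
  define A where "A n = (LINT \<omega>|lborel. exp (- pi * c n * \<omega>\<^sup>2) * (norm (fourier h \<omega>))\<^sup>2)" for n
  have iA: "integrable lborel (\<lambda>\<omega>. exp (- pi * c n * \<omega>\<^sup>2) * (norm (fourier h \<omega>))\<^sup>2)" for n
  proof (rule Bochner_Integration.integrable_bound)
    show "integrable lborel (\<lambda>\<omega>. exp (- pi * c n * \<omega>\<^sup>2) * (LINT y|lborel. norm (h y))\<^sup>2)"
      using gaussian_fourier(1)[OF c[of n]] by (intro integrable_mult_left)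
    show "AE \<omega> in lborel. norm (exp (- pi * c n * \<omega>\<^sup>2) * (norm (fourier h \<omega>))\<^sup>2) \<le> norm (exp (- pi * c n * \<omega>\<^sup>2) * (LINT y|lborel. norm (h y))\<^sup>2)"
      using norm_fourier_le[of h] by (intro AE_I2) (auto intro!: mult_left_mono power_mono)
  qed measurable
  have A_eq: "of_real (A n) = (LINT t|lborel. of_real (exp (- pi * t\<^sup>2)) * R (sqrt (c n) * t))" for n
  proof -
    have "of_real (A n) = (LINT \<omega>|lborel. of_real (exp (- pi * c n * \<omega>\<^sup>2)) * (fourier h \<omega> * cnj (fourier h \<omega>)))"
      unfolding A_def integral_complex_of_real[symmetric]
      by (intro Bochner_Integration.integral_cong refl) (simp only: of_real_mult complex_norm_square)
    then show ?thesis unfolding regularised_plancherel[OF h h2 c] R_def .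
  qed
  have "(\<lambda>n. LINT t|lborel. of_real (exp (- pi * t\<^sup>2)) * R (sqrt (c n) * t)) \<longlonglongrightarrow> (LINT t|lborel. of_real (exp (- pi * t\<^sup>2)) * of_real H)"
  proof (rule integral_dominated_convergence[where w = "\<lambda>t. exp (- pi * t\<^sup>2) * H"])
    have "R \<in> borel_measurable borel"
      unfolding R_def[abs_def] by measurable
    then show "(\<lambda>t. of_real (exp (- pi * t\<^sup>2)) * R (sqrt (c n) * t)) \<in> borel_measurable lborel" for n
      by measurable
    show "integrable lborel (\<lambda>t. exp (- pi * t\<^sup>2) * H)" using gaussian_fourier(1)[of 1] by simp
    show "AE t in lborel. norm (of_real (exp (- pi * t\<^sup>2)) * R (sqrt (c n) * t)) \<le> exp (- pi * t\<^sup>2) * H" for n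
      using R_bd by (intro AE_I2) (simp add: norm_mult)
    show "AE t in lborel. (\<lambda>n. of_real (exp (- pi * t\<^sup>2)) * R (sqrt (c n) * t)) \<longlonglongrightarrow> of_real (exp (- pi * t\<^sup>2)) * of_real H"
    proof (intro AE_I2 tendsto_intros R_lim)
      fix t
      have "(\<lambda>n. sqrt (c n) * t) \<longlonglongrightarrow> sqrt 0 * t" by (intro tendsto_intros c0)
      then show "(\<lambda>n. sqrt (c n) * t) \<longlonglongrightarrow> 0" by simp
    qed
  qed measurable
  also have "(LINT t|lborel. of_real (exp (- pi * t\<^sup>2)) * of_real H) = complex_of_real H"
    using integral_gaussian[of 1] by (simp add: of_real_mult[symmetric] del: of_real_mult)
  finally have "(\<lambda>n. complex_of_real (A n)) \<longlonglongrightarrow> complex_of_real H" unfolding A_eq .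
  then have "A \<longlonglongrightarrow> H" by (simp only: tendsto_of_real_iff)
  then have "(\<lambda>n. ennreal (A n)) \<longlonglongrightarrow> ennreal H" by (rule tendsto_ennrealI)
  moreover have "(\<lambda>n. ennreal (A n)) \<longlonglongrightarrow> (\<integral>\<^sup>+\<omega>. ennreal ((norm (fourier h \<omega>))\<^sup>2) \<partial>lborel)"
  proof -
    have "ennreal (A n) = (\<integral>\<^sup>+\<omega>. ennreal (exp (- pi * c n * \<omega>\<^sup>2) * (norm (fourier h \<omega>))\<^sup>2) \<partial>lborel)" for n
      unfolding A_def by (rule nn_integral_eq_integral[symmetric, OF iA]) simp
    moreover have "(\<lambda>n. \<integral>\<^sup>+\<omega>. ennreal (exp (- pi * c n * \<omega>\<^sup>2) * (norm (fourier h \<omega>))\<^sup>2) \<partial>lborel)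
      \<longlonglongrightarrow> (\<integral>\<^sup>+\<omega>. ennreal ((norm (fourier h \<omega>))\<^sup>2) \<partial>lborel)"
    proof (rule nn_integral_LIMSEQ)
      show "mono (\<lambda>n \<omega>. ennreal (exp (- pi * c n * \<omega>\<^sup>2) * (norm (fourier h \<omega>))\<^sup>2))"
      proof (intro monoI le_funI ennreal_leI mult_right_mono)
        fix m n :: nat and \<omega> :: real assume "m \<le> n"
        then have "c n \<le> c m" by (auto simp: c_def intro!: divide_left_mono)
        then have "pi * (c n * \<omega>\<^sup>2) \<le> pi * (c m * \<omega>\<^sup>2)" by (intro mult_left_mono mult_right_mono) auto
        then show "exp (- pi * c m * \<omega>\<^sup>2) \<le> exp (- pi * c n * \<omega>\<^sup>2)" by (simp add: mult.assoc)
      qed simp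
      show "(\<lambda>n. ennreal (exp (- pi * c n * \<omega>\<^sup>2) * (norm (fourier h \<omega>))\<^sup>2)) \<longlonglongrightarrow> ennreal ((norm (fourier h \<omega>))\<^sup>2)" for \<omega>
      proof -
        have "(\<lambda>n. exp (- pi * c n * \<omega>\<^sup>2) * (norm (fourier h \<omega>))\<^sup>2) \<longlonglongrightarrow> exp (- pi * 0 * \<omega>\<^sup>2) * (norm (fourier h \<omega>))\<^sup>2"
          by (intro tendsto_intros c0)
        then show ?thesis by (intro tendsto_ennrealI) simp
      qed
    qed measurable
    ultimately show ?thesis by simp
  qed
  ultimately show ?thesis unfolding H_def by (rule LIMSEQ_unique[symmetric])
qed

section \<open>The short-time Fourier transform of Borel functions\<close>

text \<open>The window translated by \<open>fst z\<close> and modulated by \<open>snd z\<close>. The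
  transform at \<open>z\<close> is the inner product with this unit vector, so pointwise statements
  about the transform become statements about two vectors in a Hilbert space.\<close>

definition coherent :: "real \<times> real \<Rightarrow> real \<Rightarrow> complex" where
  "coherent z y = exp (2 * of_real pi * \<i> * of_real y * of_real (snd z)) * of_real (gaussian (fst z - y))"

definition bstft :: "(real \<Rightarrow> complex) \<Rightarrow> real \<times> real \<Rightarrow> complex" where
  "bstft f z = (LINT y|lborel. f y * cnj (coherent z y))"

lemma gaussian_square: "(gaussian x)\<^sup>2 = sqrt 2 * exp (- pi * 2 * x\<^sup>2)"
proof -
  have "(2 powr (1/4))\<^sup>2 = sqrt (2::real)"
    by (simp add: powr_half_sqrt[symmetric] powr_realpow[symmetric] powr_powr flip: powr_numeral)
  then show ?thesis by (simp add: gaussian_def power_mult_distrib exp_double[symmetric] mult.commute mult.left_commute)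
qed

lemma gaussian_nonneg [simp]: "0 \<le> gaussian x" by (simp add: gaussian_def)

lemma gaussian_minus [simp]: "gaussian (- x) = gaussian x" by (simp add: gaussian_def)

lemma continuous_gaussian: "continuous_on S gaussian"
  unfolding gaussian_def[abs_def] by (intro continuous_intros)

lemma borel_measurable_gaussian [measurable]: "gaussian \<in> borel_measurable borel"
  by (rule borel_measurable_continuous_onI[OF continuous_gaussian])

lemma norm_coherent: "norm (coherent z y) = gaussian (fst z - y)"
  by (simp add: coherent_def norm_mult)

lemma cnj_coherent: "cnj (coherent z y) = exp (- 2 * of_real pi * \<i> * of_real y * of_real (snd z)) * of_real (gaussian (fst z - y))"
  by (simp add: coherent_def exp_cnj)

lemma borel_measurable_coherent [measurable (raw)]:
  assumes "f \<in> borel_measurable M" "g \<in> borel_measurable M"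
  shows "(\<lambda>x. coherent (f x) (g x)) \<in> borel_measurable M"
proof -
  have "(\<lambda>p. coherent (fst p) (snd p)) \<in> borel_measurable borel"
    unfolding coherent_def
    by (intro borel_measurable_continuous_onI continuous_intros continuous_on_compose2[OF continuous_gaussian[of UNIV]]) simp
  from measurable_compose[OF borel_measurable_Pair[OF assms] this] show ?thesis by simp
qed

lemma borel_measurable_gaussian_shift [measurable (raw)]:
  fixes f :: "'a \<Rightarrow> real \<times> real"
  assumes [measurable]: "f \<in> borel_measurable M" "g \<in> borel_measurable M"
  shows "(\<lambda>x. gaussian (fst (f x) - g x)) \<in> borel_measurable M"
proof -
  have "(\<lambda>x. norm (coherent (f x) (g x))) \<in> borel_measurable M" by measurable
  then show ?thesis by (simp add: norm_coherent)
qed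

lemma gaussian_translate:
  "integrable lborel (\<lambda>y. (gaussian (x - y))\<^sup>2)" "(LINT y|lborel. (gaussian (x - y))\<^sup>2) = 1"
proof -
  have "integrable lborel (\<lambda>y. sqrt 2 * exp (- pi * 2 * (x + (-1) * y)\<^sup>2))"
    using gaussian_fourier(1)[of 2] by (intro integrable_mult_right lborel_integrable_real_affine) auto
  then show "integrable lborel (\<lambda>y. (gaussian (x - y))\<^sup>2)" by (simp add: gaussian_square)
  have "1 = sqrt 2 * (LINT y|lborel. exp (- pi * 2 * y\<^sup>2))"
    by (subst integral_gaussian) auto
  also have "(LINT y|lborel. exp (- pi * 2 * y\<^sup>2)) = \<bar>-1\<bar> *\<^sub>R (LINT y|lborel. exp (- pi * 2 * (x + (-1) * y)\<^sup>2))"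
    by (rule lborel_integral_real_affine) simp
  finally show "(LINT y|lborel. (gaussian (x - y))\<^sup>2) = 1" by (simp add: gaussian_square)
qed

lemma square_integrable_coherent:
  "square_integrable lborel (coherent z)" "(LINT y|lborel. (norm (coherent z y))\<^sup>2) = 1"
  using gaussian_translate by (auto simp: square_integrable_def norm_coherent)

lemma norm_bstft_le:
  assumes "square_integrable lborel f"
  shows "norm (bstft f z) \<le> sqrt (sqnorm f)"
  using norm_integral_mult_cnj_le[OF assms square_integrable_coherent(1)[of z]]
  by (simp add: bstft_def square_integrable_coherent(2))

lemma borel_measurable_bstft [measurable]:
  assumes [measurable]: "f \<in> borel_measurable borel"
  shows "bstft f \<in> borel_measurable borel"
  unfolding bstft_def[abs_def] by measurable

text \<open>For fixed \<open>x\<close> the transform is the Fourier transform of \<open>f\<close>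
  times the shifted window. Plancherel in the frequency and Tonelli in \<open>x\<close> leave the
  squared norm of the window, which is 1.\<close>

lemma bstft_isometry:
  assumes f: "square_integrable lborel f"
  shows "(\<integral>\<^sup>+z. ennreal ((norm (bstft f z))\<^sup>2) \<partial>lborel) = ennreal (sqnorm f)"
    and "integrable lborel (\<lambda>z. (norm (bstft f z))\<^sup>2)"
    and "(LINT z|lborel. (norm (bstft f z))\<^sup>2) = sqnorm f"
proof -
  have fm[measurable]: "f \<in> borel_measurable borel" using square_integrableD[OF f] by simp
  have m: "(\<lambda>z. ennreal ((norm (bstft f z))\<^sup>2)) \<in> borel_measurable (lborel \<Otimes>\<^sub>M lborel)"
    unfolding lborel_prod by measurable
  define h where "h x y = f y * of_real (gaussian (x - y))" for x y
  have gb: "gaussian t \<le> 2 powr (1/4)" for t by (simp add: gaussian_def)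
  have h2: "square_integrable lborel (h x)" for x
    unfolding square_integrable_def
  proof
    show "h x \<in> borel_measurable lborel" unfolding h_def by measurable
    show "integrable lborel (\<lambda>y. (norm (h x y))\<^sup>2)"
    proof (rule Bochner_Integration.integrable_bound)
      show "integrable lborel (\<lambda>y. (2 powr (1/4))\<^sup>2 * (norm (f y))\<^sup>2)"
        using square_integrableD(2)[OF f] by (rule integrable_mult_right)
      show "AE y in lborel. norm ((norm (h x y))\<^sup>2) \<le> norm ((2 powr (1/4))\<^sup>2 * (norm (f y))\<^sup>2)"
        by (intro AE_I2) (auto simp: h_def norm_mult power_mult_distrib mult.commute[of "(norm (f _))\<^sup>2"] intro!: mult_right_mono power_mono gb)
    qed (unfold h_def, measurable)
  qed
  have h1: "integrable lborel (h x)" for x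
  proof -
    have "square_integrable lborel (\<lambda>y. of_real (gaussian (x - y)))"
      using gaussian_translate by (auto simp: square_integrable_def)
    from integrable_mult_cnj[OF f this] show ?thesis by (simp add: h_def[abs_def])
  qed
  have bf: "bstft f (x, \<omega>) = fourier (h x) \<omega>" for x \<omega>
    by (simp add: bstft_def fourier_def h_def cnj_coherent mult_ac)
  have "(\<integral>\<^sup>+z. ennreal ((norm (bstft f z))\<^sup>2) \<partial>lborel) = (\<integral>\<^sup>+x. \<integral>\<^sup>+\<omega>. ennreal ((norm (bstft f (x, \<omega>)))\<^sup>2) \<partial>lborel \<partial>lborel)"
    by (subst lborel_prod[symmetric]) (rule lborel.nn_integral_fst[symmetric, OF m])
  also have "\<dots> = (\<integral>\<^sup>+x. ennreal (LINT y|lborel. (norm (h x y))\<^sup>2) \<partial>lborel)"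
    unfolding bf by (intro nn_integral_cong plancherel h1 h2)
  also have "\<dots> = (\<integral>\<^sup>+x. \<integral>\<^sup>+y. ennreal ((norm (h x y))\<^sup>2) \<partial>lborel \<partial>lborel)"
    using h2 by (intro nn_integral_cong nn_integral_eq_integral[symmetric]) (auto simp: square_integrable_def)
  also have "\<dots> = (\<integral>\<^sup>+y. \<integral>\<^sup>+x. ennreal ((norm (h x y))\<^sup>2) \<partial>lborel \<partial>lborel)"
    unfolding h_def by (rule lborel_pair.Fubini'[symmetric]) measurable
  also have "\<dots> = (\<integral>\<^sup>+y. ennreal ((norm (f y))\<^sup>2) \<partial>lborel)"
  proof (rule nn_integral_cong)
    fix y
    have "(\<integral>\<^sup>+x. ennreal ((norm (h x y))\<^sup>2) \<partial>lborel) = (\<integral>\<^sup>+x. ennreal ((norm (f y))\<^sup>2) * ennreal ((gaussian (y - x))\<^sup>2) \<partial>lborel)"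
      using gaussian_minus[of "y - _"] by (intro nn_integral_cong) (simp add: h_def norm_mult power_mult_distrib ennreal_mult)
    also have "\<dots> = ennreal ((norm (f y))\<^sup>2) * (\<integral>\<^sup>+x. ennreal ((gaussian (y - x))\<^sup>2) \<partial>lborel)"
      by (rule nn_integral_cmult) measurable
    also have "(\<integral>\<^sup>+x. ennreal ((gaussian (y - x))\<^sup>2) \<partial>lborel) = ennreal 1"
      using nn_integral_eq_integral[OF gaussian_translate(1)[of y]] by (simp add: gaussian_translate(2))
    finally show "(\<integral>\<^sup>+x. ennreal ((norm (h x y))\<^sup>2) \<partial>lborel) = ennreal ((norm (f y))\<^sup>2)" by simp
  qed
  also have "\<dots> = ennreal (sqnorm f)"
    by (rule nn_integral_eq_integral[OF square_integrableD(2)[OF f]]) simp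
  finally show 1: "(\<integral>\<^sup>+z. ennreal ((norm (bstft f z))\<^sup>2) \<partial>lborel) = ennreal (sqnorm f)" .
  show 2: "integrable lborel (\<lambda>z. (norm (bstft f z))\<^sup>2)"
    using 1 by (intro integrableI_bounded) auto
  have "0 \<le> (LINT z|lborel. (norm (bstft f z))\<^sup>2)" by simp
  then show "(LINT z|lborel. (norm (bstft f z))\<^sup>2) = sqnorm f"
    using 1 nn_integral_eq_integral[OF 2] by simp
qed

section \<open>The adjoint and the overlap of coherent states\<close>

definition synthesis :: "(real \<times> real \<Rightarrow> complex) \<Rightarrow> real \<Rightarrow> complex" where
  "synthesis W y = (LINT z|lborel. W z * coherent z y)"

text \<open>Integrability of \<open>W\<close> makes the defining integral converge absolutely. It
  holds for bounded functions supported on sets of finite measure, to which the lemma is applied.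
  Square integrability of the result follows from the Cauchy--Schwarz inequality with weight
  \<open>norm (W z)\<close>.\<close>

lemma synthesis_adjoint:
  assumes W: "integrable lborel W"
  shows "square_integrable lborel (synthesis W)"
    and "square_integrable lborel f \<Longrightarrow>
      (LINT y|lborel. f y * cnj (synthesis W y)) = (LINT z|lborel. bstft f z * cnj (W z))"
proof -
  have [measurable]: "W \<in> borel_measurable borel" using W by auto
  have sm[measurable]: "synthesis W \<in> borel_measurable borel"
    unfolding synthesis_def[abs_def] by measurable
  define A where "A = (LINT z|lborel. norm (W z))"
  have A: "(\<integral>\<^sup>+z. ennreal (norm (W z)) \<partial>lborel) = ennreal A"
    unfolding A_def using W by (intro nn_integral_eq_integral) auto
  have "0 \<le> A" unfolding A_def by (intro Bochner_Integration.integral_nonneg) simp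
  have pt: "(ennreal (norm (synthesis W y)))\<^sup>2 \<le> ennreal A * (\<integral>\<^sup>+z. ennreal (norm (W z) * (gaussian (fst z - y))\<^sup>2) \<partial>lborel)" for y
  proof -
    have "ennreal (norm (synthesis W y)) \<le> (\<integral>\<^sup>+z. ennreal (norm (W z * coherent z y)) \<partial>lborel)"
      unfolding synthesis_def by (cases "integrable lborel (\<lambda>z. W z * coherent z y)")
        (auto intro: integral_norm_bound_ennreal simp: not_integrable_integral_eq)
    also have "\<dots> = (\<integral>\<^sup>+z. ennreal (sqrt (norm (W z))) * ennreal (sqrt (norm (W z)) * gaussian (fst z - y)) \<partial>lborel)"
      by (intro nn_integral_cong) (simp add: norm_mult norm_coherent ennreal_mult[symmetric] mult.assoc[symmetric])
    finally have "(ennreal (norm (synthesis W y)))\<^sup>2 \<le> (\<integral>\<^sup>+z. ennreal (sqrt (norm (W z))) * ennreal (sqrt (norm (W z)) * gaussian (fst z - y)) \<partial>lborel)\<^sup>2"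
      by (intro power_mono) auto
    also have "\<dots> \<le> (\<integral>\<^sup>+z. (ennreal (sqrt (norm (W z))))\<^sup>2 \<partial>lborel) * (\<integral>\<^sup>+z. (ennreal (sqrt (norm (W z)) * gaussian (fst z - y)))\<^sup>2 \<partial>lborel)"
      by (intro Cauchy_Schwarz_nn_integral) measurable
    also have "\<dots> = ennreal A * (\<integral>\<^sup>+z. ennreal (norm (W z) * (gaussian (fst z - y))\<^sup>2) \<partial>lborel)"
      by (simp add: ennreal_power power_mult_distrib A)
    finally show ?thesis .
  qed
  have "(\<integral>\<^sup>+y. ennreal ((norm (synthesis W y))\<^sup>2) \<partial>lborel) \<le> (\<integral>\<^sup>+y. ennreal A * (\<integral>\<^sup>+z. ennreal (norm (W z) * (gaussian (fst z - y))\<^sup>2) \<partial>lborel) \<partial>lborel)"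
    using pt by (intro nn_integral_mono) (simp add: ennreal_power)
  also have "\<dots> = ennreal A * (\<integral>\<^sup>+y. \<integral>\<^sup>+z. ennreal (norm (W z) * (gaussian (fst z - y))\<^sup>2) \<partial>lborel \<partial>lborel)"
    by (rule nn_integral_cmult) measurable
  also have "(\<integral>\<^sup>+y. \<integral>\<^sup>+z. ennreal (norm (W z) * (gaussian (fst z - y))\<^sup>2) \<partial>lborel \<partial>lborel)
     = (\<integral>\<^sup>+z. \<integral>\<^sup>+y. ennreal (norm (W z) * (gaussian (fst z - y))\<^sup>2) \<partial>lborel \<partial>lborel)"
    by (rule lborel_pair.Fubini') measurable
  also have "\<dots> = (\<integral>\<^sup>+z. ennreal (norm (W z)) \<partial>lborel)"
  proof (rule nn_integral_cong)
    fix z :: "real \<times> real"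
    have "(\<integral>\<^sup>+y. ennreal (norm (W z) * (gaussian (fst z - y))\<^sup>2) \<partial>lborel) = ennreal (LINT y|lborel. norm (W z) * (gaussian (fst z - y))\<^sup>2)"
      by (intro nn_integral_eq_integral integrable_mult_right gaussian_translate) auto
    then show "(\<integral>\<^sup>+y. ennreal (norm (W z) * (gaussian (fst z - y))\<^sup>2) \<partial>lborel) = ennreal (norm (W z))"
      by (simp add: gaussian_translate)
  qed
  finally have "(\<integral>\<^sup>+y. ennreal ((norm (synthesis W y))\<^sup>2) \<partial>lborel) \<le> ennreal A * ennreal A" by (simp add: A)
  also have "\<dots> < \<infinity>" by (simp add: ennreal_mult[symmetric] \<open>0 \<le> A\<close>)
  finally show "square_integrable lborel (synthesis W)"
    unfolding square_integrable_def by (auto intro!: integrableI_bounded)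
  assume f: "square_integrable lborel f"
  have [measurable]: "f \<in> borel_measurable borel" using square_integrableD[OF f] by simp
  define Q where "Q z y = cnj (W z) * (f y * cnj (coherent z y))" for z y
  have iz: "integrable lborel (\<lambda>y. f y * cnj (coherent z y))" for z
    by (rule integrable_mult_cnj[OF f square_integrable_coherent(1)])
  have Qm: "case_prod Q \<in> borel_measurable (lborel \<Otimes>\<^sub>M lborel)"
  proof -
    have "(\<lambda>p. Q (fst p) (snd p)) \<in> borel_measurable (lborel \<Otimes>\<^sub>M lborel)"
      unfolding Q_def by measurable
    then show ?thesis by (simp only: case_prod_beta')
  qed
  have int: "integrable (lborel \<Otimes>\<^sub>M lborel) (case_prod Q)"
  proof (rule lborel_pair.Fubini_integrable)
    show "AE z in lborel. integrable lborel (\<lambda>y. case_prod Q (z, y))"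
      using iz by (intro AE_I2) (simp add: Q_def)
    show "integrable lborel (\<lambda>z. LINT y|lborel. norm (case_prod Q (z, y)))"
    proof (rule Bochner_Integration.integrable_bound)
      show "integrable lborel (\<lambda>z. norm (W z) * sqrt (sqnorm f))"
        using W by (intro integrable_mult_left integrable_norm)
      show "AE z in lborel. norm (LINT y|lborel. norm (case_prod Q (z, y))) \<le> norm (norm (W z) * sqrt (sqnorm f))"
      proof (rule AE_I2)
        fix z
        have "(LINT y|lborel. norm (case_prod Q (z, y))) = norm (W z) * (LINT y|lborel. norm (f y) * norm (coherent z y))"
          by (simp add: Q_def norm_mult)
        also have "\<dots> \<le> norm (W z) * sqrt (sqnorm f)"
          using integral_norm_mult_le[OF f square_integrable_coherent(1)[of z]]
          by (intro mult_left_mono) (simp_all add: square_integrable_coherent(2))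
        finally have "(LINT y|lborel. norm (case_prod Q (z, y))) \<le> norm (W z) * sqrt (sqnorm f)" .
        moreover have "0 \<le> (LINT y|lborel. norm (case_prod Q (z, y)))" by (intro Bochner_Integration.integral_nonneg) simp
        ultimately show "norm (LINT y|lborel. norm (case_prod Q (z, y))) \<le> norm (norm (W z) * sqrt (sqnorm f))"
          by simp
      qed
    qed (use Qm in measurable)
  qed (rule Qm)
  have "(LINT y|lborel. f y * cnj (synthesis W y)) = (LINT y|lborel. LINT z|lborel. Q z y)"
    unfolding synthesis_def Bochner_Integration.integral_cnj[symmetric] integral_mult_right_zero[symmetric]
    by (simp add: Q_def mult_ac)
  also have "\<dots> = (LINT z|lborel. LINT y|lborel. Q z y)"
    by (rule lborel_pair.Fubini_integral[OF int])
  also have "\<dots> = (LINT z|lborel. bstft f z * cnj (W z))"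
    by (simp add: Q_def bstft_def mult.commute)
  finally show "(LINT y|lborel. f y * cnj (synthesis W y)) = (LINT z|lborel. bstft f z * cnj (W z))" .
qed

lemma integral_norm_diff_square:
  assumes f: "square_integrable M f" and g: "square_integrable M g"
  shows "(LINT x|M. (norm (f x - a * g x))\<^sup>2) = (LINT x|M. (norm (f x))\<^sup>2) + (norm a)\<^sup>2 * (LINT x|M. (norm (g x))\<^sup>2)
    - 2 * Re (cnj a * (LINT x|M. f x * cnj (g x)))"
proof -
  have pt: "(norm (f x - a * g x))\<^sup>2 = (norm (f x))\<^sup>2 + (norm a)\<^sup>2 * (norm (g x))\<^sup>2 - 2 * Re (cnj a * (f x * cnj (g x)))" for x
    unfolding cmod_power2 by (simp add: power2_eq_square algebra_simps)
  have i: "integrable M (\<lambda>x. cnj a * (f x * cnj (g x)))" using integrable_mult_cnj[OF f g] by simp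
  define c where "c x = Re (cnj a * (f x * cnj (g x)))" for x
  have ic: "integrable M c" unfolding c_def by (rule integrable_Re[OF i])
  have "(LINT x|M. (norm (f x - a * g x))\<^sup>2) = (LINT x|M. (norm (f x))\<^sup>2) + (norm a)\<^sup>2 * (LINT x|M. (norm (g x))\<^sup>2)
    - 2 * (LINT x|M. c x)"
    unfolding pt c_def[symmetric] using square_integrableD(2)[OF f] square_integrableD(2)[OF g] ic by simp
  also have "(LINT x|M. c x) = Re (LINT x|M. cnj a * (f x * cnj (g x)))"
    unfolding c_def by (rule integral_Re[OF i])
  finally show ?thesis by simp
qed

text \<open>The product of two shifted Gaussians is a Gaussian about the midpoint \<open>m\<close>
  of their centres, times \<open>exp (- pi * (a - b)\<^sup>2 / 2)\<close>; the modulations differ by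
  the frequency \<open>s\<close>, so a Gaussian Fourier transform supplies the other factor.\<close>

lemma norm_bstft_coherent: "norm (bstft (coherent w) z) = exp (- pi / 2 * (dist w z)\<^sup>2)"
proof -
  define a b s m where "a = fst w" and "b = fst z" and "s = snd w - snd z" and "m = (a + b) / 2"
  have pt: "coherent w (m + 1 * x) * cnj (coherent z (m + 1 * x)) =
     (of_real (sqrt 2 * exp (- pi * (a - b)\<^sup>2 / 2)) * exp (2 * of_real pi * \<i> * of_real m * of_real s))
     * (exp (- 2 * of_real pi * \<i> * of_real x * of_real (- s)) * of_real (exp (- pi * 2 * x\<^sup>2)))" for x
  proof -
    have "gaussian (a - (m + x)) * gaussian (b - (m + x)) = (2 powr (1/4) * 2 powr (1/4)) * exp (- pi * (a - (m + x))\<^sup>2 + - pi * (b - (m + x))\<^sup>2)"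
      by (simp add: gaussian_def mult_exp_exp)
    also have "2 powr (1/4) * 2 powr (1/4) = sqrt (2::real)"
      by (simp add: powr_add[symmetric] powr_half_sqrt[symmetric])
    also have "- pi * (a - (m + x))\<^sup>2 + - pi * (b - (m + x))\<^sup>2 = - pi * (a - b)\<^sup>2 / 2 + - pi * 2 * x\<^sup>2"
      by (simp add: m_def power2_eq_square field_simps)
    finally have g: "gaussian (a - (m + x)) * gaussian (b - (m + x)) = sqrt 2 * exp (- pi * (a - b)\<^sup>2 / 2) * exp (- pi * 2 * x\<^sup>2)"
      by (simp only: exp_add mult.assoc)
    have e: "exp (2 * of_real pi * \<i> * of_real (m + x) * of_real (snd w)) * exp (- 2 * of_real pi * \<i> * of_real (m + x) * of_real (snd z))
      = exp (2 * of_real pi * \<i> * of_real m * of_real s) * exp (- 2 * of_real pi * \<i> * of_real x * of_real (- s) :: complex)"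
      unfolding exp_add[symmetric] by (rule arg_cong[where f = exp]) (simp add: s_def algebra_simps)
    have "coherent w (m + 1 * x) * cnj (coherent z (m + 1 * x)) =
      (exp (2 * of_real pi * \<i> * of_real (m + x) * of_real (snd w)) * exp (- 2 * of_real pi * \<i> * of_real (m + x) * of_real (snd z)))
       * of_real (gaussian (a - (m + x)) * gaussian (b - (m + x)))"
      unfolding cnj_coherent by (simp add: coherent_def a_def b_def mult_ac)
    then show ?thesis unfolding e g by (simp add: mult_ac)
  qed
  have "bstft (coherent w) z = (LINT x|lborel. coherent w (m + 1 * x) * cnj (coherent z (m + 1 * x)))"
    unfolding bstft_def by (subst lborel_integral_real_affine[of 1 _ m]) auto
  also have "\<dots> = (of_real (sqrt 2 * exp (- pi * (a - b)\<^sup>2 / 2)) * exp (2 * of_real pi * \<i> * of_real m * of_real s))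
     * fourier (\<lambda>x. of_real (exp (- pi * 2 * x\<^sup>2))) (- s)"
    unfolding pt fourier_def by (rule integral_mult_right_zero)
  also have "\<dots> = (of_real (sqrt 2 * exp (- pi * (a - b)\<^sup>2 / 2)) * exp (2 * of_real pi * \<i> * of_real m * of_real s))
     * of_real (exp (- pi * s\<^sup>2 / 2) / sqrt 2)"
    using gaussian_fourier(2)[of 2 "-s"] by simp
  finally have "norm (bstft (coherent w) z) = exp (- pi * (a - b)\<^sup>2 / 2) * exp (- pi * s\<^sup>2 / 2)"
    by (simp add: norm_mult norm_divide)
  also have "\<dots> = exp (- pi / 2 * ((a - b)\<^sup>2 + s\<^sup>2))"
    unfolding exp_add[symmetric] by (simp add: algebra_simps add_divide_distrib)
  also have "(a - b)\<^sup>2 + s\<^sup>2 = (dist w z)\<^sup>2"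
    by (cases w; cases z) (simp add: a_def b_def s_def dist_Pair_Pair dist_real_def)
  finally show ?thesis .
qed

text \<open>A phase \<open>c\<close> is chosen that makes the inner product of the two coherent
  states positive. Their squared distance is then \<open>2 - 2 * r\<close>, at most
  \<open>pi * (dist w z)\<^sup>2\<close>, and the phase does not change the modulus of the
  transform.\<close>

lemma norm_bstft_lipschitz:
  assumes f: "square_integrable lborel f"
  shows "norm (bstft f z) - norm (bstft f w) \<le> sqrt (sqnorm f) * (sqrt pi * dist w z)"
proof -
  define q where "q = bstft (coherent w) z"
  define r where "r = exp (- pi / 2 * (dist w z)\<^sup>2)"
  have nq: "norm q = r" unfolding q_def r_def by (rule norm_bstft_coherent)
  have "r > 0" by (simp add: r_def)
  define c where "c = cnj q / of_real r"
  have nc: "norm c = 1" using \<open>r > 0\<close> by (simp add: c_def norm_divide nq)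
  note cz = square_integrable_coherent[of z] and cw = square_integrable_coherent[of w]
  have "cnj q = (LINT y|lborel. coherent z y * cnj (coherent w y))"
    unfolding q_def bstft_def Bochner_Integration.integral_cnj[symmetric] by (simp add: mult.commute)
  moreover have "cnj c * cnj q = of_real r"
    using \<open>r > 0\<close> complex_norm_square[of q] nq by (simp add: c_def field_simps power2_eq_square)
  ultimately have "(LINT y|lborel. (norm (coherent z y - c * coherent w y))\<^sup>2) = 2 - 2 * r"
    using integral_norm_diff_square[OF cz(1) cw(1), of c] cz(2) cw(2) nc by simp
  also have "\<dots> \<le> pi * (dist w z)\<^sup>2"
    using exp_ge_add_one_self[of "- pi / 2 * (dist w z)\<^sup>2"] by (simp add: r_def field_simps)
  finally have d: "(LINT y|lborel. (norm (coherent z y - c * coherent w y))\<^sup>2) \<le> pi * (dist w z)\<^sup>2" .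
  have sd: "square_integrable lborel (\<lambda>y. coherent z y - c * coherent w y)"
    by (intro square_integrable_diff square_integrable_cmult cz cw)
  have "bstft f z - cnj c * bstft f w = (LINT y|lborel. f y * cnj (coherent z y) - cnj c * (f y * cnj (coherent w y)))"
    unfolding bstft_def using integrable_mult_cnj[OF f cz(1)] integrable_mult_cnj[OF f cw(1)] by simp
  also have "\<dots> = (LINT y|lborel. f y * cnj (coherent z y - c * coherent w y))"
    by (simp add: algebra_simps)
  finally have "norm (bstft f z - cnj c * bstft f w) \<le> sqrt (sqnorm f) *
      sqrt (LINT y|lborel. (norm (coherent z y - c * coherent w y))\<^sup>2)"
    using norm_integral_mult_cnj_le[OF f sd] by simp
  also have "\<dots> \<le> sqrt (sqnorm f) * sqrt (pi * (dist w z)\<^sup>2)"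
    using d by (intro mult_left_mono real_sqrt_le_mono) auto
  also have "sqrt (pi * (dist w z)\<^sup>2) = sqrt pi * dist w z" by (simp add: real_sqrt_mult)
  finally have "norm (bstft f z - cnj c * bstft f w) \<le> sqrt (sqnorm f) * (sqrt pi * dist w z)" .
  moreover have "norm (bstft f z) - norm (cnj c * bstft f w) \<le> norm (bstft f z - cnj c * bstft f w)"
    by (rule norm_triangle_ineq2)
  moreover have "norm (cnj c * bstft f w) = norm (bstft f w)" by (simp add: norm_mult nc)
  ultimately show ?thesis by simp
qed

text \<open>By the Lipschitz bound each point of the superlevel set carries a ball of fixed radius
  on which the density is at least \<open>r / 4\<close>. Far out, this would exceed the tail of an
  integrable function.\<close>

lemma bounded_superlevel_bstft:
  assumes f: "square_integrable lborel f" and "0 < r"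
  shows "bounded {z. r \<le> (norm (bstft f z))\<^sup>2}"
proof -
  define N where "N = sqrt (sqnorm f)"
  have "N \<ge> 0" by (simp add: N_def)
  \<comment> \<open>Within this radius the modulus drops by at most \<open>sqrt r / 2\<close>; the
    summand 1 in the denominator covers \<open>N = 0\<close>. The bound
    \<open>\<delta> \<le> 1\<close> matches the radius \<open>real n + 1\<close> used below.\<close>
  define \<delta> where "\<delta> = min 1 (sqrt r / (2 * (N * sqrt pi + 1)))"
  have "N * sqrt pi \<ge> 0" using \<open>N \<ge> 0\<close> by simp
  then have "\<delta> > 0" "\<delta> \<le> 1" using \<open>0 < r\<close> by (auto simp: \<delta>_def)
  have [measurable]: "f \<in> borel_measurable borel" using square_integrableD[OF f] by simp
  define u where "u z = (norm (bstft f z))\<^sup>2" for z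
  have [measurable]: "u \<in> borel_measurable borel" unfolding u_def by measurable
  have iu: "integrable lborel u" unfolding u_def by (rule bstft_isometry(2)[OF f])
  have tail: "(\<lambda>n. LINT z|lborel. indicator {z. real n < norm z} z * u z) \<longlonglongrightarrow> integral\<^sup>L (lborel :: (real \<times> real) measure) (\<lambda>z. 0)"
  proof (rule integral_dominated_convergence[where w = u])
    show "AE z in lborel. (\<lambda>n. indicator {z. real n < norm z} z * u z) \<longlonglongrightarrow> 0"
    proof (rule AE_I2, rule tendsto_eventually)
      fix z :: "real \<times> real"
      obtain n0 where "norm z \<le> real n0" using real_arch_simple by blast
      then show "\<forall>\<^sub>F n in sequentially. indicator {z. real n < norm z} z * u z = 0"
        unfolding eventually_sequentially by (intro exI[of _ n0]) (auto simp: indicator_def)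
    qed
    show "AE z in lborel. norm (indicator {z. real n < norm z} z * u z) \<le> u z" for n
      by (intro AE_I2) (auto simp: indicator_def u_def)
  qed (use iu in auto)
  have "0 < r / 4 * (pi * \<delta>\<^sup>2)" using \<open>0 < r\<close> \<open>\<delta> > 0\<close> by simp
  then have "\<forall>\<^sub>F n in sequentially. (LINT z|lborel. indicator {z. real n < norm z} z * u z) < r / 4 * (pi * \<delta>\<^sup>2)"
    using tail by (intro order_tendstoD(2)) auto
  then obtain n where n: "(LINT z|lborel. indicator {z. real n < norm z} z * u z) < r / 4 * (pi * \<delta>\<^sup>2)"
    by (auto dest: eventually_happens)
  have "norm z \<le> real n + 1" if z: "r \<le> u z" for z
  proof (rule ccontr)
    assume far: "\<not> norm z \<le> real n + 1"
    have uw: "r / 4 \<le> u w" "real n < norm w" if w: "w \<in> ball z \<delta>" for w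
    proof -
      have "norm z \<le> norm w + dist z w" by (metis dist_norm norm_triangle_sub)
      then show "real n < norm w" using far w \<open>\<delta> \<le> 1\<close> by simp
      have "sqrt r \<le> norm (bstft f z)" using z unfolding u_def by (rule real_le_lsqrt[rotated -1]) (use \<open>0 < r\<close> in auto)
      moreover have "norm (bstft f z) - norm (bstft f w) \<le> sqrt r / 2"
      proof -
        have "norm (bstft f z) - norm (bstft f w) \<le> N * (sqrt pi * dist w z)"
          unfolding N_def by (rule norm_bstft_lipschitz[OF f])
        also have "\<dots> \<le> (N * sqrt pi) * (sqrt r / (2 * (N * sqrt pi + 1)))"
        proof -
          have "dist w z \<le> sqrt r / (2 * (N * sqrt pi + 1))" using w by (simp add: \<delta>_def dist_commute)
          from mult_left_mono[OF this \<open>N * sqrt pi \<ge> 0\<close>] show ?thesis by (simp only: mult.assoc)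
        qed
        also have "\<dots> \<le> sqrt r / 2"
          using \<open>N * sqrt pi \<ge> 0\<close> \<open>0 < r\<close> by (simp add: field_simps)
        finally show ?thesis .
      qed
      ultimately have "sqrt r / 2 \<le> norm (bstft f w)" by simp
      then have "(sqrt r / 2)\<^sup>2 \<le> u w" unfolding u_def using \<open>0 < r\<close> by (intro power_mono) auto
      then show "r / 4 \<le> u w" using \<open>0 < r\<close> by (simp add: power_divide)
    qed
    have "r / 4 * (pi * \<delta>\<^sup>2) = (LINT w|lborel. r / 4 * indicator (ball z \<delta>) w)"
      using \<open>\<delta> > 0\<close> content_ball[of \<delta> z] by (simp add: unit_ball_vol_2 power2_eq_square)
    also have "\<dots> \<le> (LINT w|lborel. indicator {z. real n < norm z} w * u w)"
    proof (rule integral_mono)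
      show "integrable lborel (\<lambda>w. r / 4 * indicator (ball z \<delta>) w)"
        using emeasure_bounded_finite[OF bounded_ball[of z \<delta>]]
        by (intro integrable_mult_right integrable_real_indicator) auto
      show "integrable lborel (\<lambda>w. indicator {z. real n < norm z} w * u w)"
        by (rule Bochner_Integration.integrable_bound[OF iu]) (auto simp: indicator_def u_def)
      show "r / 4 * indicator (ball z \<delta>) w \<le> indicator {z. real n < norm z} w * u w" for w
        using uw[of w] by (auto simp: indicator_def u_def)
    qed
    finally show False using n by simp
  qed
  then show ?thesis unfolding bounded_iff u_def by blast
qed

text \<open>Equality in the Cauchy--Schwarz inequality: the remainder after projecting
  \<open>f\<close> onto the unit vector \<open>coherent z\<close> has norm 0.\<close>

lemma bstft_norm_eq_imp_coherent:
  assumes f: "square_integrable lborel f" and eq: "(norm (bstft f z))\<^sup>2 = sqnorm f"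
  shows "AE y in lborel. f y = bstft f z * coherent z y"
proof -
  note cz = square_integrable_coherent[of z]
  have "Re (cnj (bstft f z) * bstft f z) = (norm (bstft f z))\<^sup>2"
    by (simp only: cmod_power2) (simp add: power2_eq_square)
  then have "(LINT y|lborel. (norm (f y - bstft f z * coherent z y))\<^sup>2) = 0"
    using integral_norm_diff_square[OF f cz(1), of "bstft f z"] cz(2) eq by (simp add: bstft_def)
  moreover have "integrable lborel (\<lambda>y. (norm (f y - bstft f z * coherent z y))\<^sup>2)"
    by (intro square_integrableD square_integrable_diff square_integrable_cmult f cz)
  ultimately have "AE y in lborel. (norm (f y - bstft f z * coherent z y))\<^sup>2 = 0"
    by (subst (asm) integral_nonneg_eq_0_iff_AE) auto
  then show ?thesis by eventually_elim simp
qed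

section \<open>The Bargmann transform\<close>

text \<open>The exponential is expanded and integrated term by term, which represents the integral
  by a power series converging in the whole plane.\<close>

lemma holomorphic_gaussian_laplace:
  assumes k: "square_integrable lborel k"
  shows "(\<lambda>\<zeta>. LINT y|lborel. k y * (exp (2 * of_real pi * of_real y * \<zeta>) * of_real (exp (- pi * y\<^sup>2)))) holomorphic_on UNIV"
    (is "?L holomorphic_on UNIV")
proof -
  have [measurable]: "k \<in> borel_measurable borel" using square_integrableD[OF k] by simp
  define a where "a n = (LINT y|lborel. k y * ((2 * of_real pi * of_real y) ^ n / fact n * of_real (exp (- pi * y\<^sup>2))))" for n
  have sums: "(\<lambda>n. a n * (w - 0) ^ n) sums ?L w" for w
  proof -
    define \<rho> where "\<rho> = norm w"
    define t where "t n y = k y * ((2 * of_real pi * of_real y) ^ n / fact n * of_real (exp (- pi * y\<^sup>2))) * w ^ n" for n y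
    \<comment> \<open>\<open>b\<close> dominates all partial sums of the norms. The exponential with
      \<open>\<bar>y\<bar>\<close> is at most the sum of those with \<open>y\<close> and
      \<open>- y\<close>; each times the Gaussian is square integrable by completing the square, so
      \<open>b\<close> is integrable.\<close>
    define b where "b y = norm (k y) * (exp (2 * pi * \<bar>y\<bar> * \<rho>) * exp (- pi * y\<^sup>2))" for y
    have g: "square_integrable lborel (\<lambda>y. of_real (exp (2 * pi * c * y - pi * y\<^sup>2)))" for c
    proof -
      have "integrable lborel (\<lambda>y. (exp (pi * c\<^sup>2))\<^sup>2 * exp (- pi * 2 * (- c + 1 * y)\<^sup>2))"
        using gaussian_fourier(1)[of 2] by (intro integrable_mult_right lborel_integrable_real_affine) auto
      also have "(\<lambda>y. (exp (pi * c\<^sup>2))\<^sup>2 * exp (- pi * 2 * (- c + 1 * y)\<^sup>2)) = (\<lambda>y. (exp (2 * pi * c * y - pi * y\<^sup>2))\<^sup>2)"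
        unfolding exp_double[symmetric] mult_exp_exp by (intro ext arg_cong[where f = exp]) (simp add: power2_eq_square algebra_simps)
      finally show ?thesis by (simp add: square_integrable_def)
    qed
    have bi: "integrable lborel b"
    proof (rule Bochner_Integration.integrable_bound)
      show "integrable lborel (\<lambda>y. norm (k y) * norm (complex_of_real (exp (2 * pi * \<rho> * y - pi * y\<^sup>2)))
          + norm (k y) * norm (complex_of_real (exp (2 * pi * (- \<rho>) * y - pi * y\<^sup>2))))"
        by (intro Bochner_Integration.integrable_add integrable_norm_mult k g)
      show "AE y in lborel. norm (b y) \<le> norm (norm (k y) * norm (complex_of_real (exp (2 * pi * \<rho> * y - pi * y\<^sup>2)))
          + norm (k y) * norm (complex_of_real (exp (2 * pi * (- \<rho>) * y - pi * y\<^sup>2))))"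
      proof (rule AE_I2)
        fix y
        have "exp (2 * pi * \<bar>y\<bar> * \<rho>) * exp (- pi * y\<^sup>2) \<le> exp (2 * pi * \<rho> * y - pi * y\<^sup>2) + exp (2 * pi * (- \<rho>) * y - pi * y\<^sup>2)"
        proof -
          have "2 * pi * \<bar>y\<bar> * \<rho> + - pi * y\<^sup>2 = 2 * pi * \<rho> * y - pi * y\<^sup>2 \<or>
              2 * pi * \<bar>y\<bar> * \<rho> + - pi * y\<^sup>2 = 2 * pi * (- \<rho>) * y - pi * y\<^sup>2"
            by (auto simp: abs_if algebra_simps)
          then show ?thesis unfolding mult_exp_exp by (elim disjE) (simp_all only: le_add_same_cancel1 le_add_same_cancel2 exp_ge_zero)
        qed
        then have "b y \<le> norm (k y) * (exp (2 * pi * \<rho> * y - pi * y\<^sup>2) + exp (2 * pi * (- \<rho>) * y - pi * y\<^sup>2))"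
          unfolding b_def by (intro mult_left_mono) auto
        moreover have "0 \<le> b y" by (simp add: b_def)
        ultimately show "norm (b y) \<le> norm (norm (k y) * norm (complex_of_real (exp (2 * pi * \<rho> * y - pi * y\<^sup>2)))
          + norm (k y) * norm (complex_of_real (exp (2 * pi * (- \<rho>) * y - pi * y\<^sup>2))))"
          by (simp add: distrib_left)
      qed
    qed (unfold b_def, measurable)
    define e where "e n y = (2 * pi * \<bar>y\<bar> * \<rho>) ^ n / fact n" for n y
    have nt: "norm (t n y) = norm (k y) * (e n y * exp (- pi * y\<^sup>2))" for n y
      by (simp add: t_def e_def \<rho>_def norm_mult norm_divide norm_power power_mult_distrib abs_mult mult_ac)
    have e0: "0 \<le> e n y" for n y by (simp add: e_def \<rho>_def)
    have es: "(\<lambda>n. e n y) sums exp (2 * pi * \<bar>y\<bar> * \<rho>)" for y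
      using exp_converges[of "2 * pi * \<bar>y\<bar> * \<rho>"] by (simp add: e_def scaleR_conv_of_real field_simps)
    have epart: "(\<Sum>n<m. e n y) \<le> exp (2 * pi * \<bar>y\<bar> * \<rho>)" for m y
      using sum_le_suminf[OF sums_summable[OF es], of "{..<m}"] e0 sums_unique[OF es] by simp
    have ntb: "(\<Sum>n<m. norm (t n y)) \<le> b y" for m y
      unfolding nt b_def sum_distrib_left[symmetric] sum_distrib_right[symmetric]
      by (intro mult_left_mono mult_right_mono epart) auto
    have tm[measurable]: "t n \<in> borel_measurable borel" for n unfolding t_def by measurable
    have ti: "integrable lborel (t n)" for n
    proof (rule Bochner_Integration.integrable_bound[OF bi])
      show "AE y in lborel. norm (t n y) \<le> norm (b y)"
      proof (rule AE_I2)
        fix y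
        have "norm (t n y) \<le> (\<Sum>n<Suc n. norm (t n y))" by (simp add: sum_nonneg)
        also have "\<dots> \<le> b y" by (rule ntb)
        finally show "norm (t n y) \<le> norm (b y)" by simp
      qed
    qed measurable
    have "(\<lambda>n. integral\<^sup>L lborel (t n)) sums (LINT y|lborel. (\<Sum>n. t n y))"
    proof (rule sums_integral[OF ti])
      show "AE y in lborel. summable (\<lambda>n. norm (t n y))"
        unfolding nt by (intro AE_I2 summable_mult summable_mult2 sums_summable[OF es])
      show "summable (\<lambda>n. LINT y|lborel. norm (t n y))"
      proof (rule summableI_nonneg_bounded)
        show "0 \<le> (LINT y|lborel. norm (t n y))" for n by (intro Bochner_Integration.integral_nonneg) simp
        show "(\<Sum>n<m. LINT y|lborel. norm (t n y)) \<le> integral\<^sup>L lborel b" for m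
        proof -
          have "(\<Sum>n<m. LINT y|lborel. norm (t n y)) = (LINT y|lborel. (\<Sum>n<m. norm (t n y)))"
            using ti by (intro Bochner_Integration.integral_sum[symmetric]) auto
          also have "\<dots> \<le> integral\<^sup>L lborel b"
            using ti bi ntb by (intro integral_mono) auto
          finally show ?thesis .
        qed
      qed
    qed
    also have "(\<lambda>n. integral\<^sup>L lborel (t n)) = (\<lambda>n. a n * (w - 0) ^ n)"
      by (simp add: t_def[abs_def] a_def)
    also have "(\<lambda>y. \<Sum>n. t n y) = (\<lambda>y. k y * (exp (2 * of_real pi * of_real y * w) * of_real (exp (- pi * y\<^sup>2))))"
    proof
      fix y
      have "(\<lambda>n. (2 * of_real pi * of_real y * w) ^ n / fact n) sums exp (2 * of_real pi * of_real y * w)"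
        using exp_converges[of "2 * of_real pi * of_real y * w"] by (simp add: scaleR_conv_of_real field_simps)
      from sums_mult2[OF sums_mult[OF this, of "k y"], of "of_real (exp (- pi * y\<^sup>2))"]
      have "(\<lambda>n. t n y) sums (k y * exp (2 * of_real pi * of_real y * w) * of_real (exp (- pi * y\<^sup>2)))"
        by (simp add: t_def power_mult_distrib mult_ac)
      then show "(\<Sum>n. t n y) = k y * (exp (2 * of_real pi * of_real y * w) * of_real (exp (- pi * y\<^sup>2)))"
        by (simp add: sums_iff mult.assoc)
    qed
    finally show ?thesis .
  qed
  have "?L holomorphic_on ball 0 r" for r
    by (rule power_series_holomorphic[where a = a]) (rule sums)
  then have "?L field_differentiable at w" for w
    using holomorphic_on_imp_differentiable_at[of ?L "ball 0 (norm w + 1)" w] by simp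
  then show ?thesis
    by (simp add: holomorphic_on_def field_differentiable_at_within)
qed

text \<open>The Bargmann transform of the conjugate of \<open>f\<close>. Conjugation makes the
  result holomorphic in \<open>x + \<i> * \<omega>\<close> without reflecting the frequency.\<close>

definition bargmann :: "(real \<Rightarrow> complex) \<Rightarrow> complex \<Rightarrow> complex" where
  "bargmann f \<zeta> = of_real (2 powr (1/4)) * exp (- of_real pi * \<zeta>\<^sup>2 / 2) *
     (LINT y|lborel. cnj (f y) * (exp (2 * of_real pi * of_real y * \<zeta>) * of_real (exp (- pi * y\<^sup>2))))"

lemma holomorphic_bargmann:
  assumes "square_integrable lborel f"
  shows "bargmann f holomorphic_on UNIV"
proof -
  have "square_integrable lborel (\<lambda>y. cnj (f y))" using assms by (auto simp: square_integrable_def)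
  then show ?thesis unfolding bargmann_def[abs_def]
    by (intro holomorphic_intros holomorphic_gaussian_laplace) auto
qed

text \<open>Completing the square in the exponent. The factor in front has modulus
  \<open>exp (pi * (x\<^sup>2 + \<omega>\<^sup>2) / 2)\<close> and never vanishes, so bounds and
  limits pass between the two transforms.\<close>

lemma bargmann_bstft:
  "bargmann f (Complex x \<omega>) = exp (of_real (pi * (x\<^sup>2 + \<omega>\<^sup>2) / 2) - \<i> * of_real (pi * x * \<omega>)) * cnj (bstft f (x, \<omega>))"
proof -
  have "bargmann f (Complex x \<omega>) = (LINT y|lborel. of_real (2 powr (1/4)) * exp (- of_real pi * (Complex x \<omega>)\<^sup>2 / 2) *
     (cnj (f y) * (exp (2 * of_real pi * of_real y * Complex x \<omega>) * of_real (exp (- pi * y\<^sup>2)))))"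
    unfolding bargmann_def by (rule integral_mult_right_zero[symmetric])
  also have "\<dots> = (LINT y|lborel. exp (of_real (pi * (x\<^sup>2 + \<omega>\<^sup>2) / 2) - \<i> * of_real (pi * x * \<omega>)) * (cnj (f y) * coherent (x, \<omega>) y))"
  proof (rule Bochner_Integration.integral_cong[OF refl])
    fix y
    have e: "exp (- of_real pi * (Complex x \<omega>)\<^sup>2 / 2) * (exp (2 * of_real pi * of_real y * Complex x \<omega>) * of_real (exp (- pi * y\<^sup>2)))
      = exp (of_real (pi * (x\<^sup>2 + \<omega>\<^sup>2) / 2) - \<i> * of_real (pi * x * \<omega>)) * (exp (2 * of_real pi * \<i> * of_real y * of_real \<omega>) * of_real (exp (- pi * (x - y)\<^sup>2)))"
      unfolding exp_of_real[symmetric] exp_add[symmetric]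
      by (rule arg_cong[where f = exp]) (simp add: Complex_eq power2_eq_square field_simps)
    show "of_real (2 powr (1/4)) * exp (- of_real pi * (Complex x \<omega>)\<^sup>2 / 2) *
     (cnj (f y) * (exp (2 * of_real pi * of_real y * Complex x \<omega>) * of_real (exp (- pi * y\<^sup>2))))
      = exp (of_real (pi * (x\<^sup>2 + \<omega>\<^sup>2) / 2) - \<i> * of_real (pi * x * \<omega>)) * (cnj (f y) * coherent (x, \<omega>) y)"
      using arg_cong[OF e, of "\<lambda>c. of_real (2 powr (1/4)) * cnj (f y) * c"]
      by (simp add: coherent_def gaussian_def mult_ac)
  qed
  also have "\<dots> = exp (of_real (pi * (x\<^sup>2 + \<omega>\<^sup>2) / 2) - \<i> * of_real (pi * x * \<omega>)) * (LINT y|lborel. cnj (f y) * coherent (x, \<omega>) y)"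
    by (rule integral_mult_right_zero)
  also have "(LINT y|lborel. cnj (f y) * coherent (x, \<omega>) y) = cnj (bstft f (x, \<omega>))"
    unfolding bstft_def Bochner_Integration.integral_cnj[symmetric] by simp
  finally show ?thesis .
qed

lemma fock_density_bargmann: "fock_density (bargmann f) z = (norm (bstft f z))\<^sup>2"
proof -
  obtain x \<omega> where z: "z = (x, \<omega>)" by fastforce
  have n: "(norm z)\<^sup>2 = x\<^sup>2 + \<omega>\<^sup>2" by (simp add: z norm_Pair)
  have "norm (bargmann f (Complex x \<omega>)) = exp (pi * (norm z)\<^sup>2 / 2) * norm (bstft f z)"
    unfolding bargmann_bstft n by (simp add: norm_mult norm_exp_eq_Re z)
  then have "fock_density (bargmann f) z = ((exp (pi * (norm z)\<^sup>2 / 2))\<^sup>2 * exp (- pi * (norm z)\<^sup>2)) * (norm (bstft f z))\<^sup>2"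
    by (simp add: fock_density_def z power_mult_distrib mult_ac)
  also have "(exp (pi * (norm z)\<^sup>2 / 2))\<^sup>2 * exp (- pi * (norm z)\<^sup>2) = 1"
    by (simp add: exp_double[symmetric] mult_exp_exp)
  finally show ?thesis by simp
qed

section \<open>Energy of a density above a level\<close>

text \<open>The left side is the integral of \<open>- ln\<close> from 0 to \<open>x\<close>; on the
  whole unit interval that integral is 1. The piece above \<open>x\<close> is what a density with
  maximum \<open>x\<close> loses against the Gaussian.\<close>

lemma diff_mult_ln_less_1:
  fixes x :: real
  assumes "0 < x" "x < 1"
  shows "x - x * ln x < 1"
proof -
  have "ln (1 / x) \<noteq> 1 / x - 1" using ln_eq_minus_one[of "1 / x"] assms by auto
  then have "ln (1 / x) < 1 / x - 1" using ln_le_minus_one[of "1 / x"] assms by simp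
  then have "x * ln (1 / x) < x * (1 / x - 1)" using assms by (intro mult_strict_left_mono) auto
  then show ?thesis using assms by (simp add: ln_div algebra_simps)
qed

lemma nn_integral_minus_ln:
  assumes "0 < a" "a \<le> b" "\<And>x. a \<le> x \<Longrightarrow> x \<le> b \<Longrightarrow> 0 \<le> c - ln x"
  shows "(\<integral>\<^sup>+x. ennreal (c - ln x) * indicator {a..b} x \<partial>lborel)
    = ennreal ((c * b + b - b * ln b) - (c * a + a - a * ln a))"
proof (rule nn_integral_FTC_Icc)
  show "((\<lambda>x. c * x + x - x * ln x) has_real_derivative c - ln x) (at x)" if "x \<in> {a..b}" for x
    using that assms(1) by (auto intro!: derivative_eq_intros)
qed (use assms in auto)

text \<open>\<open>ennreal\<close> sends negative reals to 0, so the integrand is the positive part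
  of \<open>u z - \<tau>\<close>, and the layer-cake formula for it starts at the level
  \<open>\<tau>\<close>.\<close>

lemma nn_integral_excess_eq:
  fixes u :: "'a \<Rightarrow> real"
  assumes "sigma_finite_measure M" "u \<in> borel_measurable M"
  shows "(\<integral>\<^sup>+z. ennreal (u z - \<tau>) \<partial>M)
    = (\<integral>\<^sup>+r. indicator {\<tau><..} r * emeasure M {z \<in> space M. r < u z} \<partial>lborel)"
proof -
  interpret sigma_finite_measure M by fact
  note [measurable] = assms(2)
  have "(\<integral>\<^sup>+z. ennreal (u z - \<tau>) \<partial>M)
      = (\<integral>\<^sup>+r. indicator {0<..} r * emeasure M {z \<in> space M. r < u z - \<tau>} \<partial>lborel)"
    by (rule nn_integral_layer_cake) (use assms in auto)
  also have "\<dots> = (\<integral>\<^sup>+r. indicator {\<tau><..} (\<tau> + 1 * r) * emeasure M {z \<in> space M. \<tau> + 1 * r < u z} \<partial>lborel)"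
    by (intro nn_integral_cong arg_cong2[where f = "(*)"] arg_cong[where f = "emeasure M"])
       (auto split: split_indicator)
  also have "\<dots> = (\<integral>\<^sup>+r. indicator {\<tau><..} r * emeasure M {z \<in> space M. r < u z} \<partial>lborel)"
    by (subst (2) nn_integral_real_affine[of _ 1 \<tau>]) simp_all
  finally show ?thesis .
qed

text \<open>Both \<open>m\<close> and \<open>- ln\<close> on the unit interval have integral 1, and
  \<open>m r + ln r\<close> is nonincreasing below the maximum \<open>T\<close> of \<open>u\<close>.
  The sign of this sum at \<open>\<tau>\<close> decides whether the two are compared above or below
  \<open>\<tau>\<close>.\<close>

lemma nn_integral_excess_less:
  fixes F :: "complex \<Rightarrow> complex"
  defines "u \<equiv> fock_density F"
  assumes F: "F holomorphic_on UNIV" and bdd: "\<And>r. 0 < r \<Longrightarrow> bounded {z. r \<le> u z}"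
    and int: "(\<integral>\<^sup>+z. ennreal (u z) \<partial>lborel) = 1"
    and lt1: "\<And>z. u z < 1" and \<tau>: "0 < \<tau>" "\<tau> < 1"
  shows "(\<integral>\<^sup>+z. ennreal (u z - \<tau>) \<partial>lborel) < ennreal (1 - \<tau> + \<tau> * ln \<tau>)"
proof -
  define m where "m r = measure lborel {z. r < u z}" for r
  have cu: "continuous_on UNIV u" unfolding u_def by (rule continuous_fock_density[OF F])
  then have [measurable]: "u \<in> borel_measurable borel" by (rule borel_measurable_continuous_onI)
  have u0: "0 \<le> u z" for z by (simp add: u_def)
  have em: "emeasure lborel {z. r < u z} = ennreal (m r)" if "0 < r" for r
    unfolding m_def u_def by (rule emeasure_superlevel[OF F bdd[unfolded u_def] that])
  have dec: "ln b - ln a \<le> m a - m b" if "0 < a" "a \<le> b" "0 < m b" for a b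
    using measure_superlevel_decrease[OF F bdd[unfolded u_def], of a b] that by (simp add: m_def u_def)
  have "\<exists>z1. 0 < u z1"
  proof (rule ccontr)
    assume "\<nexists>z1. 0 < u z1"
    then have "u z = 0" for z using u0[of z] by (metis less_eq_real_def)
    then show False using int by simp
  qed
  then obtain z1 where z1: "0 < u z1" by blast
  obtain z0 where z0: "\<And>z. u z \<le> u z0"
  proof -
    have "closed {z. u z1 \<le> u z}" using cu by (intro closed_Collect_le continuous_intros)
    then have "compact {z. u z1 \<le> u z}" using bdd[OF z1] by (simp add: compact_eq_bounded_closed)
    from continuous_attains_sup[OF this _ continuous_on_subset[OF cu subset_UNIV]]
    obtain z0 where z0: "u z1 \<le> u z0" "\<And>z. u z1 \<le> u z \<Longrightarrow> u z \<le> u z0" by blast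
    have "u z \<le> u z0" for z using z0(1) z0(2)[of z] by (cases "u z1 \<le> u z") auto
    then show thesis using that by blast
  qed
  define T where "T = u z0"
  have T: "0 < T" "T < 1" using z1 z0[of z1] lt1[of z0] by (auto simp: T_def)
  have mT: "emeasure lborel {z. r < u z} = 0" if "T \<le> r" for r
  proof -
    have E: "{z. r < u z} = {}" using z0 that by (auto simp: T_def not_less intro: order_trans)
    show ?thesis by (simp only: E emeasure_empty)
  qed
  have mpos: "0 < m r" if "0 < r" "r < T" for r
  proof -
    have op: "open {z. r < u z}" using cu by (intro open_Collect_less continuous_intros)
    have "{z. r < u z} \<noteq> {}" using that unfolding T_def by blast
    then have "\<not> negligible {z. r < u z}" by (rule open_not_negligible[OF op])
    then have "emeasure lborel {z. r < u z} \<noteq> 0"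
      using op by (auto simp: negligible_iff_null_sets null_sets_def)
    then show ?thesis unfolding em[OF that(1)] by (simp add: ennreal_eq_0_iff not_le)
  qed
  have excess: "(\<integral>\<^sup>+z. ennreal (u z - \<tau>) \<partial>lborel) = (\<integral>\<^sup>+r. indicator {\<tau><..} r * emeasure lborel {z. r < u z} \<partial>lborel)"
    using nn_integral_excess_eq[of lborel u \<tau>] by (simp add: lborel.sigma_finite_measure_axioms)
  have pos: "0 < 1 - \<tau> + \<tau> * ln \<tau>" using diff_mult_ln_less_1[OF \<tau>] by simp
  consider "T \<le> \<tau>" | "\<tau> < T" "m \<tau> \<le> - ln \<tau>" | "\<tau> < T" "- ln \<tau> < m \<tau>" by linarith
  then show ?thesis
  proof cases
    case 1
    have "u z - \<tau> \<le> 0" for z using z0[of z] 1 by (simp add: T_def)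
    then have "(\<integral>\<^sup>+z. ennreal (u z - \<tau>) \<partial>lborel) = 0" by (simp add: ennreal_neg)
    then show ?thesis using pos by simp
  next
    case 2
    \<comment> \<open>Here \<open>m\<close> stays below \<open>- ln\<close> from
      \<open>\<tau>\<close> up to \<open>T\<close> and vanishes from there on. Strictness comes from
      the missing part of the comparison integral between \<open>T\<close> and 1.\<close>
    have "(\<integral>\<^sup>+z. ennreal (u z - \<tau>) \<partial>lborel) \<le> (\<integral>\<^sup>+r. ennreal (0 - ln r) * indicator {\<tau>..T} r \<partial>lborel)"
      unfolding excess
    proof (rule nn_integral_mono)
      fix r
      show "indicator {\<tau><..} r * emeasure lborel {z. r < u z} \<le> ennreal (0 - ln r) * indicator {\<tau>..T} r"
      proof (cases "\<tau> < r \<and> r < T")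
        case True
        then have "ln r - ln \<tau> \<le> m \<tau> - m r" using \<tau> by (intro dec mpos) auto
        then have "m r \<le> 0 - ln r" using 2 by simp
        then show ?thesis using True \<tau> by (simp add: em ennreal_leI)
      next
        case False
        then consider "r \<le> \<tau>" | "T \<le> r" by linarith
        then show ?thesis by cases (auto simp: mT)
      qed
    qed
    also have "\<dots> = ennreal ((0 * T + T - T * ln T) - (0 * \<tau> + \<tau> - \<tau> * ln \<tau>))"
      using \<tau> T 2 by (intro nn_integral_minus_ln) auto
    also have "\<dots> < ennreal (1 - \<tau> + \<tau> * ln \<tau>)"
      using diff_mult_ln_less_1[OF T] pos by (intro ennreal_lessI) auto
    finally show ?thesis .
  next
    case 3
    \<comment> \<open>The lead of \<open>m\<close> over \<open>- ln\<close> at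
      \<open>\<tau>\<close>. Monotonicity carries it to all lower levels, so the part of
      \<open>u\<close> below height \<open>\<tau>\<close> takes up too much of the total mass 1 and
      the part above is too small.\<close>
    define c where "c = m \<tau> + ln \<tau>"
    have "0 < c" using 3 by (simp add: c_def)
    \<comment> \<open>The comparison integral is started at some \<open>\<delta>\<close> above 0,
      where \<open>ln\<close> is regular. The part cut off is made smaller than the gain
      \<open>c * \<tau>\<close>, so the strict inequality survives.\<close>
    have "((\<lambda>x. c * x + x - x * ln x) \<longlongrightarrow> 0) (at_right 0)" by real_asymp
    then have "\<forall>\<^sub>F x in at_right 0. c * x + x - x * ln x < c * \<tau>"
      using \<open>0 < c\<close> \<tau> by (intro order_tendstoD(2)) auto
    moreover have "\<forall>\<^sub>F x in at_right 0. x \<in> {0<..<\<tau>}"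
      using \<tau> by (intro eventually_at_right_real)
    ultimately have "\<forall>\<^sub>F x in at_right 0. c * x + x - x * ln x < c * \<tau> \<and> x \<in> {0<..<\<tau>}"
      by (rule eventually_conj)
    then obtain \<delta> where \<delta>: "0 < \<delta>" "\<delta> < \<tau>" "c * \<delta> + \<delta> - \<delta> * ln \<delta> < c * \<tau>"
      by (auto dest!: eventually_happens)
    have lnn: "0 \<le> c - ln r" if "\<delta> \<le> r" "r \<le> \<tau>" for r
    proof -
      have "ln r \<le> 0" using that \<delta> \<tau> by (subst ln_le_zero_iff) auto
      then show ?thesis using \<open>0 < c\<close> by simp
    qed
    have "ennreal ((c * \<tau> + \<tau> - \<tau> * ln \<tau>) - (c * \<delta> + \<delta> - \<delta> * ln \<delta>))
        = (\<integral>\<^sup>+r. ennreal (c - ln r) * indicator {\<delta>..\<tau>} r \<partial>lborel)"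
      using \<delta> lnn by (intro nn_integral_minus_ln[symmetric]) auto
    also have "\<dots> \<le> (\<integral>\<^sup>+r. indicator {0<..} r * emeasure lborel {z \<in> space lborel. r < min (u z) \<tau>} \<partial>lborel)"
    proof (rule nn_integral_mono_AE)
      show "AE r in lborel. ennreal (c - ln r) * indicator {\<delta>..\<tau>} r
          \<le> indicator {0<..} r * emeasure lborel {z \<in> space lborel. r < min (u z) \<tau>}"
        using AE_lborel_singleton[of \<tau>]
      proof eventually_elim
        fix r assume "r \<noteq> \<tau>"
        show "ennreal (c - ln r) * indicator {\<delta>..\<tau>} r
          \<le> indicator {0<..} r * emeasure lborel {z \<in> space lborel. r < min (u z) \<tau>}"
        proof (cases "\<delta> \<le> r \<and> r < \<tau>")
          case True
          then have "ln \<tau> - ln r \<le> m r - m \<tau>" using \<delta> \<tau> 3 by (intro dec mpos) auto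
          then have "ennreal (c - ln r) \<le> ennreal (m r)" by (intro ennreal_leI) (simp add: c_def)
          moreover have "{z \<in> space lborel. r < min (u z) \<tau>} = {z. r < u z}" using True by auto
          ultimately show ?thesis using True \<delta> em[of r] by simp
        qed (use \<open>r \<noteq> \<tau>\<close> in auto)
      qed
    qed
    also have "\<dots> = (\<integral>\<^sup>+z. ennreal (min (u z) \<tau>) \<partial>lborel)"
      by (rule nn_integral_layer_cake[symmetric]) (auto simp: lborel.sigma_finite_measure_axioms)
    finally have low: "ennreal ((c * \<tau> + \<tau> - \<tau> * ln \<tau>) - (c * \<delta> + \<delta> - \<delta> * ln \<delta>)) \<le> (\<integral>\<^sup>+z. ennreal (min (u z) \<tau>) \<partial>lborel)" .
    have sum1: "(\<integral>\<^sup>+z. ennreal (u z - \<tau>) \<partial>lborel) + (\<integral>\<^sup>+z. ennreal (min (u z) \<tau>) \<partial>lborel) = 1"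
    proof -
      have "(\<integral>\<^sup>+z. ennreal (u z - \<tau>) \<partial>lborel) + (\<integral>\<^sup>+z. ennreal (min (u z) \<tau>) \<partial>lborel)
          = (\<integral>\<^sup>+z. ennreal (u z - \<tau>) + ennreal (min (u z) \<tau>) \<partial>lborel)"
        by (rule nn_integral_add[symmetric]) measurable
      also have "\<dots> = (\<integral>\<^sup>+z. ennreal (u z) \<partial>lborel)"
      proof (rule nn_integral_cong)
        fix z
        show "ennreal (u z - \<tau>) + ennreal (min (u z) \<tau>) = ennreal (u z)"
          using \<tau> u0[of z] by (cases "u z \<le> \<tau>") (auto simp: ennreal_neg ennreal_plus[symmetric] simp del: ennreal_plus)
      qed
      finally show ?thesis using int by simp
    qed
    define X where "X = enn2real (\<integral>\<^sup>+z. ennreal (u z - \<tau>) \<partial>lborel)"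
    have fin: "(\<integral>\<^sup>+z. ennreal (u z - \<tau>) \<partial>lborel) \<noteq> top" "(\<integral>\<^sup>+z. ennreal (min (u z) \<tau>) \<partial>lborel) \<noteq> top"
      using sum1 by auto
    then have X: "(\<integral>\<^sup>+z. ennreal (u z - \<tau>) \<partial>lborel) = ennreal X" by (simp add: X_def less_top)
    have "0 \<le> X" by (simp add: X_def)
    define D where "D = (c * \<tau> + \<tau> - \<tau> * ln \<tau>) - (c * \<delta> + \<delta> - \<delta> * ln \<delta>)"
    have "\<tau> * ln \<tau> \<le> 0" using \<tau> by (intro mult_nonneg_nonpos) auto
    then have "0 \<le> D" using \<delta>(3) \<tau> by (simp add: D_def)
    then have "ennreal (X + D) = ennreal X + ennreal D" using \<open>0 \<le> X\<close> by simp
    also have "\<dots> \<le> ennreal X + (\<integral>\<^sup>+z. ennreal (min (u z) \<tau>) \<partial>lborel)"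
      using low by (intro add_left_mono) (simp add: D_def)
    also have "\<dots> = ennreal 1" using sum1 X by simp
    finally have "X + D \<le> 1" by simp
    then have "X < 1 - \<tau> + \<tau> * ln \<tau>" using \<delta>(3) by (simp add: D_def)
    then show ?thesis unfolding X using pos by (intro ennreal_lessI)
  qed
qed

text \<open>The bathtub bound: pointwise, \<open>u z\<close> is at most \<open>\<tau>\<close> plus
  the positive part of \<open>u z - \<tau>\<close>.\<close>

lemma nn_integral_indicator_le_excess:
  fixes u :: "'a::euclidean_space \<Rightarrow> real"
  assumes u[measurable]: "u \<in> borel_measurable borel" and \<Omega>: "\<Omega> \<in> sets lebesgue" and "0 \<le> \<tau>"
  shows "(\<integral>\<^sup>+z. ennreal (u z) * indicator \<Omega> z \<partial>lebesgue)
    \<le> (\<integral>\<^sup>+z. ennreal (u z - \<tau>) \<partial>lborel) + ennreal \<tau> * emeasure lebesgue \<Omega>"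
proof -
  have [measurable]: "(\<lambda>z. ennreal (u z - \<tau>)) \<in> borel_measurable lebesgue"
    by (rule measurable_completion) measurable
  have "(\<integral>\<^sup>+z. ennreal (u z) * indicator \<Omega> z \<partial>lebesgue)
      \<le> (\<integral>\<^sup>+z. ennreal (u z - \<tau>) + ennreal \<tau> * indicator \<Omega> z \<partial>lebesgue)"
  proof (rule nn_integral_mono)
    fix z
    have "ennreal (u z) \<le> ennreal (u z - \<tau>) + ennreal \<tau>"
      using \<open>0 \<le> \<tau>\<close> by (cases "\<tau> \<le> u z") (auto simp: ennreal_neg ennreal_plus[symmetric] intro: ennreal_leI simp del: ennreal_plus)
    then show "ennreal (u z) * indicator \<Omega> z \<le> ennreal (u z - \<tau>) + ennreal \<tau> * indicator \<Omega> z"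
      by (auto simp: indicator_def)
  qed
  also have "\<dots> = (\<integral>\<^sup>+z. ennreal (u z - \<tau>) \<partial>lebesgue) + (\<integral>\<^sup>+z. ennreal \<tau> * indicator \<Omega> z \<partial>lebesgue)"
    using \<Omega> by (intro nn_integral_add) auto
  also have "(\<integral>\<^sup>+z. ennreal (u z - \<tau>) \<partial>lebesgue) = (\<integral>\<^sup>+z. ennreal (u z - \<tau>) \<partial>lborel)"
    by (rule nn_integral_completion)
  also have "(\<integral>\<^sup>+z. ennreal \<tau> * indicator \<Omega> z \<partial>lebesgue) = ennreal \<tau> * emeasure lebesgue \<Omega>"
    using \<Omega> by (rule nn_integral_cmult_indicator)
  finally show ?thesis .
qed

text \<open>The superlevel set of the Gaussian at a level \<open>r\<close> between 0 and 1 is a disc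
  of area \<open>- ln r\<close>: the extremal case of the comparison.\<close>

lemma gaussian_excess:
  fixes p :: "real \<times> real"
  assumes \<tau>: "0 < \<tau>" "\<tau> < 1"
  shows "(\<integral>\<^sup>+z. ennreal (exp (- pi * (dist p z)\<^sup>2) - \<tau>) \<partial>lborel) = ennreal (1 - \<tau> + \<tau> * ln \<tau>)"
proof -
  have lev: "{z. r < exp (- pi * (dist p z)\<^sup>2)} = ball p (sqrt (- ln r / pi))" if "0 < r" "r < 1" for r
  proof -
    have "r < exp (- pi * (dist p z)\<^sup>2) \<longleftrightarrow> dist p z < sqrt (- ln r / pi)" for z
    proof -
      have "r < exp (- pi * (dist p z)\<^sup>2) \<longleftrightarrow> ln r < - pi * (dist p z)\<^sup>2"
        using that by (metis exp_less_cancel_iff exp_ln)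
      also have "\<dots> \<longleftrightarrow> (dist p z)\<^sup>2 < - ln r / pi" by (simp add: field_simps, linarith)
      also have "\<dots> \<longleftrightarrow> sqrt ((dist p z)\<^sup>2) < sqrt (- ln r / pi)" by (simp only: real_sqrt_less_iff)
      finally show ?thesis by simp
    qed
    then show ?thesis by (auto simp: ball_def)
  qed
  have em: "emeasure lborel {z. r < exp (- pi * (dist p z)\<^sup>2)} = ennreal (- ln r)" if "0 < r" "r < 1" for r
  proof -
    have "ln r \<le> 0" using that by simp
    then have "0 \<le> - ln r / pi" by (intro divide_nonneg_pos) auto
    then show ?thesis unfolding lev[OF that] by (subst emeasure_ball) (auto simp: unit_ball_vol_2 abs_of_nonpos[OF \<open>ln r \<le> 0\<close>])
  qed
  have "(\<integral>\<^sup>+z. ennreal (exp (- pi * (dist p z)\<^sup>2) - \<tau>) \<partial>lborel)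
    = (\<integral>\<^sup>+r. indicator {\<tau><..} r * emeasure lborel {z. r < exp (- pi * (dist p z)\<^sup>2)} \<partial>lborel)"
    using nn_integral_excess_eq[of lborel "\<lambda>z. exp (- pi * (dist p z)\<^sup>2)" \<tau>]
    by (simp add: lborel.sigma_finite_measure_axioms)
  also have "\<dots> = (\<integral>\<^sup>+r. ennreal (0 - ln r) * indicator {\<tau>..1} r \<partial>lborel)"
  proof (rule nn_integral_cong_AE)
    show "AE r in lborel. indicator {\<tau><..} r * emeasure lborel {z. r < exp (- pi * (dist p z)\<^sup>2)} = ennreal (0 - ln r) * indicator {\<tau>..1} r"
      using AE_lborel_singleton[of \<tau>]
    proof eventually_elim
      fix r assume "r \<noteq> \<tau>"
      show "indicator {\<tau><..} r * emeasure lborel {z. r < exp (- pi * (dist p z)\<^sup>2)} = ennreal (0 - ln r) * indicator {\<tau>..1} r"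
      proof (cases "\<tau> < r \<and> r < 1")
        case True
        then show ?thesis using em[of r] \<tau> by simp
      next
        case False
        then consider "r < \<tau>" | "r = 1" | "1 < r" using \<open>r \<noteq> \<tau>\<close> \<tau> by linarith
        moreover have E: "{z. r < exp (- pi * (dist p z)\<^sup>2)} = {}" if "1 \<le> r"
        proof -
          have "exp (- pi * (dist p z)\<^sup>2) \<le> 1" for z by simp
          then have "\<not> r < exp (- pi * (dist p z)\<^sup>2)" for z
            using that by (meson not_less order_trans)
          then show ?thesis by blast
        qed
        ultimately show ?thesis by cases (use \<tau> in \<open>auto simp only: E emeasure_empty\<close>, auto)
      qed
    qed
  qed
  also have "\<dots> = ennreal ((0 * 1 + 1 - 1 * ln 1) - (0 * \<tau> + \<tau> - \<tau> * ln \<tau>))"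
    using \<tau> by (intro nn_integral_minus_ln) auto
  finally show ?thesis by (simp add: algebra_simps)
qed

section \<open>Energy of the short-time Fourier transform on a set\<close>

definition energy_on :: "(real \<times> real) set \<Rightarrow> (real \<Rightarrow> complex) \<Rightarrow> real" where
  "energy_on \<Omega> f = (LINT z:\<Omega>|lebesgue. (norm (bstft f z))\<^sup>2)"

lemma bstft_cmult: "bstft (\<lambda>y. c * f y) z = c * bstft f z"
  by (simp add: bstft_def mult.assoc)

lemma bstft_cong_AE:
  assumes "f \<in> borel_measurable borel" "g \<in> borel_measurable borel" "AE y in lborel. f y = g y"
  shows "bstft f = bstft g"
proof
  fix z
  show "bstft f z = bstft g z"
    unfolding bstft_def using assms by (intro integral_cong_AE) (measurable, auto)
qed

lemma
  assumes f: "square_integrable lborel f" and \<Omega>: "\<Omega> \<in> sets lebesgue"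
  shows ennreal_energy_on: "ennreal (energy_on \<Omega> f) = (\<integral>\<^sup>+z. ennreal ((norm (bstft f z))\<^sup>2) * indicator \<Omega> z \<partial>lebesgue)"
    and energy_on_nonneg: "0 \<le> energy_on \<Omega> f"
    and energy_on_le: "energy_on \<Omega> f \<le> sqnorm f"
proof -
  have fm[measurable]: "f \<in> borel_measurable borel" using square_integrableD[OF f] by simp
  have i: "integrable lebesgue (\<lambda>z. (norm (bstft f z))\<^sup>2)"
    using bstft_isometry(2)[OF f] by (subst integrable_completion) measurable
  have 1: "integrable lebesgue (\<lambda>z. indicator \<Omega> z *\<^sub>R (norm (bstft f z))\<^sup>2)"
    using i \<Omega> by (rule integrable_mult_indicator[rotated])
  have "ennreal (energy_on \<Omega> f) = (\<integral>\<^sup>+z. ennreal (indicator \<Omega> z *\<^sub>R (norm (bstft f z))\<^sup>2) \<partial>lebesgue)"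
    unfolding energy_on_def set_lebesgue_integral_def by (rule nn_integral_eq_integral[symmetric, OF 1]) simp
  also have "\<dots> = (\<integral>\<^sup>+z. ennreal ((norm (bstft f z))\<^sup>2) * indicator \<Omega> z \<partial>lebesgue)"
    by (intro nn_integral_cong) (auto simp: indicator_def)
  finally show "ennreal (energy_on \<Omega> f) = (\<integral>\<^sup>+z. ennreal ((norm (bstft f z))\<^sup>2) * indicator \<Omega> z \<partial>lebesgue)" .
  show "0 \<le> energy_on \<Omega> f"
    unfolding energy_on_def set_lebesgue_integral_def by (rule Bochner_Integration.integral_nonneg) simp
  have "energy_on \<Omega> f \<le> (LINT z|lebesgue. (norm (bstft f z))\<^sup>2)"
    unfolding energy_on_def set_lebesgue_integral_def by (rule integral_mono[OF 1 i]) (auto simp: indicator_def)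
  also have "\<dots> = (LINT z|lborel. (norm (bstft f z))\<^sup>2)"
    by (rule integral_completion) measurable
  finally show "energy_on \<Omega> f \<le> sqnorm f" by (simp add: bstft_isometry(3)[OF f])
qed

lemma energy_on_cmult: "energy_on \<Omega> (\<lambda>y. c * f y) = (norm c)\<^sup>2 * energy_on \<Omega> f"
  unfolding energy_on_def bstft_cmult norm_mult power_mult_distrib by (rule set_integral_mult_right)

text \<open>After normalisation \<open>f\<close> satisfies the hypotheses of
  \<open>nn_integral_excess_less\<close>, since a value different from the Cauchy--Schwarz bound is
  strictly below it. The bathtub bound then turns the strict estimate of the excess into one for
  \<open>\<Omega>\<close>.\<close>

lemma energy_on_less:
  assumes f: "square_integrable lborel f" and \<Omega>: "\<Omega> \<in> sets lebesgue" "emeasure lebesgue \<Omega> = ennreal s" and "0 < s"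
    and pos: "0 < sqnorm f"
    and ne: "\<And>z. (norm (bstft f z))\<^sup>2 \<noteq> sqnorm f"
  shows "energy_on \<Omega> f < sqnorm f * (1 - exp (- s))"
proof -
  define N where "N = sqnorm f"
  have "N > 0" using pos by (simp add: N_def)
  define g where "g y = of_real (1 / sqrt N) * f y" for y
  have g: "square_integrable lborel g" unfolding g_def by (rule square_integrable_cmult[OF f])
  have [measurable]: "g \<in> borel_measurable borel" using square_integrableD[OF g] by simp
  have nc: "(norm (complex_of_real (1 / sqrt N)))\<^sup>2 = 1 / N" using \<open>N > 0\<close> by (simp add: power_divide norm_divide)
  have gN: "sqnorm g = 1"
  proof -
    have "sqnorm g = (LINT y|lborel. 1 / N * (norm (f y))\<^sup>2)"
      unfolding g_def norm_mult power_mult_distrib nc ..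
    also have "\<dots> = 1 / N * N" by (subst integral_mult_right_zero) (simp add: N_def)
    finally show ?thesis using \<open>N > 0\<close> by simp
  qed
  have ug: "(norm (bstft g z))\<^sup>2 = (norm (bstft f z))\<^sup>2 / N" for z
    unfolding g_def bstft_cmult norm_mult power_mult_distrib nc by simp
  define F where "F = bargmann g"
  have F: "F holomorphic_on UNIV" unfolding F_def by (rule holomorphic_bargmann[OF g])
  have uF: "fock_density F z = (norm (bstft g z))\<^sup>2" for z unfolding F_def by (rule fock_density_bargmann)
  \<comment> \<open>For this threshold \<open>\<tau> * ln \<tau> = - \<tau> * s\<close>, which
    cancels the term \<open>\<tau> * s\<close> of the bathtub bound and leaves
    \<open>1 - \<tau>\<close>.\<close>
  define \<tau> where "\<tau> = exp (- s)"
  have \<tau>: "0 < \<tau>" "\<tau> < 1" using \<open>0 < s\<close> by (auto simp: \<tau>_def)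
  have lt1: "(norm (bstft g z))\<^sup>2 < 1" for z
  proof -
    have "(norm (bstft f z))\<^sup>2 \<le> N"
      using power_mono[OF norm_bstft_le[OF f, of z], of 2] by (simp add: N_def)
    then have "(norm (bstft f z))\<^sup>2 < N" using ne[of z] by (simp add: N_def)
    then show ?thesis using \<open>N > 0\<close> by (simp add: ug)
  qed
  have ex: "(\<integral>\<^sup>+z. ennreal ((norm (bstft g z))\<^sup>2 - \<tau>) \<partial>lborel) < ennreal (1 - \<tau> + \<tau> * ln \<tau>)"
    unfolding uF[symmetric]
  proof (rule nn_integral_excess_less[OF F])
    show "bounded {z. r \<le> fock_density F z}" if "0 < r" for r
      unfolding uF using g that by (rule bounded_superlevel_bstft)
    show "(\<integral>\<^sup>+z. ennreal (fock_density F z) \<partial>lborel) = 1"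
      unfolding uF using bstft_isometry(1)[OF g] gN by simp
    show "fock_density F z < 1" for z unfolding uF by (rule lt1)
  qed (use \<tau> in auto)
  have "0 \<le> 1 - \<tau> - \<tau> * s" using diff_mult_ln_less_1[OF \<tau>] by (simp add: \<tau>_def)
  have "ennreal (energy_on \<Omega> g) \<le> (\<integral>\<^sup>+z. ennreal ((norm (bstft g z))\<^sup>2 - \<tau>) \<partial>lborel) + ennreal \<tau> * emeasure lebesgue \<Omega>"
    unfolding ennreal_energy_on[OF g \<Omega>(1)] using \<tau> \<Omega>(1) by (intro nn_integral_indicator_le_excess) auto
  also have "ennreal \<tau> * emeasure lebesgue \<Omega> = ennreal (\<tau> * s)"
    unfolding \<Omega>(2) using \<tau> \<open>0 < s\<close> by (simp add: ennreal_mult)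
  finally have le: "ennreal (energy_on \<Omega> g) \<le> (\<integral>\<^sup>+z. ennreal ((norm (bstft g z))\<^sup>2 - \<tau>) \<partial>lborel) + ennreal (\<tau> * s)" .
  define E where "E = enn2real (\<integral>\<^sup>+z. ennreal ((norm (bstft g z))\<^sup>2 - \<tau>) \<partial>lborel)"
  have E: "(\<integral>\<^sup>+z. ennreal ((norm (bstft g z))\<^sup>2 - \<tau>) \<partial>lborel) = ennreal E"
    using less_trans[OF ex ennreal_less_top] by (simp add: E_def)
  have "0 \<le> E" by (simp add: E_def)
  have "E < 1 - \<tau> - \<tau> * s" using ex \<open>0 \<le> E\<close> unfolding E by (simp add: ennreal_less_iff \<tau>_def)
  moreover have "energy_on \<Omega> g \<le> E + \<tau> * s"
    using le \<open>0 \<le> E\<close> \<tau> \<open>0 < s\<close> unfolding E by (simp add: ennreal_plus[symmetric] del: ennreal_plus)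
  ultimately have "energy_on \<Omega> g < 1 - \<tau>" by simp
  moreover have "energy_on \<Omega> g = energy_on \<Omega> f / N"
    unfolding g_def energy_on_cmult nc by simp
  ultimately show ?thesis using \<open>N > 0\<close> by (simp add: N_def[symmetric] \<tau>_def field_simps)
qed

lemma norm_bstft_eq_gaussian:
  assumes f: "square_integrable lborel f" and eq: "(norm (bstft f p))\<^sup>2 = sqnorm f"
  shows "(norm (bstft f z))\<^sup>2 = sqnorm f * exp (- pi * (dist p z)\<^sup>2)"
proof -
  have "bstft f = bstft (\<lambda>y. bstft f p * coherent p y)"
    using square_integrableD(1)[OF f] bstft_norm_eq_imp_coherent[OF f eq] by (intro bstft_cong_AE) auto
  then have "norm (bstft f z) = norm (bstft f p) * exp (- pi / 2 * (dist p z)\<^sup>2)"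
    using bstft_cmult[of "bstft f p" "coherent p" z] by (simp add: norm_mult norm_bstft_coherent)
  then have "(norm (bstft f z))\<^sup>2 = (norm (bstft f p))\<^sup>2 * (exp (- pi / 2 * (dist p z)\<^sup>2))\<^sup>2"
    by (simp add: power_mult_distrib)
  also have "(exp (- pi / 2 * (dist p z)\<^sup>2))\<^sup>2 = exp (- pi * (dist p z)\<^sup>2)"
    by (simp add: exp_double[symmetric])
  finally show ?thesis by (simp add: eq)
qed

text \<open>The bathtub principle with its equality case: a set of area \<open>s\<close> collects
  the most mass exactly when it agrees, up to a null set, with the superlevel disc of area
  \<open>s\<close>.\<close>

lemma gaussian_mass_on:
  fixes p :: "real \<times> real"
  assumes \<Omega>: "\<Omega> \<in> sets lebesgue" "emeasure lebesgue \<Omega> = ennreal s" and "0 < s"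
  defines "Q \<equiv> LINT z:\<Omega>|lebesgue. exp (- pi * (dist p z)\<^sup>2)"
  shows "Q \<le> 1 - exp (- s)"
    and "Q = 1 - exp (- s) \<longleftrightarrow> sym_diff \<Omega> (ball p (sqrt (s / pi))) \<in> null_sets lebesgue"
proof -
  define \<tau> where "\<tau> = exp (- s)"
  have \<tau>: "0 < \<tau>" "\<tau> < 1" using \<open>0 < s\<close> by (auto simp: \<tau>_def)
  define u where "u z = exp (- pi * (dist p z)\<^sup>2)" for z
  have [measurable]: "u \<in> borel_measurable borel"
    unfolding u_def by (intro borel_measurable_continuous_onI continuous_intros)
  define \<rho> where "\<rho> = sqrt (s / pi)"
  have "\<rho> > 0" using \<open>0 < s\<close> by (simp add: \<rho>_def)
  have lev: "\<tau> \<le> u z \<longleftrightarrow> dist p z \<le> \<rho>" "\<tau> < u z \<longleftrightarrow> dist p z < \<rho>" for z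
  proof -
    have "\<tau> \<le> u z \<longleftrightarrow> (dist p z)\<^sup>2 \<le> s / pi" "\<tau> < u z \<longleftrightarrow> (dist p z)\<^sup>2 < s / pi"
      by (auto simp: \<tau>_def u_def field_simps)
    moreover have "(dist p z)\<^sup>2 \<le> s / pi \<longleftrightarrow> sqrt ((dist p z)\<^sup>2) \<le> \<rho>" "(dist p z)\<^sup>2 < s / pi \<longleftrightarrow> sqrt ((dist p z)\<^sup>2) < \<rho>"
      unfolding \<rho>_def by (simp_all only: real_sqrt_le_iff real_sqrt_less_iff)
    ultimately show "\<tau> \<le> u z \<longleftrightarrow> dist p z \<le> \<rho>" "\<tau> < u z \<longleftrightarrow> dist p z < \<rho>" by simp_all
  qed
  have fin: "integrable lebesgue (indicator \<Omega> :: _ \<Rightarrow> real)"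
    using \<Omega> by (intro integrable_real_indicator) auto
  have mO: "measure lebesgue \<Omega> = s" using \<Omega>(2) \<open>0 < s\<close> by (simp add: measure_def)
  have e1: "(\<integral>\<^sup>+z. ennreal (max 0 (u z - \<tau>)) \<partial>lborel) = ennreal (1 - \<tau> - \<tau> * s)"
    using gaussian_excess[OF \<tau>, of p] by (simp add: u_def \<tau>_def ennreal_max_0)
  have p0: "0 \<le> 1 - \<tau> - \<tau> * s" using diff_mult_ln_less_1[OF \<tau>] by (simp add: \<tau>_def)
  have i1b: "integrable lborel (\<lambda>z. max 0 (u z - \<tau>))" "(LINT z|lborel. max 0 (u z - \<tau>)) = 1 - \<tau> - \<tau> * s"
    using nn_integral_eq_integrable[of "\<lambda>z. max 0 (u z - \<tau>)" lborel "1 - \<tau> - \<tau> * s"] e1 p0 by auto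
  have i1: "integrable lebesgue (\<lambda>z. max 0 (u z - \<tau>))" "(LINT z|lebesgue. max 0 (u z - \<tau>)) = 1 - \<tau> - \<tau> * s"
    using i1b by (auto simp: integrable_completion integral_completion)
  have i2: "integrable lebesgue (\<lambda>z. indicator \<Omega> z *\<^sub>R u z)"
  proof (rule Bochner_Integration.integrable_bound[OF fin])
    show "(\<lambda>z. indicator \<Omega> z *\<^sub>R u z) \<in> borel_measurable lebesgue"
      using \<Omega>(1) measurable_completion[of u lborel borel] by (intro borel_measurable_scaleR borel_measurable_indicator) auto
  qed (auto simp: indicator_def u_def)
  have Q: "Q = (LINT z|lebesgue. indicator \<Omega> z *\<^sub>R u z)"
    by (simp add: Q_def set_lebesgue_integral_def u_def)
  \<comment> \<open>The pointwise defect of the bathtub bound, with integral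
    \<open>1 - \<tau> - Q\<close>. It vanishes exactly when \<open>\<tau> \<le> u z\<close> on
    \<open>\<Omega>\<close> and \<open>u z \<le> \<tau>\<close> off it; the circle where
    \<open>u z = \<tau>\<close> is a null set.\<close>
  define J where "J z = max 0 (u z - \<tau>) + \<tau> * indicator \<Omega> z - indicator \<Omega> z *\<^sub>R u z" for z
  have Ji: "integrable lebesgue J" unfolding J_def using i1(1) fin i2 by auto
  have J0: "0 \<le> J z" for z by (auto simp: J_def indicator_def)
  have JQ: "(LINT z|lebesgue. J z) = 1 - \<tau> - Q"
    unfolding J_def Q using i1 fin i2 mO by simp
  have "0 \<le> (LINT z|lebesgue. J z)" by (rule Bochner_Integration.integral_nonneg[OF J0])
  then show "Q \<le> 1 - exp (- s)" by (simp add: JQ \<tau>_def)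
  have "Q = 1 - exp (- s) \<longleftrightarrow> (LINT z|lebesgue. J z) = 0" by (auto simp: JQ \<tau>_def)
  also have "\<dots> \<longleftrightarrow> (AE z in lebesgue. J z = 0)"
    using J0 by (intro integral_nonneg_eq_0_iff_AE[OF Ji]) auto
  also have "\<dots> \<longleftrightarrow> (AE z in lebesgue. z \<notin> sym_diff \<Omega> (ball p \<rho>))"
  proof
    have "sphere p \<rho> \<in> null_sets lebesgue" using negligible_sphere negligible_iff_null_sets by blast
    then have S: "AE z in lebesgue. z \<notin> sphere p \<rho>" by (rule AE_not_in)
    assume "AE z in lebesgue. J z = 0"
    with S show "AE z in lebesgue. z \<notin> sym_diff \<Omega> (ball p \<rho>)"
    proof eventually_elim
      fix z assume z: "z \<notin> sphere p \<rho>" "J z = 0"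
      show "z \<notin> sym_diff \<Omega> (ball p \<rho>)"
      proof (cases "z \<in> \<Omega>")
        case True
        then have "\<tau> \<le> u z" using z(2) by (auto simp: J_def max_def split: if_splits)
        then show ?thesis using True z(1) by (auto simp: lev sphere_def)
      next
        case False
        then have "\<not> \<tau> < u z" using z(2) by (auto simp: J_def max_def split: if_splits)
        then show ?thesis using False by (auto simp: lev)
      qed
    qed
  next
    assume "AE z in lebesgue. z \<notin> sym_diff \<Omega> (ball p \<rho>)"
    then show "AE z in lebesgue. J z = 0"
    proof eventually_elim
      fix z assume z: "z \<notin> sym_diff \<Omega> (ball p \<rho>)"
      show "J z = 0"
      proof (cases "dist p z < \<rho>")
        case True
        then have "\<tau> < u z" "z \<in> \<Omega>" using z lev by auto
        then show ?thesis by (simp add: J_def)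
      next
        case False
        then have "\<not> \<tau> < u z" "z \<notin> \<Omega>" using z lev by auto
        then show ?thesis by (simp add: J_def)
      qed
    qed
  qed
  also have "\<dots> \<longleftrightarrow> sym_diff \<Omega> (ball p \<rho>) \<in> null_sets lebesgue"
  proof -
    have "ball p \<rho> \<in> sets lebesgue" by simp
    with \<Omega>(1) have "sym_diff \<Omega> (ball p \<rho>) \<in> sets lebesgue" by (intro sets.Un sets.Diff)
    from AE_iff_null_sets[OF this] show ?thesis by simp
  qed
  finally show "Q = 1 - exp (- s) \<longleftrightarrow> sym_diff \<Omega> (ball p (sqrt (s / pi))) \<in> null_sets lebesgue"
    by (simp only: \<rho>_def)
qed

lemma energy_on_coherent:
  assumes f: "square_integrable lborel f" and eq: "(norm (bstft f p))\<^sup>2 = sqnorm f"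
  shows "energy_on \<Omega> f = sqnorm f * (LINT z:\<Omega>|lebesgue. exp (- pi * (dist p z)\<^sup>2))"
  unfolding energy_on_def norm_bstft_eq_gaussian[OF assms]
  by (rule set_integral_mult_right)

section \<open>Attainment of the maximum\<close>

lemma lebesgue_complex_ex_borel:
  fixes f :: "'a::euclidean_space \<Rightarrow> complex"
  assumes "f \<in> borel_measurable lebesgue"
  obtains g where "g \<in> borel_measurable borel" "AE x in lborel. f x = g x"
proof -
  obtain a b where a: "a \<in> borel_measurable lborel" "AE x in lborel. Re (f x) = a x"
    and b: "b \<in> borel_measurable lborel" "AE x in lborel. Im (f x) = b x"
    using completion_ex_borel_measurable_real[of "\<lambda>x. Re (f x)" lborel]
      completion_ex_borel_measurable_real[of "\<lambda>x. Im (f x)" lborel] assms by auto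
  have "(\<lambda>x. Complex (a x) (b x)) \<in> borel_measurable borel"
    using a(1) b(1) by (simp add: Complex_eq)
  moreover have "AE x in lborel. f x = Complex (a x) (b x)"
    using a(2) b(2) by eventually_elim (simp add: complex_eq_iff)
  ultimately show thesis using that by blast
qed

text \<open>The transform and the norm depend only on the class of \<open>f\<close> modulo null
  sets. This is the passage from Lebesgue measurable functions to Borel ones, where the results on
  \<open>bstft\<close> apply.\<close>

lemma L2_space_rep:
  fixes f :: "real \<Rightarrow> complex"
  assumes "f \<in> L2_space"
  obtains g where "square_integrable lborel g" "AE x in lborel. f x = g x" "stft f = bstft g"
    "(L2_norm f)\<^sup>2 = sqnorm g"
proof -
  have fm: "f \<in> borel_measurable lebesgue" and fi: "integrable lebesgue (\<lambda>x. (norm (f x))\<^sup>2)"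
    using assms by (auto simp: L2_space_def)
  obtain g where gm[measurable]: "g \<in> borel_measurable borel" and ae: "AE x in lborel. f x = g x"
    using lebesgue_complex_ex_borel[OF fm] by blast
  have gl: "g \<in> borel_measurable lebesgue" using gm by (intro measurable_completion) simp
  have ae': "AE x in lebesgue. f x = g x" using ae by (rule AE_completion)
  have ae2: "AE x in lebesgue. (norm (f x))\<^sup>2 = (norm (g x))\<^sup>2" using ae' by eventually_elim simp
  have nm: "(\<lambda>x. (norm (g x))\<^sup>2) \<in> borel_measurable lborel" by simp
  have "integrable lebesgue (\<lambda>x. (norm (g x))\<^sup>2)"
    using fi by (subst integrable_cong_AE[where g = "\<lambda>x. (norm (f x))\<^sup>2"]) (use ae2 fm gl in \<open>auto elim: AE_mp\<close>)
  then have "square_integrable lborel g" using nm by (simp add: square_integrable_def integrable_completion)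
  moreover have "stft f = bstft g"
  proof
    fix z
    obtain x \<omega> :: real where z: "z = (x, \<omega>)" by fastforce
    define e where "e y = (exp (- 2 * of_real pi * \<i> * of_real y * of_real \<omega>) * of_real (gaussian (x - y)) :: complex)" for y
    have em: "e \<in> borel_measurable lborel" unfolding e_def by simp
    then have el: "e \<in> borel_measurable lebesgue" by (rule measurable_completion)
    have "stft f z = (LINT y|lebesgue. f y * e y)" by (simp add: stft_def z e_def mult_ac)
    also have "\<dots> = (LINT y|lebesgue. g y * e y)"
      using ae' fm gl el by (intro integral_cong_AE) auto
    also have "\<dots> = (LINT y|lborel. g y * e y)" using em by (intro integral_completion) simp
    also have "\<dots> = bstft g z" by (simp add: bstft_def z e_def cnj_coherent)
    finally show "stft f z = bstft g z" .
  qed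
  moreover have "(L2_norm f)\<^sup>2 = sqnorm g"
  proof -
    have "(L2_norm f)\<^sup>2 = (LINT y|lebesgue. (norm (f y))\<^sup>2)" by (simp add: L2_norm_def)
    also have "\<dots> = (LINT y|lebesgue. (norm (g y))\<^sup>2)"
      using ae2 fm gl by (intro integral_cong_AE) auto
    also have "\<dots> = sqnorm g" using nm by (rule integral_completion)
    finally show ?thesis .
  qed
  ultimately show thesis using that ae by blast
qed

lemma square_integrable_imp_L2_space:
  fixes g :: "real \<Rightarrow> complex"
  assumes "square_integrable lborel g"
  shows "g \<in> L2_space" "stft g = bstft g" "(L2_norm g)\<^sup>2 = sqnorm g"
proof -
  have gm: "g \<in> borel_measurable lborel" using square_integrableD[OF assms] by simp
  have nm: "(\<lambda>x. (norm (g x))\<^sup>2) \<in> borel_measurable lborel" using gm by simp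
  show L: "g \<in> L2_space"
    using square_integrableD(2)[OF assms] gm nm by (simp add: L2_space_def integrable_completion measurable_completion)
  obtain h where h: "square_integrable lborel h" "AE x in lborel. g x = h x" "stft g = bstft h"
    "(L2_norm g)\<^sup>2 = sqnorm h" using L2_space_rep[OF L] by blast
  have hm: "h \<in> borel_measurable lborel" using square_integrableD[OF h(1)] by simp
  show "stft g = bstft g" unfolding h(3) using gm hm h(2) by (intro bstft_cong_AE) auto
  show "(L2_norm g)\<^sup>2 = sqnorm g"
    unfolding h(4) using gm hm h(2) by (intro integral_cong_AE) auto
qed

lemma L2_nonzero_iff:
  fixes f :: "real \<Rightarrow> complex"
  assumes f: "f \<in> L2_space"
  shows "f \<in> L2_nonzero \<longleftrightarrow> 0 < (L2_norm f)\<^sup>2"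
proof -
  have "(L2_norm f)\<^sup>2 = (LINT x|lebesgue. (norm (f x))\<^sup>2)" by (simp add: L2_norm_def)
  moreover have "(LINT x|lebesgue. (norm (f x))\<^sup>2) = 0 \<longleftrightarrow> (AE x in lebesgue. (norm (f x))\<^sup>2 = 0)"
    using f by (intro integral_nonneg_eq_0_iff_AE) (auto simp: L2_space_def)
  moreover have "0 \<le> (LINT x|lebesgue. (norm (f x))\<^sup>2)" by simp
  ultimately show ?thesis using f by (auto simp: L2_nonzero_def less_le)
qed

lemma concentration_eq:
  assumes g: "square_integrable lborel g" and "stft f = bstft g"
  shows "concentration \<Omega> f = energy_on \<Omega> g / sqnorm g"
proof -
  have [measurable]: "g \<in> borel_measurable borel" using square_integrableD[OF g] by simp
  have "(LINT z|lebesgue. (norm (bstft g z))\<^sup>2) = (LINT z|lborel. (norm (bstft g z))\<^sup>2)"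
    by (intro integral_completion) simp
  then show ?thesis
    unfolding concentration_def energy_on_def assms(2) bstft_isometry(3)[OF g, symmetric] by simp
qed

lemma concentration_bounds:
  assumes f: "f \<in> L2_nonzero" and \<Omega>: "\<Omega> \<in> sets lebesgue"
  shows "0 \<le> concentration \<Omega> f" "concentration \<Omega> f \<le> 1"
proof -
  have fL: "f \<in> L2_space" using f by (simp add: L2_nonzero_def)
  obtain g where g: "square_integrable lborel g" "stft f = bstft g" "(L2_norm f)\<^sup>2 = sqnorm g"
    using L2_space_rep[OF fL] by blast
  have "0 < sqnorm g" using L2_nonzero_iff[OF fL] f g(3) by simp
  then show "0 \<le> concentration \<Omega> f" "concentration \<Omega> f \<le> 1"
    unfolding concentration_eq[OF g(1,2)]
    using energy_on_nonneg[OF g(1) \<Omega>] energy_on_le[OF g(1) \<Omega>] by auto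
qed

lemma concentration_le_Phi:
  assumes "f \<in> L2_nonzero" "\<Omega> \<in> sets lebesgue"
  shows "concentration \<Omega> f \<le> \<Phi> \<Omega>"
  unfolding \<Phi>_def using assms concentration_bounds(2)[OF _ assms(2)]
  by (intro cSUP_upper bdd_aboveI[of _ 1]) auto

lemma coherent_facts:
  "coherent p \<in> L2_nonzero" "(norm (bstft (coherent p) p))\<^sup>2 = (LINT y|lborel. (norm (coherent p y))\<^sup>2)"
  using square_integrable_imp_L2_space[OF square_integrable_coherent(1)[of p]] L2_nonzero_iff[of "coherent p"]
  by (auto simp: square_integrable_coherent(2) norm_bstft_coherent)

lemma concentration_coherent:
  "concentration \<Omega> (coherent p) = (LINT z:\<Omega>|lebesgue. exp (- pi * (dist p z)\<^sup>2))"
  unfolding concentration_eq[OF square_integrable_coherent(1) square_integrable_imp_L2_space(2)[OF square_integrable_coherent(1)]]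
    energy_on_coherent[OF square_integrable_coherent(1) coherent_facts(2)]
  by (simp add: square_integrable_coherent(2))

text \<open>A dichotomy on the Cauchy--Schwarz bound \<open>N\<close>. If the squared modulus never
  reaches it, \<open>energy_on_less\<close> is strict. If it does, the function is a multiple of a
  coherent state and the question reduces to the mass of a Gaussian on
  \<open>\<Omega>\<close>.\<close>

lemma concentration_cases:
  assumes f: "f \<in> L2_nonzero" and \<Omega>: "\<Omega> \<in> sets lebesgue" "emeasure lebesgue \<Omega> = ennreal s" "0 < s"
  shows "concentration \<Omega> f \<le> 1 - exp (- s)"
    and "concentration \<Omega> f = 1 - exp (- s) \<Longrightarrow> \<exists>p c. c \<noteq> 0 \<and> (AE x in lebesgue. f x = c * coherent p x)
      \<and> sym_diff \<Omega> (ball p (sqrt (s / pi))) \<in> null_sets lebesgue"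
proof -
  have fL: "f \<in> L2_space" using f by (simp add: L2_nonzero_def)
  obtain g where g: "square_integrable lborel g" "AE x in lborel. f x = g x" "stft f = bstft g"
    "(L2_norm f)\<^sup>2 = sqnorm g"
    using L2_space_rep[OF fL] by blast
  define N where "N = sqnorm g"
  have N: "0 < N" using L2_nonzero_iff[OF fL] f g(4) by (simp add: N_def)
  have conc: "concentration \<Omega> f = energy_on \<Omega> g / N"
    unfolding concentration_eq[OF g(1,3)] N_def ..
  have *: "concentration \<Omega> f \<le> 1 - exp (- s) \<and> (concentration \<Omega> f = 1 - exp (- s) \<longrightarrow>
    (\<exists>p c. c \<noteq> 0 \<and> (AE x in lebesgue. f x = c * coherent p x)
      \<and> sym_diff \<Omega> (ball p (sqrt (s / pi))) \<in> null_sets lebesgue))"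
  proof (cases "\<exists>p. (norm (bstft g p))\<^sup>2 = N")
    case False
    then have "energy_on \<Omega> g < N * (1 - exp (- s))"
      unfolding N_def using N by (intro energy_on_less[OF g(1) \<Omega>]) (auto simp: N_def)
    then have "concentration \<Omega> f < 1 - exp (- s)"
      using N by (simp add: conc field_simps)
    then show ?thesis by simp
  next
    case True
    then obtain p where p: "(norm (bstft g p))\<^sup>2 = sqnorm g" by (auto simp: N_def)
    have "concentration \<Omega> f = (LINT z:\<Omega>|lebesgue. exp (- pi * (dist p z)\<^sup>2))"
      unfolding conc energy_on_coherent[OF g(1) p] using N by (simp add: N_def)
    moreover have "bstft g p \<noteq> 0" using p N by (auto simp: N_def)
    moreover have "AE x in lebesgue. f x = bstft g p * coherent p x"
      using AE_completion[OF g(2)] AE_completion[OF bstft_norm_eq_imp_coherent[OF g(1) p]]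
      by eventually_elim simp
    ultimately show ?thesis using gaussian_mass_on[OF \<Omega>, of p]
      by (intro conjI impI exI[of _ p] exI[of _ "bstft g p"]) simp_all
  qed
  then show "concentration \<Omega> f \<le> 1 - exp (- s)" by blast
  from * show "concentration \<Omega> f = 1 - exp (- s) \<Longrightarrow> \<exists>p c. c \<noteq> 0 \<and> (AE x in lebesgue. f x = c * coherent p x)
      \<and> sym_diff \<Omega> (ball p (sqrt (s / pi))) \<in> null_sets lebesgue" by blast
qed

lemma lebesgue_set_ex_borel:
  fixes \<Omega> :: "'a::euclidean_space set"
  assumes "\<Omega> \<in> sets lebesgue"
  obtains B where "B \<in> sets borel" "AE z in lebesgue. z \<in> \<Omega> \<longleftrightarrow> z \<in> B" "emeasure lebesgue \<Omega> = emeasure lborel B"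
proof
  show "main_part lborel \<Omega> \<in> sets borel" using main_part_sets[OF assms] by simp
  have "AE z in lebesgue. z \<notin> null_part lborel \<Omega>" using AE_notin_null_part[OF assms] by (rule AE_completion)
  then show "AE z in lebesgue. z \<in> \<Omega> \<longleftrightarrow> z \<in> main_part lborel \<Omega>"
  proof eventually_elim
    fix z assume "z \<notin> null_part lborel \<Omega>"
    then show "z \<in> \<Omega> \<longleftrightarrow> z \<in> main_part lborel \<Omega>" using main_part_null_part_Un[OF assms] by blast
  qed
  show "emeasure lebesgue \<Omega> = emeasure lborel (main_part lborel \<Omega>)" by (rule emeasure_completion[OF assms])
qed

lemma lebesgue_set_integral_borel:
  fixes h :: "'a::euclidean_space \<Rightarrow> 'b::{banach, second_countable_topology}"
  assumes h[measurable]: "h \<in> borel_measurable borel" and B[measurable]: "B \<in> sets borel" and \<Omega>: "\<Omega> \<in> sets lebesgue"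
    and ae: "AE z in lebesgue. z \<in> \<Omega> \<longleftrightarrow> z \<in> B"
  shows "(LINT z|lebesgue. indicator \<Omega> z *\<^sub>R h z) = (LINT z|lborel. indicator B z *\<^sub>R h z)"
proof -
  have hl: "h \<in> borel_measurable lebesgue" by (rule measurable_completion) simp
  have "(LINT z|lebesgue. indicator \<Omega> z *\<^sub>R h z) = (LINT z|lebesgue. indicator B z *\<^sub>R h z)"
  proof (rule integral_cong_AE)
    show "(\<lambda>z. indicator \<Omega> z *\<^sub>R h z) \<in> borel_measurable lebesgue"
      using hl \<Omega> by (intro borel_measurable_scaleR borel_measurable_indicator)
    show "(\<lambda>z. indicator B z *\<^sub>R h z) \<in> borel_measurable lebesgue"
      using hl B by (intro borel_measurable_scaleR borel_measurable_indicator) auto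
    show "AE z in lebesgue. indicator \<Omega> z *\<^sub>R h z = indicator B z *\<^sub>R h z"
      using ae by eventually_elim (auto simp: indicator_def)
  qed
  also have "\<dots> = (LINT z|lborel. indicator B z *\<^sub>R h z)" by (rule integral_completion) measurable
  finally show ?thesis .
qed

section \<open>Maximising sequences\<close>

text \<open>Unit norms give the Bargmann transforms the common bound
  \<open>exp (pi * (norm \<zeta>)\<^sup>2 / 2)\<close>, so they form a normal family. Dividing by
  the nonvanishing factor of \<open>bargmann_bstft\<close> returns to the short-time Fourier
  transform.\<close>

lemma bstft_ptwise_compactness:
  fixes h :: "nat \<Rightarrow> real \<Rightarrow> complex"
  assumes h: "\<And>n. square_integrable lborel (h n)" "\<And>n. (LINT y|lborel. (norm (h n y))\<^sup>2) = 1"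
  shows "\<exists>r W. strict_mono (r :: nat \<Rightarrow> nat) \<and> (\<forall>z. (\<lambda>n. bstft (h (r n)) z) \<longlonglongrightarrow> W z)"
proof -
  have nb: "norm (bargmann (h n) \<zeta>) \<le> exp (pi * (norm \<zeta>)\<^sup>2 / 2)" for n \<zeta>
  proof -
    have "norm (bstft (h n) (Re \<zeta>, Im \<zeta>)) \<le> 1" using norm_bstft_le[OF h(1)[of n]] by (simp add: h(2))
    then have "exp (pi * ((Re \<zeta>)\<^sup>2 + (Im \<zeta>)\<^sup>2) / 2) * norm (bstft (h n) (Re \<zeta>, Im \<zeta>)) \<le> exp (pi * ((Re \<zeta>)\<^sup>2 + (Im \<zeta>)\<^sup>2) / 2) * 1"
      by (intro mult_left_mono) auto
    then show ?thesis
      using bargmann_bstft[of "h n" "Re \<zeta>" "Im \<zeta>"] by (simp add: norm_mult norm_exp_eq_Re cmod_power2)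
  qed
  obtain G r where r: "strict_mono (r :: nat \<Rightarrow> nat)"
    and lim: "\<And>\<zeta>. \<zeta> \<in> UNIV \<Longrightarrow> (\<lambda>n. bargmann (h (r n)) \<zeta>) \<longlonglongrightarrow> G \<zeta>"
  proof (rule Montel[of UNIV "range (\<lambda>n. bargmann (h n))" "\<lambda>n. bargmann (h n)"])
    show "F holomorphic_on UNIV" if "F \<in> range (\<lambda>n. bargmann (h n))" for F
      using that h(1) holomorphic_bargmann by auto
    show "\<exists>B. \<forall>F\<in>range (\<lambda>n. bargmann (h n)). \<forall>\<zeta>\<in>K. norm (F \<zeta>) \<le> B" if "compact K" for K
    proof -
      obtain R where R: "\<And>\<zeta>. \<zeta> \<in> K \<Longrightarrow> norm \<zeta> \<le> R"
        using compact_imp_bounded[OF \<open>compact K\<close>] bounded_iff by blast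
      have "norm (bargmann (h n) \<zeta>) \<le> exp (pi * R\<^sup>2 / 2)" if "\<zeta> \<in> K" for n \<zeta>
      proof -
        have "(norm \<zeta>)\<^sup>2 \<le> R\<^sup>2" using R[OF that] by (intro power_mono) auto
        then have "exp (pi * (norm \<zeta>)\<^sup>2 / 2) \<le> exp (pi * R\<^sup>2 / 2)" by simp
        then show ?thesis using nb order_trans by blast
      qed
      then show ?thesis by blast
    qed
  qed auto
  have "\<exists>w. (\<lambda>n. bstft (h (r n)) z) \<longlonglongrightarrow> w" for z
  proof -
    obtain x \<omega> where z: "z = (x, \<omega>)" by fastforce
    define e where "e = exp (of_real (pi * (x\<^sup>2 + \<omega>\<^sup>2) / 2) - \<i> * of_real (pi * x * \<omega>))"
    have "e \<noteq> 0" by (simp add: e_def)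
    have eq: "bstft (h (r n)) z = cnj (bargmann (h (r n)) (Complex x \<omega>) / e)" for n
      using \<open>e \<noteq> 0\<close> unfolding bargmann_bstft e_def[symmetric] by (simp add: z)
    have "(\<lambda>n. cnj (bargmann (h (r n)) (Complex x \<omega>) / e)) \<longlonglongrightarrow> cnj (G (Complex x \<omega>) / e)"
      using \<open>e \<noteq> 0\<close> by (intro tendsto_intros lim) auto
    then show ?thesis unfolding eq by blast
  qed
  then obtain W where "\<And>z. (\<lambda>n. bstft (h (r n)) z) \<longlonglongrightarrow> W z" by metis
  with r show ?thesis by blast
qed

text \<open>For a maximising sequence with \<open>bstft (h n)\<close> converging pointwise to \<open>W\<close>, the function
  \<open>g = V\<^sup>*(1\<^sub>B W)\<close> is a maximiser: \<open>\<langle>h n, g\<rangle>\<close> tends to \<open>\<integral>\<^sub>B |W|\<^sup>2 = lam\<close>, so \<open>lam \<le> \<parallel>g\<parallel>\<close>, while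
  \<open>\<parallel>g\<parallel>\<^sup>2 = \<integral>\<^sub>B W (V g)\<^sup>* \<le> \<surd>lam (\<integral>\<^sub>B |V g|\<^sup>2)\<^sup>1\<^sup>/\<^sup>2\<close>.\<close>

lemma maximiser_exists_borel:
  fixes h :: "nat \<Rightarrow> real \<Rightarrow> complex"
  assumes h: "\<And>n. square_integrable lborel (h n)" "\<And>n. (LINT y|lborel. (norm (h n y))\<^sup>2) = 1"
    and B[measurable]: "B \<in> sets borel" and fin: "emeasure lborel B < \<infinity>"
    and lim: "(\<lambda>n. LINT z|lborel. indicator B z *\<^sub>R (norm (bstft (h n) z))\<^sup>2) \<longlonglongrightarrow> lam" and "0 < lam"
  obtains g where "square_integrable lborel g" "0 < sqnorm g"
    "lam * sqnorm g \<le> (LINT z|lborel. indicator B z *\<^sub>R (norm (bstft g z))\<^sup>2)"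
proof -
  obtain r W where r: "strict_mono (r :: nat \<Rightarrow> nat)" and W: "\<And>z. (\<lambda>n. bstft (h (r n)) z) \<longlonglongrightarrow> W z"
    using bstft_ptwise_compactness[of h, OF h] by blast
  have hm[measurable]: "h n \<in> borel_measurable borel" for n using square_integrableD[OF h(1)] by simp
  have [measurable]: "W \<in> borel_measurable borel"
    by (rule borel_measurable_LIMSEQ_metric[OF _ W]) measurable
  \<comment> \<open>With this bound \<open>indicator B\<close> dominates the integrands on
    \<open>B\<close>, and it is integrable because \<open>B\<close> has finite measure.\<close>
  have n1: "norm (bstft (h n) z) \<le> 1" for n z using norm_bstft_le[OF h(1)[of n], of z] by (simp add: h(2))
  have nW: "norm (W z) \<le> 1" for z
    by (rule LIMSEQ_le_const2[OF tendsto_norm[OF W[of z]]]) (use n1 in blast)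
  have iB: "integrable lborel (indicator B :: _ \<Rightarrow> real)" using fin by (intro integrable_real_indicator) auto
  define V where "V z = indicator B z *\<^sub>R W z" for z
  have [measurable]: "V \<in> borel_measurable borel" unfolding V_def by measurable
  have iV: "integrable lborel V"
    by (rule Bochner_Integration.integrable_bound[OF iB]) (use nW in \<open>auto simp: V_def indicator_def\<close>)
  have sV: "square_integrable lborel V"
    unfolding square_integrable_def
    by (auto intro!: Bochner_Integration.integrable_bound[OF iB] simp: V_def indicator_def nW power_le_one)
  have lamV: "(LINT z|lborel. (norm (V z))\<^sup>2) = lam"
  proof (rule LIMSEQ_unique)
    show "(\<lambda>n. LINT z|lborel. indicator B z *\<^sub>R (norm (bstft (h (r n)) z))\<^sup>2) \<longlonglongrightarrow> lam"
      using LIMSEQ_subseq_LIMSEQ[OF lim r] by (simp add: o_def)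
    show "(\<lambda>n. LINT z|lborel. indicator B z *\<^sub>R (norm (bstft (h (r n)) z))\<^sup>2) \<longlonglongrightarrow> (LINT z|lborel. (norm (V z))\<^sup>2)"
    proof (rule integral_dominated_convergence[where w = "indicator B"])
      show "AE z in lborel. (\<lambda>n. indicator B z *\<^sub>R (norm (bstft (h (r n)) z))\<^sup>2) \<longlonglongrightarrow> (norm (V z))\<^sup>2"
      proof (rule AE_I2)
        fix z
        have "(\<lambda>n. indicator B z *\<^sub>R (norm (bstft (h (r n)) z))\<^sup>2) \<longlonglongrightarrow> indicator B z *\<^sub>R (norm (W z))\<^sup>2"
          by (intro tendsto_intros W)
        also have "indicator B z *\<^sub>R (norm (W z))\<^sup>2 = (norm (V z))\<^sup>2" by (simp add: V_def indicator_def)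
        finally show "(\<lambda>n. indicator B z *\<^sub>R (norm (bstft (h (r n)) z))\<^sup>2) \<longlonglongrightarrow> (norm (V z))\<^sup>2" .
      qed
      show "AE z in lborel. norm (indicator B z *\<^sub>R (norm (bstft (h (r n)) z))\<^sup>2) \<le> indicator B z" for n
        using n1 by (intro AE_I2) (auto simp: indicator_def power_le_one)
    qed (use iB in auto)
  qed
  \<comment> \<open>The pointwise limit \<open>W\<close> is not identified as a transform. Applying
    the adjoint to its restriction \<open>V\<close> produces a square integrable candidate
    directly.\<close>
  define g where "g = synthesis V"
  have g: "square_integrable lborel g" unfolding g_def by (rule synthesis_adjoint(1)[OF iV])
  have adj: "(LINT y|lborel. f y * cnj (g y)) = (LINT z|lborel. bstft f z * cnj (V z))"
    if "square_integrable lborel f" for f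
    unfolding g_def by (rule synthesis_adjoint(2)[OF iV that])
  define N where "N = sqnorm g"
  have "0 \<le> N" by (simp add: N_def)
  have "(\<lambda>n. LINT z|lborel. bstft (h (r n)) z * cnj (V z)) \<longlonglongrightarrow> (LINT z|lborel. V z * cnj (V z))"
  proof (rule integral_dominated_convergence[where w = "indicator B"])
    show "AE z in lborel. (\<lambda>n. bstft (h (r n)) z * cnj (V z)) \<longlonglongrightarrow> V z * cnj (V z)"
    proof (rule AE_I2)
      fix z
      have "(\<lambda>n. bstft (h (r n)) z * cnj (V z)) \<longlonglongrightarrow> W z * cnj (V z)" by (intro tendsto_intros W)
      also have "W z * cnj (V z) = V z * cnj (V z)" by (simp add: V_def indicator_def)
      finally show "(\<lambda>n. bstft (h (r n)) z * cnj (V z)) \<longlonglongrightarrow> V z * cnj (V z)" .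
    qed
    show "AE z in lborel. norm (bstft (h (r n)) z * cnj (V z)) \<le> indicator B z" for n
      using n1 nW by (intro AE_I2) (auto simp: V_def indicator_def norm_mult intro: mult_le_one)
  qed (use iB in auto)
  also have "(LINT z|lborel. V z * cnj (V z)) = of_real lam"
    unfolding lamV[symmetric] integral_complex_of_real[symmetric] by (simp add: complex_norm_square del: of_real_power)
  finally have "(\<lambda>n. norm (LINT z|lborel. bstft (h (r n)) z * cnj (V z))) \<longlonglongrightarrow> norm (complex_of_real lam)"
    by (rule tendsto_norm)
  moreover have "norm (LINT z|lborel. bstft (h (r n)) z * cnj (V z)) \<le> sqrt N" for n
    using norm_integral_mult_cnj_le[OF h(1)[of "r n"] g] by (simp add: adj[OF h(1)] h(2) N_def)
  ultimately have "norm (complex_of_real lam) \<le> sqrt N"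
    by (intro LIMSEQ_le_const2) auto
  then have lamN: "lam \<le> sqrt N" using \<open>0 < lam\<close> by simp
  then have "0 < sqrt N" using \<open>0 < lam\<close> by linarith
  then have "0 < N" by simp
  define Q where "Q = (LINT z|lborel. indicator B z *\<^sub>R (norm (bstft g z))\<^sup>2)"
  have [measurable]: "g \<in> borel_measurable borel" using square_integrableD[OF g] by simp
  define U where "U z = indicator B z *\<^sub>R bstft g z" for z
  have sU: "square_integrable lborel U"
    unfolding square_integrable_def
  proof
    show "U \<in> borel_measurable lborel" unfolding U_def by measurable
    then show "integrable lborel (\<lambda>z. (norm (U z))\<^sup>2)"
      by (intro Bochner_Integration.integrable_bound[OF bstft_isometry(2)[OF g]]) (auto simp: U_def indicator_def)
  qed
  have QU: "Q = (LINT z|lborel. (norm (U z))\<^sup>2)"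
    unfolding Q_def U_def by (intro Bochner_Integration.integral_cong) (auto simp: indicator_def)
  then have "0 \<le> Q" by simp
  have "of_real N = (LINT y|lborel. g y * cnj (g y))"
    unfolding N_def integral_complex_of_real[symmetric] by (simp add: complex_norm_square del: of_real_power)
  also have "\<dots> = (LINT z|lborel. U z * cnj (V z))"
    unfolding adj[OF g] by (intro Bochner_Integration.integral_cong) (auto simp: U_def V_def indicator_def)
  finally have "norm (complex_of_real N) \<le> sqrt Q * sqrt lam"
    using norm_integral_mult_cnj_le[OF sU sV] by (simp add: QU lamV)
  then have "N \<le> sqrt (Q * lam)" using \<open>0 \<le> N\<close> by (simp add: real_sqrt_mult)
  then have "N\<^sup>2 \<le> Q * lam"
    using \<open>0 \<le> N\<close> \<open>0 \<le> Q\<close> \<open>0 < lam\<close> power_mono[of N "sqrt (Q * lam)" 2] by simp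
  \<comment> \<open>Combined with \<open>N\<^sup>2 \<le> Q * lam\<close> this gives
    \<open>lam * N \<le> Q\<close> after cancelling one factor \<open>lam\<close>, for which
    \<open>0 < lam\<close> is required.\<close>
  moreover have "lam\<^sup>2 \<le> N" using power_mono[OF lamN, of 2] \<open>0 < lam\<close> \<open>0 < N\<close> by simp
  then have "lam\<^sup>2 * N \<le> N * N" using \<open>0 < N\<close> by (intro mult_right_mono) auto
  ultimately have "lam * (lam * N) \<le> lam * Q" by (simp add: power2_eq_square mult_ac)
  then have "lam * N \<le> Q" using \<open>0 < lam\<close> by simp
  then show thesis using that[of g] g \<open>0 < N\<close> by (simp add: N_def Q_def)
qed

text \<open>\<open>\<Omega>\<close> may be any set of finite positive measure. It is replaced by a
  Borel set with the same integrals, and near-maximisers are scaled to norm 1, which leaves their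
  concentration unchanged.\<close>

lemma Phi_attained:
  assumes \<Omega>: "\<Omega> \<in> sets lebesgue" "emeasure lebesgue \<Omega> = ennreal s" "0 < s"
  shows "\<exists>f\<in>L2_nonzero. concentration \<Omega> f = \<Phi> \<Omega>"
proof -
  obtain B where B: "B \<in> sets borel" "AE z in lebesgue. z \<in> \<Omega> \<longleftrightarrow> z \<in> B" "emeasure lebesgue \<Omega> = emeasure lborel B"
    using lebesgue_set_ex_borel[OF \<Omega>(1)] by blast
  have EB: "energy_on \<Omega> f = (LINT z|lborel. indicator B z *\<^sub>R (norm (bstft f z))\<^sup>2)"
    if "f \<in> borel_measurable borel" for f
    unfolding energy_on_def set_lebesgue_integral_def using that
    by (intro lebesgue_set_integral_borel[OF _ B(1) \<Omega>(1) B(2)]) measurable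
  define lam where "lam = \<Phi> \<Omega>"
  \<comment> \<open>The Gaussian centred at the origin is positive everywhere, so its concentration
    on a set of positive measure is positive.\<close>
  have "0 < lam"
  proof -
    have i: "integrable lborel (\<lambda>z. indicator B z *\<^sub>R exp (- pi * (dist 0 z)\<^sup>2))"
    proof (rule Bochner_Integration.integrable_bound)
      show "integrable lborel (indicator B :: real \<times> real \<Rightarrow> real)"
        using B(1) by (intro integrable_real_indicator) (simp_all add: B(3)[symmetric] \<Omega>(2) del: emeasure_completion)
      show "(\<lambda>z. indicator B z *\<^sub>R exp (- pi * (dist 0 z)\<^sup>2)) \<in> borel_measurable lborel" using B(1) by measurable
    qed (auto simp: indicator_def)
    have "concentration \<Omega> (coherent 0) = (LINT z|lborel. indicator B z *\<^sub>R exp (- pi * (dist 0 z)\<^sup>2))"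
      unfolding concentration_coherent set_lebesgue_integral_def
      by (intro lebesgue_set_integral_borel[OF _ B(1) \<Omega>(1) B(2)]) measurable
    moreover have "(LINT z|lborel. indicator B z *\<^sub>R exp (- pi * (dist 0 z)\<^sup>2)) \<noteq> 0"
    proof
      assume "(LINT z|lborel. indicator B z *\<^sub>R exp (- pi * (dist 0 z)\<^sup>2)) = 0"
      then have "AE z in lborel. indicator B z *\<^sub>R exp (- pi * (dist (0::real\<times>real) z)\<^sup>2) = 0"
        by (subst (asm) integral_nonneg_eq_0_iff_AE[OF i]) auto
      then have "AE z in lborel. z \<notin> B" by eventually_elim (auto simp: indicator_def split: if_splits)
      then have "B \<in> null_sets lborel" using AE_iff_null_sets[of B lborel] B(1) by simp
      then show False using B(3) \<Omega> by (auto simp: null_sets_def)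
    qed
    ultimately have "concentration \<Omega> (coherent 0) \<noteq> 0" by (simp only: simp_thms)
    then have "0 < concentration \<Omega> (coherent 0)"
      using concentration_bounds(1)[OF coherent_facts(1) \<Omega>(1), of 0] by (metis less_le)
    then show ?thesis unfolding lam_def using concentration_le_Phi[OF coherent_facts(1) \<Omega>(1), of 0] by linarith
  qed
  have "\<exists>h. square_integrable lborel h \<and> (sqnorm h) = 1
      \<and> lam - 1 / real (Suc n) < energy_on \<Omega> h \<and> energy_on \<Omega> h \<le> lam" for n
  proof -
    have "lam - 1 / real (Suc n) < (SUP f\<in>L2_nonzero. concentration \<Omega> f)" by (simp add: lam_def \<Phi>_def)
    then obtain f where f: "f \<in> L2_nonzero" "lam - 1 / real (Suc n) < concentration \<Omega> f"
      using less_cSUP_iff[of L2_nonzero "concentration \<Omega>"] coherent_facts(1) concentration_bounds(2)[OF _ \<Omega>(1)]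
      by (metis bdd_aboveI2 empty_iff)
    have fL: "f \<in> L2_space" using f(1) by (simp add: L2_nonzero_def)
    obtain g where g: "square_integrable lborel g" "stft f = bstft g" "(L2_norm f)\<^sup>2 = sqnorm g"
      using L2_space_rep[OF fL] by blast
    define N where "N = sqnorm g"
    have N: "0 < N" using L2_nonzero_iff[OF fL] f(1) g(3) by (simp add: N_def)
    define h where "h y = of_real (1 / sqrt N) * g y" for y
    have nc: "(norm (complex_of_real (1 / sqrt N)))\<^sup>2 = 1 / N" using N by (simp add: power_divide norm_divide)
    have "sqnorm h = (LINT y|lborel. 1 / N * (norm (g y))\<^sup>2)"
      unfolding h_def norm_mult power_mult_distrib nc ..
    also have "\<dots> = 1 / N * N" by (subst integral_mult_right_zero) (simp add: N_def)
    also have "\<dots> = 1" using N by simp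
    finally have "sqnorm h = 1" .
    moreover have "square_integrable lborel h" unfolding h_def by (rule square_integrable_cmult[OF g(1)])
    moreover have "energy_on \<Omega> h = concentration \<Omega> f"
    proof -
      have "energy_on \<Omega> h = (norm (complex_of_real (1 / sqrt N)))\<^sup>2 * energy_on \<Omega> g"
        unfolding h_def by (rule energy_on_cmult)
      then show ?thesis unfolding nc concentration_eq[OF g(1,2)] N_def[symmetric] by simp
    qed
    ultimately show ?thesis using f concentration_le_Phi[OF f(1) \<Omega>(1)] by (auto simp: lam_def)
  qed
  then obtain h where h: "\<And>n. square_integrable lborel (h n)" "\<And>n. (LINT y|lborel. (norm (h n y))\<^sup>2) = 1"
    "\<And>n. lam - 1 / real (Suc n) < energy_on \<Omega> (h n)" "\<And>n. energy_on \<Omega> (h n) \<le> lam" by metis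
  have hm: "h n \<in> borel_measurable borel" for n using square_integrableD[OF h(1)] by simp
  have "(\<lambda>n. energy_on \<Omega> (h n)) \<longlonglongrightarrow> lam"
  proof (rule tendsto_sandwich)
    have "(\<lambda>n. lam - 1 / real (Suc n)) \<longlonglongrightarrow> lam - 0"
      by (intro tendsto_intros LIMSEQ_Suc lim_1_over_n)
    then show "(\<lambda>n. lam - 1 / real (Suc n)) \<longlonglongrightarrow> lam" by simp
    show "\<forall>\<^sub>F n in sequentially. lam - 1 / real (Suc n) \<le> energy_on \<Omega> (h n)"
      by (intro always_eventually allI less_imp_le h(3))
    show "\<forall>\<^sub>F n in sequentially. energy_on \<Omega> (h n) \<le> lam"
      by (intro always_eventually allI h(4))
  qed simp
  then have lim: "(\<lambda>n. LINT z|lborel. indicator B z *\<^sub>R (norm (bstft (h n) z))\<^sup>2) \<longlonglongrightarrow> lam"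
    using EB[OF hm] by simp
  have fin: "emeasure lborel B < \<infinity>"
    by (simp add: B(3)[symmetric] \<Omega>(2) del: emeasure_completion)
  obtain g where g: "square_integrable lborel g" "0 < sqnorm g"
    "lam * sqnorm g \<le> (LINT z|lborel. indicator B z *\<^sub>R (norm (bstft g z))\<^sup>2)"
    using maximiser_exists_borel[OF h(1,2) B(1) fin lim \<open>0 < lam\<close>] by blast
  note gL = square_integrable_imp_L2_space[OF g(1)]
  have gn: "g \<in> L2_nonzero" using L2_nonzero_iff[OF gL(1)] gL(3) g(2) by simp
  have "lam \<le> concentration \<Omega> g"
    unfolding concentration_eq[OF g(1) gL(2)] using g(2,3) EB square_integrableD(1)[OF g(1)] by (simp add: field_simps)
  then show ?thesis using gn concentration_le_Phi[OF gn \<Omega>(1)] by (auto simp: lam_def intro!: bexI[of _ g])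
qed

text \<open>\<open>stft_adjoint\<close> is a choice, so a function with the defining property has to
  be exhibited: \<open>synthesis F0\<close>, available because a bounded function on a set of finite
  measure is integrable. The quadratic form is then evaluated through the defining pairing.\<close>

lemma rayleigh_eq_concentration:
  assumes \<Omega>: "\<Omega> \<in> sets lebesgue" "emeasure lebesgue \<Omega> = ennreal s" and f: "f \<in> L2_space"
  shows "rayleigh_quotient \<Omega> f = concentration \<Omega> f"
proof -
  obtain B where B: "B \<in> sets borel" "AE z in lebesgue. z \<in> \<Omega> \<longleftrightarrow> z \<in> B" "emeasure lebesgue \<Omega> = emeasure lborel B"
    using lebesgue_set_ex_borel[OF \<Omega>(1)] by blast
  note [measurable] = B(1)
  obtain f0 where f0: "square_integrable lborel f0" "stft f = bstft f0" "(L2_norm f)\<^sup>2 = sqnorm f0"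
    using L2_space_rep[OF f] by blast
  have [measurable]: "f0 \<in> borel_measurable borel" using square_integrableD[OF f0(1)] by simp
  define F where "F z = indicator \<Omega> z * stft f z" for z
  define F0 where "F0 z = indicator B z * bstft f0 z" for z
  have iF0: "integrable lborel F0"
  proof (rule Bochner_Integration.integrable_bound)
    show "integrable lborel (\<lambda>z. sqrt (sqnorm f0) * indicator B z)"
      using B(1) by (intro integrable_mult_right integrable_real_indicator) (simp_all add: B(3)[symmetric] \<Omega>(2) del: emeasure_completion)
    show "AE z in lborel. norm (F0 z) \<le> norm (sqrt (sqnorm f0) * indicator B z)"
      using norm_bstft_le[OF f0(1)] by (intro AE_I2) (auto simp: F0_def indicator_def)
  qed (unfold F0_def, measurable)
  have inner: "L2_inner (stft h) F = (LINT z|lborel. bstft h0 z * cnj (F0 z))"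
    if h0: "h0 \<in> borel_measurable borel" "stft h = bstft h0" for h h0
  proof -
    have "L2_inner (stft h) F = (LINT z|lebesgue. indicator \<Omega> z *\<^sub>R (bstft h0 z * cnj (bstft f0 z)))"
      unfolding L2_inner_def F_def h0(2) f0(2)
      by (intro Bochner_Integration.integral_cong) (auto simp: indicator_def)
    also have "\<dots> = (LINT z|lborel. indicator B z *\<^sub>R (bstft h0 z * cnj (bstft f0 z)))"
      using borel_measurable_bstft[OF h0(1)] borel_measurable_cnj[OF borel_measurable_bstft[of f0]]
      by (intro lebesgue_set_integral_borel[OF _ B(1) \<Omega>(1) B(2)] borel_measurable_times) auto
    also have "\<dots> = (LINT z|lborel. bstft h0 z * cnj (F0 z))"
      unfolding F0_def by (intro Bochner_Integration.integral_cong) (auto simp: indicator_def)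
    finally show ?thesis .
  qed
  have "\<exists>g. g \<in> L2_space \<and> (\<forall>h\<in>L2_space. L2_inner (stft h) F = L2_inner h g)"
  proof (intro exI conjI ballI)
    have sg: "square_integrable lborel (synthesis F0)" by (rule synthesis_adjoint(1)[OF iF0])
    then show "synthesis F0 \<in> L2_space" by (rule square_integrable_imp_L2_space)
    fix h :: "real \<Rightarrow> complex" assume h: "h \<in> L2_space"
    obtain h0 where h0: "square_integrable lborel h0" "AE x in lborel. h x = h0 x" "stft h = bstft h0"
      using L2_space_rep[OF h] by blast
    have sm: "synthesis F0 \<in> borel_measurable lborel" and hm: "h0 \<in> borel_measurable lborel"
      using square_integrableD(1)[OF sg] square_integrableD(1)[OF h0(1)] by auto
    have "L2_inner (stft h) F = (LINT z|lborel. bstft h0 z * cnj (F0 z))"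
      using hm h0(3) by (intro inner) auto
    also have "\<dots> = (LINT y|lborel. h0 y * cnj (synthesis F0 y))"
      by (rule synthesis_adjoint(2)[OF iF0 h0(1), symmetric])
    also have "\<dots> = (LINT y|lebesgue. h0 y * cnj (synthesis F0 y))"
      by (intro integral_completion[symmetric] borel_measurable_times hm borel_measurable_cnj sm)
    also have "\<dots> = L2_inner h (synthesis F0)"
      unfolding L2_inner_def
    proof (rule integral_cong_AE)
      have "h \<in> borel_measurable lebesgue" using h by (simp add: L2_space_def)
      then show "(\<lambda>x. h x * cnj (synthesis F0 x)) \<in> borel_measurable lebesgue"
        by (intro borel_measurable_times borel_measurable_cnj measurable_completion[OF sm])
      show "(\<lambda>x. h0 x * cnj (synthesis F0 x)) \<in> borel_measurable lebesgue"
        by (intro borel_measurable_times borel_measurable_cnj measurable_completion[OF sm] measurable_completion[OF hm])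
      show "AE x in lebesgue. h0 x * cnj (synthesis F0 x) = h x * cnj (synthesis F0 x)"
        using AE_completion[OF h0(2)] by eventually_elim simp
    qed
    finally show "L2_inner (stft h) F = L2_inner h (synthesis F0)" .
  qed
  from someI_ex[OF this] have adj: "\<And>h. h \<in> L2_space \<Longrightarrow> L2_inner (stft h) F = L2_inner h (stft_adjoint F)"
    unfolding stft_adjoint_def by blast
  have "L2_inner (stft_adjoint F) f = cnj (L2_inner f (stft_adjoint F))"
    unfolding L2_inner_def Bochner_Integration.integral_cnj[symmetric] by (simp add: mult.commute)
  also have "L2_inner f (stft_adjoint F) = L2_inner (stft f) F" by (rule adj[OF f, symmetric])
  finally have "Re (L2_inner (stft_adjoint F) f) = Re (L2_inner (stft f) F)" by simp
  also have "L2_inner (stft f) F = (LINT z|lebesgue. of_real (indicator \<Omega> z *\<^sub>R (norm (bstft f0 z))\<^sup>2))"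
    unfolding L2_inner_def F_def f0(2)
    by (intro Bochner_Integration.integral_cong) (auto simp: indicator_def complex_norm_square simp del: of_real_power)
  also have "\<dots> = of_real (energy_on \<Omega> f0)"
    unfolding energy_on_def set_lebesgue_integral_def by (rule integral_complex_of_real)
  finally have "rayleigh_quotient \<Omega> f = energy_on \<Omega> f0 / sqnorm f0"
    by (simp add: rayleigh_quotient_def F_def f0(3))
  then show ?thesis by (simp add: concentration_eq[OF f0(1,2)])
qed

section \<open>The Faber--Krahn inequality\<close>

lemma sym_diff_null_trans:
  assumes "sym_diff A B \<in> null_sets lebesgue" "sym_diff A C \<in> null_sets lebesgue"
    and "B \<in> sets lebesgue" "C \<in> sets lebesgue"
  shows "sym_diff B C \<in> null_sets lebesgue"
proof (rule null_sets_subset)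
  show "sym_diff A B \<union> sym_diff A C \<in> null_sets lebesgue" using assms by blast
  show "sym_diff B C \<in> sets lebesgue" using assms(3,4) by (intro sets.Un sets.Diff)
qed auto

text \<open>For distinct centres one ball minus the closed other one is open and nonempty, hence not
  negligible.\<close>

lemma ball_sym_diff_null_imp_center_eq:
  fixes p q :: "'a::euclidean_space"
  assumes "0 < r" and null: "sym_diff (ball p r) (ball q r) \<in> null_sets lebesgue"
  shows "p = q"
proof (rule ccontr)
  assume "p \<noteq> q"
  define d where "d = norm (p - q)"
  have "d > 0" using \<open>p \<noteq> q\<close> by (simp add: d_def)
  \<comment> \<open>The distance from \<open>p\<close>, on the side facing away from
    \<open>q\<close>, at which a point lies inside the first ball and outside the closed second one:
    this needs \<open>t < r\<close> and \<open>r < d + t\<close>.\<close>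
  define t where "t = max 0 (r - d / 2)"
  have t: "0 \<le> t" "t < r" "r < d + t" using \<open>0 < r\<close> \<open>d > 0\<close> by (auto simp: t_def)
  define x where "x = p + (t / d) *\<^sub>R (p - q)"
  have "norm (x - p) = t" using t \<open>d > 0\<close> by (simp add: x_def d_def[symmetric])
  moreover have "norm (x - q) = d + t"
  proof -
    have "x - q = (1 + t / d) *\<^sub>R (p - q)" by (simp add: x_def algebra_simps)
    then have "norm (x - q) = (1 + t / d) * d" using t \<open>d > 0\<close> by (simp add: d_def[symmetric])
    then show ?thesis using \<open>d > 0\<close> by (simp add: distrib_right)
  qed
  ultimately have "x \<in> ball p r - cball q r" using t by (simp add: dist_norm norm_minus_commute)
  then have "ball p r - cball q r \<noteq> {}" by blast
  moreover have "open (ball p r - cball q r)" by (intro open_Diff) auto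
  ultimately have "\<not> negligible (ball p r - cball q r)" by (intro open_not_negligible)
  moreover have "negligible (ball p r - cball q r)"
  proof (rule negligible_subset)
    show "negligible (sym_diff (ball p r) (ball q r))" using null by (simp add: negligible_iff_null_sets)
  qed auto
  ultimately show False by blast
qed

lemma emeasure_eq_of_sym_diff_null:
  assumes "sym_diff A B \<in> null_sets lebesgue" "A \<in> sets lebesgue" "B \<in> sets lebesgue"
  shows "emeasure lebesgue A = emeasure lebesgue B"
proof (rule emeasure_eq_AE)
  show "AE x in lebesgue. x \<in> A \<longleftrightarrow> x \<in> B"
    using AE_not_in[OF assms(1)] by eventually_elim blast
qed (use assms in auto)

lemma ball_radius_of_emeasure:
  fixes p :: "real \<times> real"
  assumes "0 \<le> r" "emeasure lebesgue (ball p r) = ennreal s" "0 < s"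
  shows "r = sqrt (s / pi)"
proof -
  have "emeasure lebesgue (ball p r) = ennreal (pi * r\<^sup>2)"
    using assms(1) by (subst emeasure_completion) (simp_all add: emeasure_ball unit_ball_vol_2 power2_eq_square)
  then have "pi * r\<^sup>2 = s" using assms by (simp add: ennreal_inj)
  then have "s / pi = r\<^sup>2" by (simp add: field_simps)
  then show ?thesis using assms(1) by simp
qed

text \<open>Attainment for an arbitrary set rests on compactness. The other two claims rest on the
  value \<open>1 - exp (- s)\<close>: it bounds every concentration, and its equality case
  determines the disc and the function together.\<close>

theorem theorem1p1:
  fixes s :: real
  assumes "0 < s"
  shows
    "(\<forall>\<Omega>\<in>sets lebesgue. emeasure lebesgue \<Omega> = ennreal s \<longrightarrow>
        (\<exists>f. is_arg_max (concentration \<Omega>) (\<lambda>f. f \<in> L2_nonzero) f \<and> concentration \<Omega> f = \<Phi> \<Omega>) \<and>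
        (\<exists>f. is_arg_max (rayleigh_quotient \<Omega>) (\<lambda>f. f \<in> L2_nonzero) f \<and>
             rayleigh_quotient \<Omega> f = \<Phi> \<Omega>)) \<and>
     (\<forall>\<Omega>\<in>sets lebesgue. emeasure lebesgue \<Omega> = ennreal s \<longrightarrow>
        (is_arg_max \<Phi> (\<lambda>\<Omega>'. \<Omega>' \<in> sets lebesgue \<and> emeasure lebesgue \<Omega>' = ennreal s) \<Omega> \<longleftrightarrow>
         (\<exists>p r. 0 < r \<and> sym_diff \<Omega> (ball p r) \<in> null_sets lebesgue))) \<and>
     (\<forall>\<Omega> x\<^sub>0 \<omega>\<^sub>0 r. (\<Omega> = ball (x\<^sub>0, \<omega>\<^sub>0) r \<or> \<Omega> = cball (x\<^sub>0, \<omega>\<^sub>0) r) \<and>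
        emeasure lebesgue \<Omega> = ennreal s \<longrightarrow>
        (\<forall>f\<in>L2_space. is_arg_max (concentration \<Omega>) (\<lambda>f. f \<in> L2_nonzero) f \<longleftrightarrow>
           (\<exists>c. c \<noteq> 0 \<and> (AE x in lebesgue.
              f x = c * exp (2 * of_real pi * \<i> * of_real \<omega>\<^sub>0 * of_real x) *
                    of_real (gaussian (x - x\<^sub>0))))))"
proof (intro conjI ballI allI impI)
  fix \<Omega> :: "(real \<times> real) set"
  assume \<Omega>: "\<Omega> \<in> sets lebesgue" "emeasure lebesgue \<Omega> = ennreal s"
  obtain f where f: "f \<in> L2_nonzero" "concentration \<Omega> f = \<Phi> \<Omega>"
    using Phi_attained[OF \<Omega> assms] by blast
  have le: "concentration \<Omega> g \<le> \<Phi> \<Omega>" if "g \<in> L2_nonzero" for g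
    using that \<Omega>(1) by (rule concentration_le_Phi)
  have R: "rayleigh_quotient \<Omega> g = concentration \<Omega> g" if "g \<in> L2_nonzero" for g
    using that by (intro rayleigh_eq_concentration[OF \<Omega>]) (simp add: L2_nonzero_def)
  show "\<exists>f. is_arg_max (concentration \<Omega>) (\<lambda>f. f \<in> L2_nonzero) f \<and> concentration \<Omega> f = \<Phi> \<Omega>"
    using f le by (intro exI[of _ f]) (auto simp: is_arg_max_def not_less)
  show "\<exists>f. is_arg_max (rayleigh_quotient \<Omega>) (\<lambda>f. f \<in> L2_nonzero) f \<and> rayleigh_quotient \<Omega> f = \<Phi> \<Omega>"
    using f le R by (intro exI[of _ f]) (auto simp: is_arg_max_def not_less)
next
  fix \<Omega> :: "(real \<times> real) set"
  assume \<Omega>: "\<Omega> \<in> sets lebesgue" "emeasure lebesgue \<Omega> = ennreal s"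
  define \<rho> where "\<rho> = sqrt (s / pi)"
  have "0 < \<rho>" using assms by (simp add: \<rho>_def)
  \<comment> \<open>A competitor of area \<open>s\<close> for which the bound
    \<open>1 - exp (- s)\<close> is reached, so that every maximising set must reach it.\<close>
  define D where "D = ball (0 :: real \<times> real) \<rho>"
  have D: "D \<in> sets lebesgue" "emeasure lebesgue D = ennreal s"
  proof -
    show "D \<in> sets lebesgue" by (simp add: D_def)
    have "emeasure lebesgue D = ennreal (pi * \<rho>\<^sup>2)"
      unfolding D_def using \<open>0 < \<rho>\<close> by (subst emeasure_completion) (simp_all add: emeasure_ball unit_ball_vol_2 power2_eq_square)
    then show "emeasure lebesgue D = ennreal s" using assms by (simp add: \<rho>_def)
  qed
  have le: "\<Phi> \<Omega>' \<le> 1 - exp (- s)" if "\<Omega>' \<in> sets lebesgue" "emeasure lebesgue \<Omega>' = ennreal s" for \<Omega>'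
    unfolding \<Phi>_def using concentration_cases(1)[OF _ that assms] coherent_facts(1)
    by (intro cSUP_least) auto
  have eq: "\<Phi> \<Omega>' = 1 - exp (- s)"
    if "\<Omega>' \<in> sets lebesgue" "emeasure lebesgue \<Omega>' = ennreal s" "sym_diff \<Omega>' (ball p \<rho>) \<in> null_sets lebesgue" for \<Omega>' p
  proof -
    have "concentration \<Omega>' (coherent p) = 1 - exp (- s)"
      unfolding concentration_coherent using gaussian_mass_on(2)[OF that(1,2) assms, of p] that(3) by (simp add: \<rho>_def)
    then show ?thesis
      using le[OF that(1,2)] concentration_le_Phi[OF coherent_facts(1) that(1), of p] by simp
  qed
  have \<Phi>D: "\<Phi> D = 1 - exp (- s)" by (rule eq[OF D, of 0]) (simp add: D_def)
  show "is_arg_max \<Phi> (\<lambda>\<Omega>'. \<Omega>' \<in> sets lebesgue \<and> emeasure lebesgue \<Omega>' = ennreal s) \<Omega> \<longleftrightarrow>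
         (\<exists>p r. 0 < r \<and> sym_diff \<Omega> (ball p r) \<in> null_sets lebesgue)"
  proof
    assume "is_arg_max \<Phi> (\<lambda>\<Omega>'. \<Omega>' \<in> sets lebesgue \<and> emeasure lebesgue \<Omega>' = ennreal s) \<Omega>"
    then have "\<Phi> D \<le> \<Phi> \<Omega>" using D by (auto simp: is_arg_max_def not_less)
    then have "\<Phi> \<Omega> = 1 - exp (- s)" using le[OF \<Omega>] \<Phi>D by simp
    \<comment> \<open>\<open>\<Phi>\<close> is a supremum; attainment supplies a function to which
      the equality case can be applied.\<close>
    moreover obtain f where f: "f \<in> L2_nonzero" "concentration \<Omega> f = \<Phi> \<Omega>"
      using Phi_attained[OF \<Omega> assms] by blast
    ultimately have "concentration \<Omega> f = 1 - exp (- s)" by simp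
    from concentration_cases(2)[OF f(1) \<Omega> assms this]
    show "\<exists>p r. 0 < r \<and> sym_diff \<Omega> (ball p r) \<in> null_sets lebesgue"
      using \<open>0 < \<rho>\<close> unfolding \<rho>_def by blast
  next
    assume "\<exists>p r. 0 < r \<and> sym_diff \<Omega> (ball p r) \<in> null_sets lebesgue"
    then obtain p r where pr: "0 < r" "sym_diff \<Omega> (ball p r) \<in> null_sets lebesgue" by blast
    have "emeasure lebesgue (ball p r) = ennreal s"
      using emeasure_eq_of_sym_diff_null[OF pr(2) \<Omega>(1)] \<Omega>(2) by simp
    then have "r = \<rho>" unfolding \<rho>_def using pr(1) assms by (intro ball_radius_of_emeasure) auto
    then have "\<Phi> \<Omega> = 1 - exp (- s)" using eq[OF \<Omega>] pr(2) by blast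
    then show "is_arg_max \<Phi> (\<lambda>\<Omega>'. \<Omega>' \<in> sets lebesgue \<and> emeasure lebesgue \<Omega>' = ennreal s) \<Omega>"
      using \<Omega> le by (auto simp: is_arg_max_def not_less)
  qed
next
  fix \<Omega> :: "(real \<times> real) set" and x\<^sub>0 \<omega>\<^sub>0 r :: real and f :: "real \<Rightarrow> complex"
  assume \<Omega>': "(\<Omega> = ball (x\<^sub>0, \<omega>\<^sub>0) r \<or> \<Omega> = cball (x\<^sub>0, \<omega>\<^sub>0) r) \<and> emeasure lebesgue \<Omega> = ennreal s"
    and f: "f \<in> L2_space"
  define p where "p = (x\<^sub>0, \<omega>\<^sub>0)"
  define \<rho> where "\<rho> = sqrt (s / pi)"
  have "0 < \<rho>" using assms by (simp add: \<rho>_def)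
  have \<Omega>: "\<Omega> \<in> sets lebesgue" "emeasure lebesgue \<Omega> = ennreal s" using \<Omega>' by auto
  have sph: "sphere p r \<in> null_sets lebesgue"
    using negligible_sphere negligible_iff_null_sets by blast
  have sd: "sym_diff \<Omega> (ball p r) \<in> null_sets lebesgue"
  proof (rule null_sets_subset[OF sph])
    have "ball p r \<in> sets lebesgue" by simp
    with \<Omega>(1) show "sym_diff \<Omega> (ball p r) \<in> sets lebesgue" by (intro sets.Un sets.Diff)
    show "sym_diff \<Omega> (ball p r) \<subseteq> sphere p r" using \<Omega>' by (auto simp: p_def)
  qed
  have eb: "emeasure lebesgue (ball p r) = ennreal s"
    using emeasure_eq_of_sym_diff_null[OF sd \<Omega>(1)] \<Omega>(2) by simp
  \<comment> \<open>The sign of \<open>r\<close> is left open in the claim; a negative radius would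
    give an empty ball, contradicting the positive area.\<close>
  have "0 \<le> r"
  proof (rule ccontr)
    assume "\<not> 0 \<le> r"
    then have E: "ball p r = {}" by simp
    show False using eb assms unfolding E by simp
  qed
  then have "r = \<rho>" unfolding \<rho>_def using eb assms by (intro ball_radius_of_emeasure)
  have sd\<rho>: "sym_diff \<Omega> (ball p \<rho>) \<in> null_sets lebesgue" using sd by (simp add: \<open>r = \<rho>\<close>)
  have cp: "concentration \<Omega> (coherent p) = 1 - exp (- s)"
    unfolding concentration_coherent using gaussian_mass_on(2)[OF \<Omega> assms, of p] sd\<rho> by (simp add: \<rho>_def)
  \<comment> \<open>The translated window appears here with the argument
    \<open>x - x\<^sub>0\<close>, and with the opposite sign in \<open>coherent\<close>; the
    Gaussian is even.\<close>
  have form: "c * exp (2 * of_real pi * \<i> * of_real \<omega>\<^sub>0 * of_real x) * of_real (gaussian (x - x\<^sub>0)) = c * coherent p x" for c x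
    using gaussian_minus[of "x - x\<^sub>0"] by (simp add: coherent_def p_def mult_ac)
  show "is_arg_max (concentration \<Omega>) (\<lambda>f. f \<in> L2_nonzero) f \<longleftrightarrow>
     (\<exists>c. c \<noteq> 0 \<and> (AE x in lebesgue. f x = c * exp (2 * of_real pi * \<i> * of_real \<omega>\<^sub>0 * of_real x) * of_real (gaussian (x - x\<^sub>0))))"
    unfolding form
  proof
    assume "is_arg_max (concentration \<Omega>) (\<lambda>f. f \<in> L2_nonzero) f"
    then have fn: "f \<in> L2_nonzero" and "concentration \<Omega> (coherent p) \<le> concentration \<Omega> f"
      using coherent_facts(1) by (auto simp: is_arg_max_def not_less)
    then have "concentration \<Omega> f = 1 - exp (- s)"
      using concentration_cases(1)[OF fn \<Omega> assms] cp by simp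
    from concentration_cases(2)[OF fn \<Omega> assms this] obtain q c where q: "c \<noteq> 0"
      "AE x in lebesgue. f x = c * coherent q x" "sym_diff \<Omega> (ball q \<rho>) \<in> null_sets lebesgue"
      unfolding \<rho>_def by blast
    \<comment> \<open>The equality case returns a coherent state with some centre \<open>q\<close>.
      Since \<open>\<Omega>\<close> agrees almost everywhere with the balls about \<open>p\<close>
      and \<open>q\<close> of the same radius, the centres coincide.\<close>
    have "p = q"
      using sym_diff_null_trans[OF sd\<rho> q(3)] by (intro ball_sym_diff_null_imp_center_eq[OF \<open>0 < \<rho>\<close>]) auto
    with q show "\<exists>c. c \<noteq> 0 \<and> (AE x in lebesgue. f x = c * coherent p x)" by blast
  next
    assume "\<exists>c. c \<noteq> 0 \<and> (AE x in lebesgue. f x = c * coherent p x)"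
    then obtain c where c: "c \<noteq> 0" "AE x in lebesgue. f x = c * coherent p x" by blast
    obtain g where g: "square_integrable lborel g" "AE x in lborel. f x = g x" "stft f = bstft g"
      "(L2_norm f)\<^sup>2 = sqnorm g"
      using L2_space_rep[OF f] by blast
    have gm: "g \<in> borel_measurable borel" and cm: "(\<lambda>x. c * coherent p x) \<in> borel_measurable borel"
      using square_integrableD(1)[OF g(1)] by auto
    have "AE x in lborel. g x = c * coherent p x"
      using g(2) c(2)[unfolded AE_completion_iff] by eventually_elim simp
    then have bg: "bstft g = bstft (\<lambda>x. c * coherent p x)"
      and Ng: "sqnorm g = (LINT y|lborel. (norm (c * coherent p y))\<^sup>2)"
      using gm cm by (auto intro!: bstft_cong_AE integral_cong_AE)
    have "(LINT y|lborel. (norm (c * coherent p y))\<^sup>2) = (norm c)\<^sup>2"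
      by (simp add: norm_mult power_mult_distrib square_integrable_coherent(2))
    then have N: "sqnorm g = (norm c)\<^sup>2" using Ng by simp
    have fn: "f \<in> L2_nonzero" using L2_nonzero_iff[OF f] g(4) N c(1) by simp
    have "energy_on \<Omega> g = energy_on \<Omega> (\<lambda>x. c * coherent p x)" by (simp add: energy_on_def bg)
    also have "\<dots> = (norm c)\<^sup>2 * energy_on \<Omega> (coherent p)" by (rule energy_on_cmult)
    also have "energy_on \<Omega> (coherent p) = 1 - exp (- s)"
      using cp concentration_eq[OF square_integrable_coherent(1) square_integrable_imp_L2_space(2)[OF square_integrable_coherent(1)], of \<Omega> p]
      by (simp add: square_integrable_coherent(2))
    finally have "concentration \<Omega> f = 1 - exp (- s)"
      unfolding concentration_eq[OF g(1,3)] N using c(1) by simp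
    then show "is_arg_max (concentration \<Omega>) (\<lambda>f. f \<in> L2_nonzero) f"
      using fn concentration_cases(1)[OF _ \<Omega> assms] by (auto simp: is_arg_max_def not_less)
  qed
qed

end
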